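(* (Leading Derivatives Theorem.) Let $N\ge 1$ and let $A,B$ be $N\times N$ normal complex matrices. For any integer $d$ with $1\leq d\leq N$, we have the absolutely convergent series representation \[ \mathbf{F}_N^{(d)}(0;A,B)=\sum_{g=0}^{\infty}\frac{C_{g,d}(A,B)}{N^{2g}}, \] where \[ C_{g,d}(A,B)=\sum_{\alpha,\beta\vdash d}(-1)^{d+\ell(\alpha)+\ell(\beta)}\,\vec{H}_g(\alpha,\beta)\,\big(N^{-\ell(\alpha)}p_\alpha(A)\big)\big(N^{-\ell(\beta)}p_\beta(B)\big). \]
   Context: $\kappa_N$ denotes the normalized Haar probability measure on the unitary group $\mathrm{U}(N)$. The HCIZ integral is the entire function $\mathbf{I}_N(z;A,B)=\int_{\mathrm{U}(N)}e^{-zN\operatorname{Tr}(AUBU^{-1})}\,\kappa_N(\mathrm{d}U)$, $z\in\mathbb{C}$; it satisfies $\mathbf{I}_N(0;A,B)=1$. The free energy $\mathbf{F}_N(z;A,B)$ is the unique holomorphic function on a simply connected domain containing $0$ on which $\mathbf{I}_N$ does not vanish, such that $\mathbf{F}_N(0;A,B)=0$ and $\mathbf{I}_N(z;A,B)=e^{N^2\mathbf{F}_N(z;A,B)}$; $\mathbf{F}_N^{(d)}(0;A,B)$ is its $d$-th derivative at $z=0$. For a partition $\alpha=(\alpha_1,\dots,\alpha_{\ell(\alpha)})\vdash d$ with $\ell(\alpha)$ parts, $p_\alpha(A)=\prod_{i=1}^{\ell(\alpha)}\operatorname{Tr}(A^{\alpha_i})$. For $g\ge 0$ and $\alpha,\beta\vdash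 d$, the monotone double Hurwitz number $\vec{H}_g(\alpha,\beta)$ is the number of $(r+2)$-tuples $(\rho,\sigma,\tau_1,\dots,\tau_r)$ of permutations in the symmetric group $S(d)$, where $r=2g-2+\ell(\alpha)+\ell(\beta)$ (and $\vec H_g(\alpha,\beta)=0$ if $r<0$), such that: (1) $\rho$ has cycle type $\alpha$, $\sigma$ has cycle type $\beta$, and each $\tau_i$ is a transposition; (2) $\rho\sigma\tau_1\cdots\tau_r$ is the identity; (3) the subgroup $\langle\rho,\sigma,\tau_1,\dots,\tau_r\rangle$ acts transitively on $\{1,\dots,d\}$; (4) writing $\tau_i=(s_i\ t_i)$ with $s_i<t_i$, one has $t_1\le t_2\le\dots\le t_r$. *)

theory Defs
  imports
    "HOL-Analysis.Analysis"
    "HOL-Library.Multiset"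
    "HOL-Combinatorics.Orbits"
    "HOL-Algebra.Sym_Groups"
begin

subsection \<open>Matrices and the unitary group\<close>

text \<open>
  \<open>N \<times> N\<close> complex matrices are elements of \<open>complex^'n^'n\<close>, with \<open>N = CARD('n)\<close>.
  Matrix multiplication is \<open>**\<close>; the class operations \<open>*\<close> and \<open>^\<close> act entrywise on this
  type, so matrix powers are defined by iterating \<open>**\<close>.
\<close>

definition conj_transpose :: "complex^'n^'n \<Rightarrow> complex^'n^'n" where
  "conj_transpose A = map_matrix cnj (Finite_Cartesian_Product.transpose A)"

definition matrix_power :: "complex^'n^'n \<Rightarrow> nat \<Rightarrow> complex^'n^'n" where
  "matrix_power A k = ((\<lambda>X. A ** X) ^^ k) (mat 1)"

definition normal_matrix :: "complex^'n^'n \<Rightarrow> bool" where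
  "normal_matrix A \<longleftrightarrow> A ** conj_transpose A = conj_transpose A ** A"

definition unitary_group :: "(complex^'n^'n) set" where
  "unitary_group = {U. U ** conj_transpose U = mat 1 \<and> conj_transpose U ** U = mat 1}"

text \<open>
  The normalized Haar measure on \<open>U(N)\<close> is characterized as the left-invariant Borel
  probability measure on the unitary group.
\<close>

definition is_unitary_haar :: "(complex^'n^'n) measure \<Rightarrow> bool" where
  "is_unitary_haar \<kappa> \<longleftrightarrow>
     sets \<kappa> = sets (restrict_space borel unitary_group) \<and>
     emeasure \<kappa> (space \<kappa>) = 1 \<and>
     (\<forall>U\<in>unitary_group. distr \<kappa> \<kappa> (\<lambda>V. U ** V) = \<kappa>)"

subsection \<open>The HCIZ integral and its free energy\<close>

definition hciz ::
  "(complex^'n^'n) measure \<Rightarrow> complex \<Rightarrow> complex^'n^'n \<Rightarrow> complex^'n^'n \<Rightarrow> complex" where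
  "hciz \<kappa> z A B =
     (\<integral>U. exp (- z * of_nat CARD('n) * trace (A ** U ** B ** matrix_inv U)) \<partial>\<kappa>)"

text \<open>
  The two conditions on \<open>F\<close> determine its values on \<open>D\<close>; values outside \<open>D\<close> are irrelevant.
\<close>

definition is_free_energy ::
  "(complex^'n^'n) measure \<Rightarrow> complex^'n^'n \<Rightarrow> complex^'n^'n \<Rightarrow> complex set \<Rightarrow>
    (complex \<Rightarrow> complex) \<Rightarrow> bool" where
  "is_free_energy \<kappa> A B D F \<longleftrightarrow>
     open D \<and> simply_connected D \<and> 0 \<in> D \<and> (\<forall>z\<in>D. hciz \<kappa> z A B \<noteq> 0) \<and>
     F holomorphic_on D \<and> F 0 = 0 \<and>
     (\<forall>z\<in>D. hciz \<kappa> z A B = exp (of_nat (CARD('n)^2) * F z))"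

subsection \<open>Partitions\<close>

text \<open>A partition is the multiset of its (positive) parts, so \<open>\<ell>(\<alpha>)\<close> is \<open>size \<alpha>\<close>.\<close>

definition partitions :: "nat \<Rightarrow> nat multiset set" where
  "partitions d = {\<alpha>. 0 \<notin># \<alpha> \<and> sum_mset \<alpha> = d}"

definition power_sum :: "nat multiset \<Rightarrow> complex^'n^'n \<Rightarrow> complex" where
  "power_sum \<alpha> A = (\<Prod>k\<in>#\<alpha>. trace (matrix_power A k))"

lemma finite_partitions: "finite (partitions d)"
proof (rule finite_subset)
  show "partitions d \<subseteq> mset ` {xs. set xs \<subseteq> {..d} \<and> length xs \<le> d}"
  proof
    fix \<alpha> assume \<alpha>: "\<alpha> \<in> partitions d"
    have "size \<alpha> \<le> sum_mset \<alpha>" if "0 \<notin># \<alpha>" for \<alpha> :: "nat multiset"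
      using that by (induction \<alpha>) auto
    with \<alpha> have "size \<alpha> \<le> d"
      by (auto simp: partitions_def)
    moreover have "k \<le> d" if "k \<in># \<alpha>" for k
      using \<alpha> multi_member_split[OF that] by (auto simp: partitions_def)
    moreover obtain xs where xs: "mset xs = \<alpha>"
      using ex_mset by blast
    ultimately have "set xs \<subseteq> {..d}" "length xs \<le> d"
      by auto
    with xs show "\<alpha> \<in> mset ` {xs. set xs \<subseteq> {..d} \<and> length xs \<le> d}"
      by blast
  qed
  show "finite (mset ` {xs. set xs \<subseteq> {..d} \<and> length xs \<le> d})"
    by (intro finite_imageI finite_lists_length_le) auto
qed

subsection \<open>Monotone double Hurwitz numbers\<close>

text \<open>Fixed points contribute parts equal to 1.\<close>

definition cycle_type :: "nat \<Rightarrow> (nat \<Rightarrow> nat) \<Rightarrow> nat multiset" where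
  "cycle_type d \<rho> = image_mset card (mset_set (orbit \<rho> ` {1..d}))"

definition monotone_transpositions :: "nat \<Rightarrow> (nat \<Rightarrow> nat) list \<Rightarrow> bool" where
  "monotone_transpositions d \<tau>s \<longleftrightarrow>
     (\<exists>s t. (\<forall>i<length \<tau>s. 1 \<le> s i \<and> s i < t i \<and> t i \<le> d \<and>
                           \<tau>s ! i = Transposition.transpose (s i) (t i)) \<and>
            (\<forall>i j. i \<le> j \<and> j < length \<tau>s \<longrightarrow> t i \<le> t j))"

definition generates_transitive :: "nat \<Rightarrow> (nat \<Rightarrow> nat) set \<Rightarrow> bool" where
  "generates_transitive d S \<longleftrightarrow>
     (\<forall>x\<in>{1..d}. \<forall>y\<in>{1..d}. \<exists>\<pi>\<in>generate (sym_group d) S. \<pi> x = y)"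

definition hurwitz_tuples ::
  "nat \<Rightarrow> nat \<Rightarrow> nat multiset \<Rightarrow> nat multiset \<Rightarrow>
    ((nat \<Rightarrow> nat) \<times> (nat \<Rightarrow> nat) \<times> (nat \<Rightarrow> nat) list) set" where
  "hurwitz_tuples d r \<alpha> \<beta> = {(\<rho>, \<sigma>, \<tau>s).
     \<rho> permutes {1..d} \<and> \<sigma> permutes {1..d} \<and> length \<tau>s = r \<and>
     cycle_type d \<rho> = \<alpha> \<and> cycle_type d \<sigma> = \<beta> \<and>
     monotone_transpositions d \<tau>s \<and>
     \<rho> \<circ> \<sigma> \<circ> foldr (\<circ>) \<tau>s id = id \<and>
     generates_transitive d ({\<rho>, \<sigma>} \<union> set \<tau>s)}"

text \<open>
  The number \<open>r\<close> of transpositions is \<open>2g - 2 + \<ell>(\<alpha>) + \<ell>(\<beta>)\<close>; the case distinction keeps the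
  subtraction on \<open>nat\<close> from truncating. For \<open>\<alpha>, \<beta> \<turnstile> d\<close> the degree \<open>d\<close> is \<open>sum_mset \<alpha>\<close>, but
  it is kept as an explicit argument.
\<close>

definition monotone_hurwitz :: "nat \<Rightarrow> nat \<Rightarrow> nat multiset \<Rightarrow> nat multiset \<Rightarrow> nat" where
  "monotone_hurwitz d g \<alpha> \<beta> =
     (if 2 * g + size \<alpha> + size \<beta> < 2 then 0
      else card (hurwitz_tuples d (2 * g + size \<alpha> + size \<beta> - 2) \<alpha> \<beta>))"

lemma finite_hurwitz_tuples: "finite (hurwitz_tuples d r \<alpha> \<beta>)"
proof (rule finite_subset)
  let ?P = "{\<pi>. \<pi> permutes {1..d}}"
  have "\<tau> permutes {1..d}" if "monotone_transpositions d \<tau>s" "\<tau> \<in> set \<tau>s" for \<tau> \<tau>s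
  proof -
    from that(2) obtain i where i: "i < length \<tau>s" "\<tau> = \<tau>s ! i"
      by (auto simp: in_set_conv_nth)
    with that(1) obtain s t :: "nat \<Rightarrow> nat"
      where "1 \<le> s i" "s i < t i" "t i \<le> d" "\<tau> = Transposition.transpose (s i) (t i)"
      unfolding monotone_transpositions_def by blast
    then have "s i \<in> {1..d}" "t i \<in> {1..d}"
      by simp_all
    then show ?thesis
      unfolding \<open>\<tau> = Transposition.transpose (s i) (t i)\<close> by (rule permutes_swap_id)
  qed
  then show "hurwitz_tuples d r \<alpha> \<beta> \<subseteq> ?P \<times> ?P \<times> {\<tau>s. set \<tau>s \<subseteq> ?P \<and> length \<tau>s = r}"
    by (auto simp: hurwitz_tuples_def)
  show "finite (?P \<times> ?P \<times> {\<tau>s. set \<tau>s \<subseteq> ?P \<and> length \<tau>s = r})"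
    by (intro finite_cartesian_product finite_lists_length_eq finite_permutations) auto
qed

definition leading_coeff ::
  "nat \<Rightarrow> nat \<Rightarrow> complex^'n^'n \<Rightarrow> complex^'n^'n \<Rightarrow> complex" where
  "leading_coeff g d A B =
     (\<Sum>\<alpha>\<in>partitions d. \<Sum>\<beta>\<in>partitions d.
        (-1) ^ (d + size \<alpha> + size \<beta>) * of_nat (monotone_hurwitz d g \<alpha> \<beta>) *
        (power_sum \<alpha> A / of_nat CARD('n) ^ size \<alpha>) *
        (power_sum \<beta> B / of_nat CARD('n) ^ size \<beta>))"

end

theory Submission
  imports Defs "HOL-Complex_Analysis.Complex_Analysis"
begin

text \<open>
  Let \<open>X\<close> be the average over \<open>U\<close> of the tensor product of matrices \<open>U B\<^sub>k U\<^sup>*\<close>. Left invariance of Haar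
  measure under one-parameter groups of unitaries, contracted at one tensor factor \<open>m\<close>, gives a
  Schwinger-Dyson equation \<open>(N + J) X = R\<close>: here \<open>J\<close> is the sum of the transpositions \<open>(s m)\<close>
  with \<open>s < m\<close> and \<open>R\<close> involves one factor less. As long as there are at most \<open>N\<close> factors, \<open>J\<close> has norm
  less than \<open>N\<close> and \<open>N + J\<close> is inverted by its Neumann series. Iterating over the factors writes the moments
  of \<open>Tr (A U B U\<^sup>*)\<close> as absolutely convergent sums over monotone factorizations, without any
  representation theory. A monotone factorization splits uniquely along the orbits of the group it
  generates, because factors belonging to different orbits are interleaved in only one monotone way.
  Hence moments and sums over transitive factorizations satisfy the same recursion as the Taylor
  coefficients of \<open>I\<close> and \<open>log I\<close>. Finally, multiplying by a transposition changes the number of cycles by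
  one, so that a transitive factorization has a genus, by which the sum is regrouped.
\<close>

text \<open>Each transposition carries a factor -1/N because (N + J) X = R is solved by iterating X
  = R/N - J X/N. Adding the elements of the ground set in increasing order makes the words obtained
  for successive \<open>m\<close> concatenate to one monotone factorization. The right-hand side R
  fuses the factors of \<open>s\<close> and \<open>m\<close> into a single one with the product of
  their matrices. The moments are therefore treated entrywise and with an arbitrary matrix in every
  factor, although only equal matrices are wanted in the end. The operator N + J is never inverted
  explicitly: moment and series satisfy the same equation, and a bounded solution of the homogeneous
  equation vanishes. The borderline degree d = N is admissible because J has one transposition fewer
  than there are factors, so that every geometric ratio is at most (N - 1)/N. The factor N^2 in
  front of the free energy is matched by the -2 in r = 2g - 2 + l(\<alpha>) + l(\<beta>), which
  leaves exactly N^(-2g) beside the normalized power sums.\<close>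

no_notation fps_nth (infixl "$" 75)
no_notation Infinite_Set_Sum.abs_summable_on (infix "abs'_summable'_on" 50)

section \<open>Orbits under multiplication by a transposition\<close>

abbreviation swp :: "nat \<Rightarrow> nat \<Rightarrow> nat \<Rightarrow> nat" where
  "swp \<equiv> Transposition.transpose"

lemma orbit_subset_closed:
  assumes "x \<in> U" and "f ` U \<subseteq> U"
  shows "orbit f x \<subseteq> U"
proof
  fix y assume "y \<in> orbit f x"
  then show "y \<in> U" by induction (use assms in auto)
qed

lemma orbit_eq_if_mem:
  assumes "permutation f" "y \<in> orbit f x"
  shows "orbit f y = orbit f x"
  using orbit_cyclic_eq3[OF cyclic_on_orbit'[OF assms(1)] assms(2)] .

text \<open>The product sends \<open>s\<close> to \<open>f t\<close> and then follows the cycle of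
  \<open>t\<close> under \<open>f\<close> undisturbed, since \<open>s\<close> is not on that cycle;
  so it must come back to \<open>t\<close>.\<close>

lemma orbit_compose_transpose_join:
  assumes f: "permutation f" and t: "t \<notin> orbit f s"
  shows "t \<in> orbit (f \<circ> Transposition.transpose s t) s"
proof (rule ccontr)
  let ?g = "f \<circ> Transposition.transpose s t"
  assume nt: "t \<notin> orbit ?g s"
  have g: "permutation ?g"
    using f by (intro permutation_compose) (auto simp: permutation_swap_id)
  have s_nt: "s \<notin> orbit f t"
    using t orbit_eq_if_mem[OF f] permutation_self_in_orbit[OF f, of t] by blast
  let ?V = "orbit f t \<inter> orbit ?g s"
  have gs: "?g s = f t" by simp
  have "f t \<in> ?V"
    using orbit.base[of f t] orbit.base[of ?g s] by (simp only: gs) simp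
  moreover have "f ` ?V \<subseteq> ?V"
  proof
    fix y assume "y \<in> f ` ?V"
    then obtain x where x: "x \<in> orbit f t" "x \<in> orbit ?g s" "y = f x" by auto
    have "x \<noteq> s" "x \<noteq> t" using x s_nt nt by auto
    then have "?g x = f x" by (simp add: Transposition.transpose_def)
    with x show "y \<in> ?V" using orbit.step[OF x(1)] orbit.step[OF x(2)] by simp
  qed
  ultimately have "orbit f (f t) \<subseteq> ?V" by (rule orbit_subset_closed)
  moreover have "t \<in> orbit f (f t)"
    using permutation_orbit_step[OF f] permutation_self_in_orbit[OF f] by auto
  ultimately show False using nt by auto
qed

lemma orbit_compose_transpose_cut:
  assumes f: "permutation f" and t: "t \<in> orbit f s" and st: "s \<noteq> t"
  shows "t \<notin> orbit (f \<circ> Transposition.transpose s t) s"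
proof -
  let ?g = "f \<circ> Transposition.transpose s t"
  \<comment> \<open>\<open>n\<close> is the first time at which the cycle of \<open>t\<close>
    reaches \<open>s\<close>. By minimality \<open>t\<close> does not recur up to then, so the
    product moves the points from \<open>f t\<close> to \<open>s\<close> in a closed cycle that
    avoids \<open>t\<close>.\<close>
  define n where "n = (LEAST n. 0 < n \<and> (f ^^ n) t = s)"
  have "s \<in> orbit f t"
    using orbit_eq_if_mem[OF f t] permutation_self_in_orbit[OF f, of s] by simp
  then have ex: "\<exists>n. 0 < n \<and> (f ^^ n) t = s" by (auto simp: orbit_altdef)
  have n: "0 < n" "(f ^^ n) t = s" using LeastI_ex[OF ex] by (auto simp: n_def)
  have least: "\<not> (0 < m \<and> (f ^^ m) t = s)" if "m < n" for m
    using not_less_Least[of m] that by (auto simp: n_def)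
  have nt: "(f ^^ i) t \<noteq> t" if "0 < i" "i \<le> n" for i
  proof
    assume eq: "(f ^^ i) t = t"
    have "i \<noteq> n" using eq n st by auto
    have "s = (f ^^ (n - i + i)) t" using n that by simp
    also have "\<dots> = (f ^^ (n - i)) t" unfolding funpow_add using eq by simp
    finally show False using least[of "n - i"] that \<open>i \<noteq> n\<close> by auto
  qed
  let ?U = "(\<lambda>i. (f ^^ i) t) ` {1..n}"
  have "s \<in> ?U" using n by force
  moreover have "?g ` ?U \<subseteq> ?U"
  proof
    fix y assume "y \<in> ?g ` ?U"
    then obtain i where i: "1 \<le> i" "i \<le> n" "y = ?g ((f ^^ i) t)" by auto
    show "y \<in> ?U"
    proof (cases "(f ^^ i) t = s")
      case True
      then have "y = (f ^^ 1) t" using i by simp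
      then show ?thesis using n by force
    next
      case False
      then have "i \<noteq> n" using n by auto
      have "y = f ((f ^^ i) t)"
        using i False nt[of i] by (simp add: Transposition.transpose_def)
      then have "y = (f ^^ (Suc i)) t" by simp
      then show ?thesis using i \<open>i \<noteq> n\<close> by (intro image_eqI[of _ _ "Suc i"]) auto
    qed
  qed
  ultimately have "orbit ?g s \<subseteq> ?U" by (rule orbit_subset_closed)
  moreover have "t \<notin> ?U"
  proof
    assume "t \<in> ?U"
    then obtain i where "i \<in> {1..n}" "t = (f ^^ i) t" by (rule imageE)
    then show False using nt[of i] by (metis atLeastAtMost_iff less_le_trans zero_less_one)
  qed
  ultimately show ?thesis by blast
qed

text \<open>The cycles themselves, and not only their number, are needed for the traces in
  \<open>index_sum_matrix_power\<close>.\<close>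

lemma orbits_compose_transpose_join:
  assumes p: "p permutes S" and fin: "finite S" and "s \<in> S" "t \<in> S" and t: "t \<notin> orbit p s"
  shows "orbit (p \<circ> Transposition.transpose s t) ` S =
    insert (orbit p s \<union> orbit p t) (orbit p ` S - {orbit p s, orbit p t})"
proof -
  let ?g = "p \<circ> Transposition.transpose s t"
  let ?E = "orbit p s \<union> orbit p t"
  have f: "permutation p" using p fin by (auto simp: permutation_permutes)
  have g: "permutation ?g"
    using f by (intro permutation_compose) (auto simp: permutation_swap_id)
  have tg: "t \<in> orbit ?g s" by (rule orbit_compose_transpose_join[OF f t])
  have sg: "s \<in> orbit ?g s" by (rule permutation_self_in_orbit[OF g])
  have self: "x \<in> orbit p x" for x by (rule permutation_self_in_orbit[OF f])
  have E_g: "?g ` ?E \<subseteq> ?E"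
    using orbit.step[of _ p s] orbit.step[of _ p t] orbit.base[of p s] orbit.base[of p t]
    by (auto simp: Transposition.transpose_def)
  have "p ` orbit ?g s \<subseteq> orbit ?g s"
  proof
    fix y assume "y \<in> p ` orbit ?g s"
    then obtain x where x: "x \<in> orbit ?g s" "y = p x" by auto
    have "p x = ?g (Transposition.transpose s t x)" by simp
    moreover have "Transposition.transpose s t x \<in> orbit ?g s"
      using x sg tg by (auto simp: Transposition.transpose_def)
    ultimately show "y \<in> orbit ?g s" using orbit.step[of _ ?g s] x by metis
  qed
  then have "?E \<subseteq> orbit ?g s"
    using orbit_subset_closed[OF sg] orbit_subset_closed[OF tg] by blast
  moreover have "orbit ?g s \<subseteq> ?E" by (rule orbit_subset_closed[OF _ E_g]) (use self in auto)
  ultimately have E: "orbit ?g s = ?E" by blast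
  have in_E: "orbit ?g x = ?E" if "x \<in> ?E" for x
    using orbit_eq_if_mem[OF g, of x s] that E by simp
  have notin_E: "orbit ?g x = orbit p x" if "x \<notin> ?E" for x
  proof (rule orbit_cong0[symmetric])
    show "x \<in> orbit p x" by (rule self)
    show "p \<in> orbit p x \<rightarrow> orbit p x" by (auto intro: orbit.step)
    fix y assume y: "y \<in> orbit p x"
    have "orbit p y = orbit p x" by (rule orbit_eq_if_mem[OF f y])
    then have "y \<noteq> s" "y \<noteq> t" using that self by auto
    then show "p y = ?g y" by (simp add: Transposition.transpose_def)
  qed
  have in_E_p: "x \<in> ?E \<longleftrightarrow> orbit p x = orbit p s \<or> orbit p x = orbit p t" for x
    using self orbit_eq_if_mem[OF f] by blast
  show ?thesis
  proof (intro equalityI subsetI)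
    fix O' assume "O' \<in> orbit ?g ` S"
    then obtain x where "x \<in> S" "O' = orbit ?g x" by auto
    then show "O' \<in> insert ?E (orbit p ` S - {orbit p s, orbit p t})"
      using in_E[of x] notin_E[of x] in_E_p[of x] by (cases "x \<in> ?E") auto
  next
    fix O' assume "O' \<in> insert ?E (orbit p ` S - {orbit p s, orbit p t})"
    then consider "O' = ?E" | x where "x \<in> S" "O' = orbit p x" "x \<notin> ?E"
      using in_E_p by auto
    then show "O' \<in> orbit ?g ` S"
      by cases (use E notin_E \<open>s \<in> S\<close> in auto)
  qed
qed

lemma card_orbits_compose_transpose_join:
  assumes p: "p permutes S" and fin: "finite S" and s: "s \<in> S" and t: "t \<in> S" "t \<notin> orbit p s"
  shows "Suc (card (orbit (p \<circ> Transposition.transpose s t) ` S)) = card (orbit p ` S)"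
proof -
  have f: "permutation p" using p fin by (auto simp: permutation_permutes)
  have self: "x \<in> orbit p x" for x by (rule permutation_self_in_orbit[OF f])
  have ne: "orbit p s \<noteq> orbit p t" using t self by blast
  have "orbit p s \<union> orbit p t \<notin> orbit p ` S"
  proof
    assume "orbit p s \<union> orbit p t \<in> orbit p ` S"
    then obtain x where x: "orbit p x = orbit p s \<union> orbit p t" by auto
    then have "s \<in> orbit p x" "t \<in> orbit p x" using self by auto
    then show False using ne orbit_eq_if_mem[OF f] by metis
  qed
  then have "card (orbit (p \<circ> Transposition.transpose s t) ` S) =
      Suc (card (orbit p ` S - {orbit p s, orbit p t}))"
    unfolding orbits_compose_transpose_join[OF p fin s t]
    using fin by (subst card_insert_disjoint) auto
  also have "card (orbit p ` S - {orbit p s, orbit p t}) = card (orbit p ` S) - 2"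
    using s t ne by (subst card_Diff_subset) auto
  finally have *: "card (orbit (p \<circ> Transposition.transpose s t) ` S) = Suc (card (orbit p ` S) - 2)" .
  have "card {orbit p s, orbit p t} \<le> card (orbit p ` S)"
    by (rule card_mono) (use s t fin in auto)
  then have "2 \<le> card (orbit p ` S)" using ne by simp
  with * show ?thesis by simp
qed

text \<open>Composing twice with the same transposition gives back \<open>p\<close>, so cutting a
  cycle is joining two read backwards.\<close>

lemma card_orbits_compose_transpose_cut:
  assumes p: "p permutes S" and fin: "finite S" and s: "s \<in> S" and t: "t \<in> S" "t \<in> orbit p s" "s \<noteq> t"
  shows "card (orbit (p \<circ> Transposition.transpose s t) ` S) = Suc (card (orbit p ` S))"
proof -
  let ?g = "p \<circ> Transposition.transpose s t"
  have f: "permutation p" using p fin by (auto simp: permutation_permutes)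
  have g: "?g permutes S" by (intro permutes_compose permutes_swap_id p s t)
  have "t \<notin> orbit ?g s" by (rule orbit_compose_transpose_cut[OF f t(2,3)])
  from card_orbits_compose_transpose_join[OF g fin s t(1) this]
  show ?thesis by (simp add: o_assoc[symmetric])
qed

lemma orbit_inv_permutes:
  assumes "p permutes S" "finite S"
  shows "orbit (inv_into UNIV p) = orbit p"
  using orbit_inv_eq[of p] assms by (auto simp: permutation_permutes)

text \<open>Inversion exchanges left and right multiplication by a transposition and leaves the
  orbits unchanged.\<close>

lemma card_orbits_transpose_compose:
  assumes p: "p permutes S" and fin: "finite S" and s: "s \<in> S" and t: "t \<in> S" "s \<noteq> t"
  shows "if t \<in> orbit p s
    then card (orbit (Transposition.transpose s t \<circ> p) ` S) = Suc (card (orbit p ` S))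
    else Suc (card (orbit (Transposition.transpose s t \<circ> p) ` S)) = card (orbit p ` S)"
proof -
  have ip: "inv_into UNIV p permutes S" by (rule permutes_inv[OF p])
  have tp: "Transposition.transpose s t \<circ> p permutes S" by (intro permutes_compose permutes_swap_id p s t)
  have "inv_into UNIV (Transposition.transpose s t \<circ> p) = inv_into UNIV p \<circ> Transposition.transpose s t"
    using permutes_bij[OF p] by (subst o_inv_distrib) (auto simp: permutes_bij)
  then have "orbit (inv_into UNIV p \<circ> Transposition.transpose s t) = orbit (Transposition.transpose s t \<circ> p)"
    using orbit_inv_permutes[OF tp fin] by simp
  then show ?thesis
    using card_orbits_compose_transpose_join[OF ip fin s t(1)]
      card_orbits_compose_transpose_cut[OF ip fin s t(1)] t orbit_inv_permutes[OF p fin]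
    by auto
qed

section \<open>Monotone factorizations and their connected components\<close>

text \<open>Later pairs act on the left: this is \<tau>_r ... \<tau>_1, the inverse of the product
  \<tau>_1 ... \<tau>_r in the Hurwitz condition.\<close>

definition iprod :: "(nat \<times> nat) list \<Rightarrow> nat \<Rightarrow> nat" where
  "iprod ps = fold (\<lambda>(s, t) p. swp s t \<circ> p) ps id"

lemma iprod_Nil [simp]: "iprod [] = id"
  by (simp add: iprod_def)

lemma iprod_snoc [simp]: "iprod (ps @ [(s, t)]) = swp s t \<circ> iprod ps"
  by (simp add: iprod_def)

definition monotone_pairs :: "nat set \<Rightarrow> (nat \<times> nat) list set" where
  "monotone_pairs S = {ps. sorted (map snd ps) \<and> (\<forall>(s, t)\<in>set ps. s \<in> S \<and> t \<in> S \<and> s < t)}"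

lemma monotone_pairs_Nil [simp]: "[] \<in> monotone_pairs S"
  by (simp add: monotone_pairs_def)

lemma iprod_permutes:
  assumes "\<forall>(s, t)\<in>set ps. s \<in> S \<and> t \<in> S"
  shows "iprod ps permutes S"
  using assms
proof (induction ps rule: rev_induct)
  case (snoc p ps)
  obtain s t where p: "p = (s, t)" by force
  have "iprod ps permutes S" by (rule snoc.IH) (use snoc.prems in auto)
  moreover have "swp s t permutes S" using snoc.prems by (intro permutes_swap_id) (auto simp: p)
  ultimately show ?case unfolding p iprod_snoc by (rule permutes_compose)
qed (simp add: permutes_id)

lemma iprod_permutes_monotone_pairs: "ps \<in> monotone_pairs S \<Longrightarrow> iprod ps permutes S"
  by (rule iprod_permutes) (auto simp: monotone_pairs_def)

text \<open>Pairs with both ends outside \<open>T\<close> fix every point of \<open>T\<close>, and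
  the remaining pairs never move a point out of \<open>T\<close>.\<close>

lemma iprod_filter:
  assumes "\<forall>(s, t)\<in>set ps. s \<in> T \<longleftrightarrow> t \<in> T" and "x \<in> T"
  shows "iprod ps x = iprod (filter (\<lambda>p. fst p \<in> T) ps) x \<and> iprod ps x \<in> T"
  using assms(1)
proof (induction ps rule: rev_induct)
  case Nil
  then show ?case using assms by simp
next
  case (snoc p ps)
  obtain s t where p: "p = (s, t)" by force
  from snoc have IH: "iprod ps x = iprod (filter (\<lambda>p. fst p \<in> T) ps) x" "iprod ps x \<in> T"
    and st: "s \<in> T \<longleftrightarrow> t \<in> T" by (auto simp: p)
  show ?case
  proof (cases "s \<in> T")
    case True
    then have "filter (\<lambda>p. fst p \<in> T) (ps @ [p]) = filter (\<lambda>p. fst p \<in> T) ps @ [(s, t)]"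
      by (simp add: p)
    moreover have "swp s t (iprod ps x) \<in> T"
      using IH(2) st True by (simp add: Transposition.transpose_def)
    ultimately show ?thesis using IH(1) by (simp add: p)
  next
    case False
    then have "filter (\<lambda>p. fst p \<in> T) (ps @ [p]) = filter (\<lambda>p. fst p \<in> T) ps"
      by (simp add: p)
    moreover have "swp s t (iprod ps x) = iprod ps x"
      using IH(2) st False by (intro transpose_apply_other) auto
    ultimately show ?thesis using IH by (simp add: p)
  qed
qed

section \<open>Configurations, stable sets and components\<close>

text \<open>
  A pair \<open>(\<sigma>, ps)\<close> encodes the Hurwitz tuple \<open>(\<rho>, \<sigma>\<^sup>-\<^sup>1, \<tau>\<^sub>1, \<dots>, \<tau>\<^sub>r)\<close>, where \<open>ps\<close> lists the pairs that are
  transposed by the \<open>\<tau>\<^sub>i\<close>, and \<open>\<rho> = \<tau>\<^sub>r \<dots> \<tau>\<^sub>1 \<sigma>\<close> is determined by the product condition. The ground set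
  is an arbitrary finite set of numbers, so that orbits need no relabelling.
\<close>

type_synonym config = "(nat \<Rightarrow> nat) \<times> (nat \<times> nat) list"

definition configs :: "nat set \<Rightarrow> config set" where
  "configs S = {\<sigma>. \<sigma> permutes S} \<times> monotone_pairs S"

text \<open>For the permutation an inclusion suffices: on a finite set an injective self-map is
  onto, see \<open>permutes_image_eq_if_subset\<close>.\<close>

definition config_stable :: "config \<Rightarrow> nat set \<Rightarrow> bool" where
  "config_stable c U \<longleftrightarrow> fst c ` U \<subseteq> U \<and> (\<forall>(s, t)\<in>set (snd c). s \<in> U \<longleftrightarrow> t \<in> U)"

definition connected_configs :: "nat set \<Rightarrow> config set" where
  "connected_configs S = {c \<in> configs S. \<forall>U\<subseteq>S. U \<noteq> {} \<longrightarrow> config_stable c U \<longrightarrow> U = S}"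

text \<open>This is the orbit of \<open>x\<close> under the group generated by the permutation and
  the swaps, obtained without that group as the least stable set through \<open>x\<close>.\<close>

definition component :: "nat set \<Rightarrow> nat \<Rightarrow> config \<Rightarrow> nat set" where
  "component S x c = \<Inter>{U. U \<subseteq> S \<and> x \<in> U \<and> config_stable c U}"

lemma permutes_image_eq_if_subset:
  assumes "\<sigma> permutes S" "finite U" "\<sigma> ` U \<subseteq> U"
  shows "\<sigma> ` U = U"
  by (rule endo_inj_surj[OF assms(2,3)]) (use permutes_inj[OF assms(1)] in \<open>auto intro: inj_on_subset\<close>)

text \<open>A permutation maps a finite stable set onto itself, so by injectivity it also preserves
  differences of stable sets.\<close>

lemma stable_Diff:
  assumes "finite S" "c \<in> configs S" "U \<subseteq> S" "V \<subseteq> S" "config_stable c U" "config_stable c V"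
  shows "config_stable c (U - V)"
proof -
  from assms have p: "fst c permutes S" by (auto simp: configs_def)
  have "fst c ` (U - V) = fst c ` U - fst c ` V"
    using permutes_inj[OF p] by (rule image_set_diff)
  also have "\<dots> = U - V"
    using permutes_image_eq_if_subset[OF p, of U] permutes_image_eq_if_subset[OF p, of V] assms
      finite_subset[of U S] finite_subset[of V S]
    by (auto simp: config_stable_def)
  finally show ?thesis using assms by (auto simp: config_stable_def)
qed

lemma stable_whole: "c \<in> configs S \<Longrightarrow> config_stable c S"
  by (auto simp: config_stable_def configs_def monotone_pairs_def permutes_in_image)

lemma component:
  assumes "c \<in> configs S" "x \<in> S"
  shows "component S x c \<subseteq> S" "x \<in> component S x c" "config_stable c (component S x c)"
proof -
  have S: "S \<in> {U. U \<subseteq> S \<and> x \<in> U \<and> config_stable c U}" using stable_whole assms by auto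
  then show "component S x c \<subseteq> S" by (auto simp: component_def)
  show "x \<in> component S x c" by (auto simp: component_def)
  show "config_stable c (component S x c)"
    unfolding config_stable_def[of c "component S x c"]
  proof (intro conjI)
    show "fst c ` component S x c \<subseteq> component S x c"
      unfolding component_def by (auto simp: config_stable_def)
    have "s \<in> U \<longleftrightarrow> t \<in> U" if "(s, t) \<in> set (snd c)" "config_stable c U" for s t U
      using that by (auto simp: config_stable_def)
    then show "\<forall>(s, t)\<in>set (snd c). s \<in> component S x c \<longleftrightarrow> t \<in> component S x c"
      unfolding component_def by blast
  qed
qed

lemma component_subset: "U \<subseteq> S \<Longrightarrow> x \<in> U \<Longrightarrow> config_stable c U \<Longrightarrow> component S x c \<subseteq> U"
  by (auto simp: component_def)

text \<open>A nonempty stable set that misses \<open>x\<close> has a stable complement containing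
  \<open>x\<close>, hence containing the component of \<open>x\<close>.\<close>

lemma connected_configs_iff_component:
  assumes "finite S" "c \<in> configs S" "x \<in> S"
  shows "c \<in> connected_configs S \<longleftrightarrow> component S x c = S"
proof
  assume "c \<in> connected_configs S"
  then show "component S x c = S"
    using component[OF assms(2,3)] by (auto simp: connected_configs_def)
next
  assume eq: "component S x c = S"
  have "U = S" if U: "U \<subseteq> S" "U \<noteq> {}" "config_stable c U" for U
  proof (cases "x \<in> U")
    case True
    then show ?thesis using component_subset[OF U(1) True U(3)] U eq by auto
  next
    case False
    have "config_stable c (S - U)"
      by (rule stable_Diff[OF assms(1,2)]) (use stable_whole assms U in auto)
    then have "S \<subseteq> S - U"
      using component_subset[of "S - U" S x c] False assms eq by auto
    then show ?thesis using U by auto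
  qed
  then show "c \<in> connected_configs S" using assms by (auto simp: connected_configs_def)
qed

text \<open>Stability of the sorting is essential: pairs with equal second entry keep their order.\<close>

definition merge_configs :: "config \<times> config \<Rightarrow> config" where
  "merge_configs = (\<lambda>((\<sigma>1, ps1), (\<sigma>2, ps2)). (\<sigma>1 \<circ> \<sigma>2, sort_key snd (ps1 @ ps2)))"

definition restrict_config :: "nat set \<Rightarrow> config \<Rightarrow> config" where
  "restrict_config T = (\<lambda>(\<sigma>, ps). (perm_restrict \<sigma> T, filter (\<lambda>p. fst p \<in> T) ps))"

lemma restrict_config_configs:
  assumes c: "c \<in> configs S" and T: "T \<subseteq> S" "config_stable c T" and fin: "finite S"
  shows "restrict_config T c \<in> configs T"
proof -
  obtain \<sigma> ps where [simp]: "c = (\<sigma>, ps)" by force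
  have \<sigma>: "\<sigma> permutes S" and ps: "ps \<in> monotone_pairs S" using c by (auto simp: configs_def)
  have "\<sigma> ` T = T"
    by (rule permutes_image_eq_if_subset[OF \<sigma>]) (use T fin finite_subset in \<open>auto simp: config_stable_def\<close>)
  then have "bij_betw \<sigma> T T"
    using permutes_inj[OF \<sigma>] by (auto simp: bij_betw_def intro: inj_on_subset)
  then have "bij_betw (perm_restrict \<sigma> T) T T"
    by (subst bij_betw_cong[of _ _ \<sigma>]) (auto simp: perm_restrict_def)
  then have "perm_restrict \<sigma> T permutes T"
    by (rule bij_imp_permutes) (auto simp: perm_restrict_def)
  moreover have "filter (\<lambda>p. fst p \<in> T) ps \<in> monotone_pairs T"
    using ps T by (force simp: monotone_pairs_def config_stable_def sorted_filter)
  ultimately show ?thesis by (auto simp: configs_def restrict_config_def)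
qed

text \<open>Pairs with the same second entry lie all inside or all outside \<open>T\<close>. The
  sort therefore never has to choose an order between equal keys from the two sides, and
  monotonicity leaves only one interleaving.\<close>

lemma sort_key_snd_filter_append:
  assumes "sorted (map snd ps)" and st: "\<forall>(s, t)\<in>set ps. s \<in> T \<longleftrightarrow> t \<in> T"
  shows "sort_key snd (filter (\<lambda>p. fst p \<in> T) ps @ filter (\<lambda>p. fst p \<notin> T) ps) = ps"
proof (rule properties_for_sort_key)
  show "mset ps = mset (filter (\<lambda>p. fst p \<in> T) ps @ filter (\<lambda>p. fst p \<notin> T) ps)"
    by (simp add: multiset_partition)
  have in_T: "fst p \<in> T \<longleftrightarrow> snd p \<in> T" if "p \<in> set ps" for p using st that by auto
  show "filter (\<lambda>x. snd k = snd x) ps =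
      filter (\<lambda>x. snd k = snd x) (filter (\<lambda>p. fst p \<in> T) ps @ filter (\<lambda>p. fst p \<notin> T) ps)" for k
  proof (cases "snd k \<in> T")
      case True
      have "filter (\<lambda>x. snd k = snd x) (filter (\<lambda>p. fst p \<in> T) ps) = filter (\<lambda>x. snd k = snd x) ps"
        unfolding filter_filter by (rule filter_cong) (use in_T True in auto)
      moreover have "filter (\<lambda>x. snd k = snd x) (filter (\<lambda>p. fst p \<notin> T) ps) = []"
        using in_T True by (auto simp: filter_empty_conv)
      ultimately show ?thesis by simp
    next
      case False
      have "filter (\<lambda>x. snd k = snd x) (filter (\<lambda>p. fst p \<notin> T) ps) = filter (\<lambda>x. snd k = snd x) ps"
        unfolding filter_filter by (rule filter_cong) (use in_T False in auto)
      moreover have "filter (\<lambda>x. snd k = snd x) (filter (\<lambda>p. fst p \<in> T) ps) = []"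
        using in_T False by (auto simp: filter_empty_conv)
      ultimately show ?thesis by simp
  qed
qed (use assms in auto)

lemma perm_restrict_comp_complement:
  assumes "\<sigma> permutes S" "T \<subseteq> S" "\<sigma> ` T \<subseteq> T" "\<sigma> ` (S - T) \<subseteq> S - T"
  shows "perm_restrict \<sigma> T \<circ> perm_restrict \<sigma> (S - T) = \<sigma>"
proof
  fix x
  show "(perm_restrict \<sigma> T \<circ> perm_restrict \<sigma> (S - T)) x = \<sigma> x"
    using assms permutes_not_in[OF assms(1), of x] by (cases "x \<in> S"; cases "x \<in> T") (auto simp: perm_restrict_def)
qed

lemma permutes_comp_disjoint:
  assumes "\<sigma>1 permutes T" "\<sigma>2 permutes V" "T \<inter> V = {}"
  shows "x \<in> T \<Longrightarrow> (\<sigma>1 \<circ> \<sigma>2) x = \<sigma>1 x" "x \<in> V \<Longrightarrow> (\<sigma>1 \<circ> \<sigma>2) x = \<sigma>2 x"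
proof -
  show "(\<sigma>1 \<circ> \<sigma>2) x = \<sigma>1 x" if "x \<in> T"
  proof -
    have "x \<notin> V" using that assms(3) by auto
    then show ?thesis using permutes_not_in[OF assms(2)] by simp
  qed
  show "(\<sigma>1 \<circ> \<sigma>2) x = \<sigma>2 x" if "x \<in> V"
  proof -
    have "\<sigma>2 x \<notin> T" using that permutes_in_image[OF assms(2), of x] assms(3) by auto
    then show ?thesis using permutes_not_in[OF assms(1)] by simp
  qed
qed

lemma merge_configs_restrict:
  assumes fin: "finite S" and c: "c \<in> configs S" and T: "T \<subseteq> S" "config_stable c T"
  shows "merge_configs (restrict_config T c, restrict_config (S - T) c) = c"
proof -
  obtain \<sigma> ps where [simp]: "c = (\<sigma>, ps)" by force
  have \<sigma>: "\<sigma> permutes S" and ps: "ps \<in> monotone_pairs S" using c by (auto simp: configs_def)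
  have "config_stable c (S - T)"
    by (rule stable_Diff[OF fin c]) (use T stable_whole[OF c] in auto)
  then have "perm_restrict \<sigma> T \<circ> perm_restrict \<sigma> (S - T) = \<sigma>"
    using T by (intro perm_restrict_comp_complement[OF \<sigma>]) (auto simp: config_stable_def)
  moreover have "filter (\<lambda>p. fst p \<in> S \<and> fst p \<notin> T) ps = filter (\<lambda>p. fst p \<notin> T) ps"
    by (rule filter_cong) (use ps in \<open>auto simp: monotone_pairs_def\<close>)
  ultimately show ?thesis
    using sort_key_snd_filter_append[of ps T] ps T
    by (simp add: merge_configs_def restrict_config_def monotone_pairs_def config_stable_def)
qed

text \<open>Filtering commutes with a stable sort, so each of the two lists is recovered in its
  original order.\<close>

lemma merge_configs_in:
  assumes c: "c1 \<in> configs T" "c2 \<in> configs V" and TV: "T \<inter> V = {}"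
  shows "merge_configs (c1, c2) \<in> configs (T \<union> V)" "config_stable (merge_configs (c1, c2)) T"
    "restrict_config T (merge_configs (c1, c2)) = c1" "restrict_config V (merge_configs (c1, c2)) = c2"
proof -
  obtain \<sigma>1 ps1 \<sigma>2 ps2 where [simp]: "c1 = (\<sigma>1, ps1)" "c2 = (\<sigma>2, ps2)" by force
  have \<sigma>: "\<sigma>1 permutes T" "\<sigma>2 permutes V"
    and ps: "ps1 \<in> monotone_pairs T" "ps2 \<in> monotone_pairs V" using c by (auto simp: configs_def)
  have "\<sigma>1 \<circ> \<sigma>2 permutes T \<union> V"
    by (intro permutes_compose permutes_subset[OF \<sigma>(1)] permutes_subset[OF \<sigma>(2)]) auto
  moreover have "sort_key snd (ps1 @ ps2) \<in> monotone_pairs (T \<union> V)"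
    using ps unfolding monotone_pairs_def by (auto split: prod.splits)
  ultimately show "merge_configs (c1, c2) \<in> configs (T \<union> V)"
    by (simp add: configs_def merge_configs_def)
  show "config_stable (merge_configs (c1, c2)) T"
    using ps TV permutes_comp_disjoint(1)[OF \<sigma> TV] permutes_in_image[OF \<sigma>(1)]
    by (force simp: config_stable_def merge_configs_def monotone_pairs_def)
  have "perm_restrict (\<sigma>1 \<circ> \<sigma>2) T = \<sigma>1" "perm_restrict (\<sigma>1 \<circ> \<sigma>2) V = \<sigma>2"
    using permutes_comp_disjoint[OF \<sigma> TV] permutes_not_in[OF \<sigma>(1)] permutes_not_in[OF \<sigma>(2)]
    by (auto simp: perm_restrict_def fun_eq_iff)
  moreover have "filter (\<lambda>p. fst p \<in> T) (sort_key snd (ps1 @ ps2)) = ps1"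
  proof -
    have "filter (\<lambda>p. fst p \<in> T) ps1 = ps1" "filter (\<lambda>p. fst p \<in> T) ps2 = []"
      using ps TV by (auto simp: monotone_pairs_def filter_id_conv filter_empty_conv)
    then show ?thesis using ps by (simp add: filter_sort sort_key_id_if_sorted monotone_pairs_def)
  qed
  moreover have "filter (\<lambda>p. fst p \<in> V) (sort_key snd (ps1 @ ps2)) = ps2"
  proof -
    have "filter (\<lambda>p. fst p \<in> V) ps2 = ps2" "filter (\<lambda>p. fst p \<in> V) ps1 = []"
      using ps TV by (auto simp: monotone_pairs_def filter_id_conv filter_empty_conv)
    then show ?thesis using ps by (simp add: filter_sort sort_key_id_if_sorted monotone_pairs_def)
  qed
  ultimately show "restrict_config T (merge_configs (c1, c2)) = c1" "restrict_config V (merge_configs (c1, c2)) = c2"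
    by (simp_all add: restrict_config_def merge_configs_def)
qed

lemma stable_restrict_config:
  assumes "U \<subseteq> T" "config_stable c T"
  shows "config_stable (restrict_config T c) U \<longleftrightarrow> config_stable c U"
proof -
  obtain \<sigma> ps where c: "c = (\<sigma>, ps)" by force
  have "perm_restrict \<sigma> T ` U = \<sigma> ` U"
    using assms(1) by (intro image_cong) (auto simp: perm_restrict_def)
  moreover have "(\<forall>(s, t)\<in>set (filter (\<lambda>p. fst p \<in> T) ps). s \<in> U \<longleftrightarrow> t \<in> U) \<longleftrightarrow>
      (\<forall>(s, t)\<in>set ps. s \<in> U \<longleftrightarrow> t \<in> U)"
    using assms unfolding config_stable_def c by fastforce
  ultimately show ?thesis
    by (simp add: config_stable_def restrict_config_def c)
qed

text \<open>Inside a stable \<open>T\<close>, stability means the same for the configuration and for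
  its restriction, and so does being the least stable set through \<open>x\<close>.\<close>

lemma component_restrict_config:
  assumes "T \<subseteq> S" "config_stable c T" "x \<in> T" "c \<in> configs S"
  shows "component T x (restrict_config T c) = component S x c"
proof -
  have 1: "component S x c \<subseteq> T" by (rule component_subset) (use assms in auto)
  have 2: "component S x c \<subseteq> S" "x \<in> component S x c" "config_stable c (component S x c)"
    using component[OF assms(4), of x] assms by auto
  show ?thesis
  proof
    show "component T x (restrict_config T c) \<subseteq> component S x c"
      by (rule component_subset) (use 1 2 stable_restrict_config[OF 1 assms(2)] in auto)
    show "component S x c \<subseteq> component T x (restrict_config T c)"
      unfolding component_def[of T] using assms stable_restrict_config[OF _ assms(2)]
      by (intro Inter_greatest component_subset) auto
  qed
qed

text \<open>This is the combinatorial form of the relation between moments and cumulants: the part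
  on the component of \<open>x\<close> is connected, and the rest is arbitrary.\<close>

lemma bij_betw_merge_configs:
  assumes fin: "finite S" and T: "T \<subseteq> S" "x \<in> T"
  shows "bij_betw merge_configs (connected_configs T \<times> configs (S - T)) {c \<in> configs S. component S x c = T}"
proof (rule bij_betw_byWitness[where f' = "\<lambda>c. (restrict_config T c, restrict_config (S - T) c)"])
  have disj: "T \<inter> (S - T) = {}" and un: "T \<union> (S - T) = S" using T by auto
  have finT: "finite T" using T fin finite_subset by auto
  note m = merge_configs_in[OF _ _ disj, unfolded un]
  have conn: "connected_configs T \<subseteq> configs T" by (auto simp: connected_configs_def)
  show "\<forall>a\<in>connected_configs T \<times> configs (S - T).
      (restrict_config T (merge_configs a), restrict_config (S - T) (merge_configs a)) = a"
    using m(3,4) conn by auto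
  have st: "config_stable c T" if "c \<in> configs S" "component S x c = T" for c
    using component(3)[OF that(1), of x] that T by auto
  show "\<forall>a'\<in>{c \<in> configs S. component S x c = T}.
      merge_configs (restrict_config T a', restrict_config (S - T) a') = a'"
    using merge_configs_restrict[OF fin] T st by auto
  show "merge_configs ` (connected_configs T \<times> configs (S - T)) \<subseteq> {c \<in> configs S. component S x c = T}"
  proof (intro image_subsetI)
    fix c12 assume c12: "c12 \<in> connected_configs T \<times> configs (S - T)"
    define c1 c2 where "c1 = fst c12" and "c2 = snd c12"
    let ?c1 = c1 and ?c2 = c2
    have c1: "?c1 \<in> connected_configs T" and c2: "?c2 \<in> configs (S - T)"
      and eq: "c12 = (c1, c2)" using c12 by (auto simp: c1_def c2_def)
    then have c1': "?c1 \<in> configs T" using conn by auto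
    have "merge_configs (?c1, ?c2) \<in> configs S" by (rule m(1)[OF c1' c2])
    have "component S x (merge_configs (?c1, ?c2)) = component T x ?c1"
      using component_restrict_config[OF T(1) m(2)[OF c1' c2] T(2) m(1)[OF c1' c2]] m(3)[OF c1' c2] by simp
    also have "\<dots> = T" using connected_configs_iff_component[OF finT c1' T(2)] c1 by simp
    finally show "merge_configs c12 \<in> {c \<in> configs S. component S x c = T}"
      using \<open>merge_configs (?c1, ?c2) \<in> configs S\<close> by (simp add: eq)
  qed
  show "(\<lambda>c. (restrict_config T c, restrict_config (S - T) c)) ` {c \<in> configs S. component S x c = T}
      \<subseteq> connected_configs T \<times> configs (S - T)"
  proof (intro image_subsetI, unfold mem_Collect_eq, elim conjE)
    fix c assume c: "c \<in> configs S" "component S x c = T"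
    have stT: "config_stable c T" by (rule st[OF c])
    have "config_stable c (S - T)" by (rule stable_Diff[OF fin c(1)]) (use T stable_whole[OF c(1)] stT in auto)
    then have 2: "restrict_config (S - T) c \<in> configs (S - T)"
      by (intro restrict_config_configs[OF c(1) _ _ fin]) auto
    have 1: "restrict_config T c \<in> configs T"
      by (rule restrict_config_configs[OF c(1) T(1) stT fin])
    have "component T x (restrict_config T c) = T"
      using component_restrict_config[OF T(1) stT T(2) c(1)] c by simp
    then have "restrict_config T c \<in> connected_configs T"
      using connected_configs_iff_component[OF finT 1 T(2)] by simp
    with 2 show "(restrict_config T c, restrict_config (S - T) c) \<in> connected_configs T \<times> configs (S - T)"
      by auto
  qed
qed

section \<open>Multiplicative weights\<close>

definition orbit_weight :: "(nat \<Rightarrow> 'a::comm_monoid_mult) \<Rightarrow> nat set \<Rightarrow> (nat \<Rightarrow> nat) \<Rightarrow> 'a" where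
  "orbit_weight h S \<sigma> = (\<Prod>C\<in>orbit \<sigma> ` S. h (card C))"

lemma orbit_weight_Un:
  assumes fin: "finite T" "finite V" and TV: "T \<inter> V = {}"
    and \<sigma>: "\<sigma>1 permutes T" "\<sigma>2 permutes V"
    and eq: "\<And>x. x \<in> T \<Longrightarrow> \<sigma> x = \<sigma>1 x" "\<And>x. x \<in> V \<Longrightarrow> \<sigma> x = \<sigma>2 x"
  shows "orbit_weight h (T \<union> V) \<sigma> = orbit_weight h T \<sigma>1 * orbit_weight h V \<sigma>2"
proof -
  have 1: "orbit \<sigma> ` T = orbit \<sigma>1 ` T"
    by (intro image_cong refl orbit_cong0[where A = T, symmetric]) (use eq permutes_in_image[OF \<sigma>(1)] in auto)
  have 2: "orbit \<sigma> ` V = orbit \<sigma>2 ` V"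
    by (intro image_cong refl orbit_cong0[where A = V, symmetric]) (use eq permutes_in_image[OF \<sigma>(2)] in auto)
  have "orbit \<sigma>1 x \<noteq> orbit \<sigma>2 y" if "x \<in> T" "y \<in> V" for x y
    using permutes_orbit_subset[OF \<sigma>(1) that(1)] permutes_orbit_subset[OF \<sigma>(2) that(2)] TV
      orbit_nonempty[of \<sigma>1 x] by blast
  then have disj: "orbit \<sigma>1 ` T \<inter> orbit \<sigma>2 ` V = {}" by blast
  have "orbit \<sigma> ` (T \<union> V) = orbit \<sigma>1 ` T \<union> orbit \<sigma>2 ` V" by (simp only: image_Un 1 2)
  then show ?thesis
    unfolding orbit_weight_def using fin disj by (simp add: prod.union_disjoint)
qed

text \<open>The weight \<open>h\<close> is read on the cycles of \<rho> and \<open>k\<close> on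
  those of \<sigma>. For traces of matrix powers the two products are the power sums of the cycle
  types, and \<open>x\<close> marks the number of transpositions.\<close>

definition config_weight ::
  "'a::comm_ring_1 \<Rightarrow> (nat \<Rightarrow> 'a) \<Rightarrow> (nat \<Rightarrow> 'a) \<Rightarrow> nat set \<Rightarrow> config \<Rightarrow> 'a" where
  "config_weight x h k S c =
    x ^ length (snd c) * orbit_weight h S (iprod (snd c) \<circ> fst c) * orbit_weight k S (fst c)"

text \<open>The product of the interleaved list agrees on each of the two parts with the product of
  the list belonging to it, so cycles and lengths split.\<close>

lemma config_weight_merge:
  assumes c: "c1 \<in> configs T" "c2 \<in> configs V" and TV: "T \<inter> V = {}" and fin: "finite T" "finite V"
  shows "config_weight x h k (T \<union> V) (merge_configs (c1, c2)) =
    config_weight x h k T c1 * config_weight x h k V c2"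
proof -
  obtain \<sigma>1 ps1 \<sigma>2 ps2 where [simp]: "c1 = (\<sigma>1, ps1)" "c2 = (\<sigma>2, ps2)" by force
  have \<sigma>: "\<sigma>1 permutes T" "\<sigma>2 permutes V"
    and ps: "ps1 \<in> monotone_pairs T" "ps2 \<in> monotone_pairs V" using c by (auto simp: configs_def)
  let ?ps = "sort_key snd (ps1 @ ps2)"
  note m = merge_configs_in[OF c TV]
  have filters: "filter (\<lambda>p. fst p \<in> T) ?ps = ps1" "filter (\<lambda>p. fst p \<in> V) ?ps = ps2"
    using m(3,4) by (auto simp: merge_configs_def restrict_config_def)
  have "\<forall>(s, t)\<in>set ?ps. (s \<in> T \<longleftrightarrow> t \<in> T) \<and> (s \<in> V \<longleftrightarrow> t \<in> V)"
    using ps TV by (auto simp: monotone_pairs_def)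
  then have ip: "iprod ?ps y = iprod ps1 y" if "y \<in> T" for y
    using iprod_filter[of ?ps T y] that filters by auto
  have "\<forall>(s, t)\<in>set ?ps. s \<in> V \<longleftrightarrow> t \<in> V"
    using ps TV by (auto simp: monotone_pairs_def)
  then have ip2: "iprod ?ps y = iprod ps2 y" if "y \<in> V" for y
    using iprod_filter[of ?ps V y] that filters by auto
  note cd = permutes_comp_disjoint[OF \<sigma> TV]
  have k: "orbit_weight k (T \<union> V) (\<sigma>1 \<circ> \<sigma>2) = orbit_weight k T \<sigma>1 * orbit_weight k V \<sigma>2"
    by (rule orbit_weight_Un[OF fin TV \<sigma>]) (use cd in auto)
  have h: "orbit_weight h (T \<union> V) (iprod ?ps \<circ> (\<sigma>1 \<circ> \<sigma>2)) =
      orbit_weight h T (iprod ps1 \<circ> \<sigma>1) * orbit_weight h V (iprod ps2 \<circ> \<sigma>2)"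
  proof (rule orbit_weight_Un[OF fin TV])
    show "iprod ps1 \<circ> \<sigma>1 permutes T" "iprod ps2 \<circ> \<sigma>2 permutes V"
      by (intro permutes_compose \<sigma> iprod_permutes_monotone_pairs ps)+
  qed (use cd ip ip2 permutes_in_image[OF \<sigma>(1)] permutes_in_image[OF \<sigma>(2)] in auto)
  show ?thesis
    by (simp add: config_weight_def merge_configs_def h k power_add mult_ac)
qed

section \<open>Genus and Hurwitz tuples\<close>

text \<open>
  A labelling that is constant on the orbits of the generated group, with as many labels as the cycle
  counts allow; in the transitive case it has one label, which is the Riemann-Hurwitz inequality.
\<close>

lemma ex_invariant_labelling:
  assumes fin: "finite S" and \<sigma>: "\<sigma> permutes S"
    and "\<forall>(s, t)\<in>set ps. s \<in> S \<and> t \<in> S \<and> s \<noteq> t"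
  shows "\<exists>f::nat \<Rightarrow> nat set. (\<forall>x. f (\<sigma> x) = f x) \<and> (\<forall>(s, t)\<in>set ps. f s = f t) \<and>
    card (orbit (iprod ps \<circ> \<sigma>) ` S) + card (orbit \<sigma> ` S) \<le> 2 * card (f ` S) + length ps"
  using assms(3)
proof (induction ps rule: rev_induct)
  case Nil
  have "permutation \<sigma>" using \<sigma> fin by (auto simp: permutation_permutes)
  then show ?case
    by (intro exI[of _ "orbit \<sigma>"]) (simp add: permutation_orbit_step)
next
  case (snoc p ps)
  obtain s t where p: "p = (s, t)" by force
  have "\<forall>(s, t)\<in>set ps. s \<in> S \<and> t \<in> S \<and> s \<noteq> t" using snoc.prems by auto
  from snoc.IH[OF this]
  obtain f :: "nat \<Rightarrow> nat set" where f: "\<And>x. f (\<sigma> x) = f x" "\<forall>(s, t)\<in>set ps. f s = f t"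
      "card (orbit (iprod ps \<circ> \<sigma>) ` S) + card (orbit \<sigma> ` S) \<le> 2 * card (f ` S) + length ps"
    by blast
  have st: "s \<in> S" "t \<in> S" "s \<noteq> t" using snoc.prems by (auto simp: p)
  let ?\<pi> = "iprod ps \<circ> \<sigma>"
  have \<pi>: "?\<pi> permutes S"
    by (intro permutes_compose \<sigma> iprod_permutes) (use snoc.prems in auto)
  have ip: "iprod (ps @ [p]) \<circ> \<sigma> = swp s t \<circ> ?\<pi>" by (simp add: p o_assoc)
  note cyc = card_orbits_transpose_compose[OF \<pi> fin st]
  have f_iprod: "f (iprod ps x) = f x" for x
    using f(2)
  proof (induction ps rule: rev_induct)
    case (snoc q qs)
    obtain u v where q: "q = (u, v)" by force
    have "f (swp u v y) = f y" for y using snoc.prems by (auto simp: q Transposition.transpose_def)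
    then show ?case using snoc by (simp add: q)
  qed simp
  have f_orbit: "f y = f x" if "y \<in> orbit ?\<pi> x" for x y
    using that by induction (auto simp: f_iprod f(1))
  show ?case
  proof (cases "t \<in> orbit ?\<pi> s")
    case True
    then have "f t = f s" by (rule f_orbit)
    moreover have "card (orbit (swp s t \<circ> ?\<pi>) ` S) = Suc (card (orbit ?\<pi> ` S))"
      using cyc True by (simp only: if_True)
    then have "card (orbit (swp s t \<circ> ?\<pi>) ` S) + card (orbit \<sigma> ` S) \<le> 2 * card (f ` S) + length (ps @ [p])"
      unfolding length_append_singleton using f(3) by linarith
    ultimately show ?thesis unfolding ip using f(1,2) by (intro exI[of _ f]) (simp only: p set_append, auto)
  next
    case False
    \<comment> \<open>Two cycles are joined, so the labels of \<open>s\<close> and \<open>t\<close>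
      are identified. The left side drops by 1; on the right at most one label is lost, counted
      twice, while the list grows by 1.\<close>
    let ?g = "\<lambda>x. if f x = f t then f s else f x"
    have "f ` S - {f t} \<subseteq> ?g ` S" by (auto simp: image_iff)
    then have "card (f ` S - {f t}) \<le> card (?g ` S)"
      using fin by (intro card_mono) auto
    moreover have "card (f ` S - {f t}) = card (f ` S) - 1" using st by simp
    ultimately have "card (f ` S) \<le> card (?g ` S) + 1" by linarith
    moreover have "Suc (card (orbit (swp s t \<circ> ?\<pi>) ` S)) = card (orbit ?\<pi> ` S)"
      using cyc False by (simp only: if_False)
    ultimately have "card (orbit (swp s t \<circ> ?\<pi>) ` S) + card (orbit \<sigma> ` S) \<le> 2 * card (?g ` S) + length (ps @ [p])"
      unfolding length_append_singleton using f(3) by linarith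
    moreover have "\<forall>(u, v)\<in>set (ps @ [p]). ?g u = ?g v"
    proof -
      have "f u = f v" if "(u, v) \<in> set ps" for u v using f(2) that by auto
      then have "?g (fst q) = ?g (snd q)" if "q \<in> set ps" for q
        using that by (metis prod.collapse)
      moreover have "?g (fst p) = ?g (snd p)" by (simp add: p)
      ultimately have "?g (fst q) = ?g (snd q)" if "q \<in> set (ps @ [p])" for q
        using that by (metis (no_types, lifting) rotate1.simps(2) set_ConsD set_rotate1)
      then show ?thesis unfolding case_prod_beta by blast
    qed
    moreover have "\<forall>x. ?g (\<sigma> x) = ?g x" using f(1) by simp
    ultimately show ?thesis unfolding ip by (intro exI[of _ ?g] conjI)
  qed
qed

text \<open>Each transposition changes the number of cycles by exactly one, and the empty list gives
  twice the number of cycles of \<sigma>.\<close>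

lemma even_cycles_plus_length:
  assumes fin: "finite S" and \<sigma>: "\<sigma> permutes S"
    and "\<forall>(s, t)\<in>set ps. s \<in> S \<and> t \<in> S \<and> s \<noteq> t"
  shows "even (card (orbit (iprod ps \<circ> \<sigma>) ` S) + card (orbit \<sigma> ` S) + length ps)"
  using assms(3)
proof (induction ps rule: rev_induct)
  case (snoc p ps)
  obtain s t where p: "p = (s, t)" by force
  have st: "s \<in> S" "t \<in> S" "s \<noteq> t" using snoc.prems by (auto simp: p)
  let ?\<pi> = "iprod ps \<circ> \<sigma>"
  have \<pi>: "?\<pi> permutes S"
    by (intro permutes_compose \<sigma> iprod_permutes) (use snoc.prems in auto)
  have ip: "iprod (ps @ [p]) \<circ> \<sigma> = swp s t \<circ> ?\<pi>" by (simp add: p o_assoc)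
  have IH: "even (card (orbit ?\<pi> ` S) + card (orbit \<sigma> ` S) + length ps)"
    by (rule snoc.IH) (use snoc.prems in auto)
  show ?case
    using card_orbits_transpose_compose[OF \<pi> fin st] IH unfolding ip length_append_singleton
    by (cases "t \<in> orbit ?\<pi> s") presburger+
qed simp

text \<open>The fibres of an invariant labelling are stable, so connectedness leaves a single label.
  The labelling bound then becomes the Riemann-Hurwitz inequality, and parity makes its defect an
  even number 2g.\<close>

lemma connected_config_genus:
  assumes fin: "finite S" "S \<noteq> {}" and c: "(\<sigma>, ps) \<in> connected_configs S"
  obtains g where "2 * g + card (orbit (iprod ps \<circ> \<sigma>) ` S) + card (orbit \<sigma> ` S) = length ps + 2"
proof -
  have \<sigma>: "\<sigma> permutes S" and ps: "ps \<in> monotone_pairs S"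
    using c by (auto simp: connected_configs_def configs_def)
  then have st: "\<forall>(s, t)\<in>set ps. s \<in> S \<and> t \<in> S \<and> s \<noteq> t" by (auto simp: monotone_pairs_def)
  obtain f :: "nat \<Rightarrow> nat set" where f: "\<And>x. f (\<sigma> x) = f x" "\<forall>(s, t)\<in>set ps. f s = f t"
      "card (orbit (iprod ps \<circ> \<sigma>) ` S) + card (orbit \<sigma> ` S) \<le> 2 * card (f ` S) + length ps"
    using ex_invariant_labelling[OF fin(1) \<sigma> st] by auto
  obtain x where x: "x \<in> S" using fin by auto
  let ?U = "{y \<in> S. f y = f x}"
  have "config_stable (\<sigma>, ps) ?U"
    using f st permutes_in_image[OF \<sigma>] by (auto simp: config_stable_def)
  moreover have "?U \<subseteq> S" "?U \<noteq> {}" using x by auto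
  ultimately have U: "?U = S" using c unfolding connected_configs_def by blast
  have "f y = f x" if "y \<in> S" for y
  proof -
    have "y \<in> ?U" unfolding U by (rule that)
    then show ?thesis by simp
  qed
  then have "f ` S = (\<lambda>_. f x) ` S" by (intro image_cong refl)
  also have "\<dots> = {f x}" using x by auto
  finally have "f ` S = {f x}" .
  then have "card (orbit (iprod ps \<circ> \<sigma>) ` S) + card (orbit \<sigma> ` S) \<le> length ps + 2"
    using f(3) by simp
  moreover have "even (card (orbit (iprod ps \<circ> \<sigma>) ` S) + card (orbit \<sigma> ` S) + length ps)"
    by (rule even_cycles_plus_length[OF fin(1) \<sigma> st])
  ultimately have "even (length ps + 2 - (card (orbit (iprod ps \<circ> \<sigma>) ` S) + card (orbit \<sigma> ` S)))"
    by auto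
  then obtain g where "length ps + 2 - (card (orbit (iprod ps \<circ> \<sigma>) ` S) + card (orbit \<sigma> ` S)) = 2 * g"
    by (elim evenE)
  with \<open>_ \<le> length ps + 2\<close> have "2 * g + card (orbit (iprod ps \<circ> \<sigma>) ` S) + card (orbit \<sigma> ` S) = length ps + 2"
    by linarith
  then show thesis by (rule that)
qed

section \<open>Correspondence with Hurwitz tuples\<close>

abbreviation swaps :: "(nat \<times> nat) list \<Rightarrow> (nat \<Rightarrow> nat) list" where
  "swaps ps \<equiv> map (\<lambda>(s, t). swp s t) ps"

lemma foldr_comp_append_id: "foldr (\<circ>) fs g = foldr (\<circ>) fs id \<circ> g"
  by (induction fs) (auto simp: o_assoc)

text \<open>The two products are taken in opposite orders, so equal transpositions meet in the
  middle and cancel.\<close>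

lemma foldr_swaps_iprod: "foldr (\<circ>) (swaps ps) id \<circ> iprod ps = id"
proof (induction ps rule: rev_induct)
  case (snoc p ps)
  obtain s t where p: "p = (s, t)" by force
  have "foldr (\<circ>) (swaps (ps @ [p])) id \<circ> iprod (ps @ [p]) =
      (foldr (\<circ>) (swaps ps) id \<circ> swp s t) \<circ> (swp s t \<circ> iprod ps)"
    using foldr_comp_append_id[of "swaps ps" "swp s t"] by (simp add: p)
  also have "\<dots> = foldr (\<circ>) (swaps ps) id \<circ> (swp s t \<circ> swp s t) \<circ> iprod ps"
    by (simp only: o_assoc)
  finally show ?case by (simp only: transpose_comp_involutory comp_id snoc)
qed simp

lemma monotone_transpositions_iff:
  "monotone_transpositions d \<tau>s \<longleftrightarrow> \<tau>s \<in> swaps ` monotone_pairs {1..d}"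
proof
  assume "monotone_transpositions d \<tau>s"
  then obtain s t where st: "\<forall>i<length \<tau>s. 1 \<le> s i \<and> s i < t i \<and> t i \<le> d \<and> \<tau>s ! i = swp (s i) (t i)"
    "\<forall>i j. i \<le> j \<and> j < length \<tau>s \<longrightarrow> t i \<le> t j"
    unfolding monotone_transpositions_def by blast
  let ?ps = "map (\<lambda>i. (s i, t i)) [0..<length \<tau>s]"
  have "\<tau>s = swaps ?ps" by (rule nth_equalityI) (use st in auto)
  moreover have "?ps \<in> monotone_pairs {1..d}"
    using st by (fastforce simp: monotone_pairs_def sorted_iff_nth_mono)
  ultimately show "\<tau>s \<in> swaps ` monotone_pairs {1..d}" by blast
next
  assume "\<tau>s \<in> swaps ` monotone_pairs {1..d}"
  then obtain ps where ps: "ps \<in> monotone_pairs {1..d}" "\<tau>s = swaps ps" by auto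
  have "(\<forall>i<length \<tau>s. 1 \<le> fst (ps ! i) \<and> fst (ps ! i) < snd (ps ! i) \<and> snd (ps ! i) \<le> d \<and>
        \<tau>s ! i = swp (fst (ps ! i)) (snd (ps ! i)))"
  proof safe
    fix i assume "i < length \<tau>s"
    then have "ps ! i \<in> set ps" using ps by auto
    then have "fst (ps ! i) \<in> {1..d}" "snd (ps ! i) \<in> {1..d}" "fst (ps ! i) < snd (ps ! i)"
      using ps(1) by (auto simp: monotone_pairs_def)
    then show "1 \<le> fst (ps ! i)" "fst (ps ! i) < snd (ps ! i)" "snd (ps ! i) \<le> d" by auto
    show "\<tau>s ! i = swp (fst (ps ! i)) (snd (ps ! i))"
      using \<open>i < length \<tau>s\<close> ps by (simp add: case_prod_beta)
  qed
  moreover have "\<forall>i j. i \<le> j \<and> j < length \<tau>s \<longrightarrow> snd (ps ! i) \<le> snd (ps ! j)"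
    using ps by (auto simp: monotone_pairs_def sorted_iff_nth_mono)
  ultimately show "monotone_transpositions d \<tau>s"
    unfolding monotone_transpositions_def
    by (intro exI[of _ "\<lambda>i. fst (ps ! i)"] exI[of _ "\<lambda>i. snd (ps ! i)"] conjI)
qed

lemma swp_eq_iff:
  assumes "s < t" "u < v"
  shows "swp s t = swp u v \<longleftrightarrow> s = u \<and> t = v"
proof
  assume eq: "swp s t = swp u v"
  have "swp u v s = t" "swp u v t = s" using eq[symmetric] by auto
  then show "s = u \<and> t = v"
    using assms by (auto simp: Transposition.transpose_def split: if_splits)
qed auto

lemma inj_on_swaps: "inj_on swaps (monotone_pairs S)"
proof (rule inj_onI)
  fix ps qs assume "ps \<in> monotone_pairs S" "qs \<in> monotone_pairs S" and eq: "swaps ps = swaps qs"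
  then have *: "\<forall>p\<in>set ps. fst p < snd p" "\<forall>p\<in>set qs. fst p < snd p"
    by (auto simp: monotone_pairs_def)
  show "ps = qs"
  proof (rule nth_equalityI)
    show len: "length ps = length qs" using map_eq_imp_length_eq[OF eq] .
    fix i assume i: "i < length ps"
    have "swaps ps ! i = swaps qs ! i" using eq by simp
    then have "swp (fst (ps ! i)) (snd (ps ! i)) = swp (fst (qs ! i)) (snd (qs ! i))"
      using i len by (simp add: case_prod_beta)
    moreover have "fst (ps ! i) < snd (ps ! i)" "fst (qs ! i) < snd (qs ! i)"
      using * i len by auto
    ultimately show "ps ! i = qs ! i" using swp_eq_iff by (simp add: prod_eq_iff)
  qed
qed

text \<open>If the group is transitive, a stable set is mapped onto itself by every generator, hence
  by the whole group, and must be everything. Conversely, an orbit of the group is stable; here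
  \<sigma> belongs to the group as the inverse of a generator.\<close>

lemma generates_transitive_iff:
  assumes c: "(\<sigma>, ps) \<in> configs {1..d}"
  shows "generates_transitive d ({iprod ps \<circ> \<sigma>, inv_into UNIV \<sigma>} \<union> set (swaps ps)) \<longleftrightarrow>
    (\<sigma>, ps) \<in> connected_configs {1..d}"
    (is "generates_transitive d ?G \<longleftrightarrow> _")
proof
  have \<sigma>: "\<sigma> permutes {1..d}" and ps: "ps \<in> monotone_pairs {1..d}" using c by (auto simp: configs_def)
  assume tr: "generates_transitive d ?G"
  have "U = {1..d}" if U: "U \<subseteq> {1..d}" "U \<noteq> {}" "config_stable (\<sigma>, ps) U" for U
  proof -
    have finU: "finite U" using U finite_subset by blast
    have \<sigma>U: "\<sigma> ` U = U"
      by (rule permutes_image_eq_if_subset[OF \<sigma> finU]) (use U in \<open>auto simp: config_stable_def\<close>)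
    have ipU: "iprod ps ` U \<subseteq> U"
      using iprod_filter[of ps U, THEN conjunct2] U(3) unfolding config_stable_def by auto
    have "h permutes {1..d} \<and> h ` U = U" if hG: "h \<in> ?G" for h
    proof -
      consider "h = iprod ps \<circ> \<sigma>" | "h = inv_into UNIV \<sigma>" | s t where "(s, t) \<in> set ps" "h = swp s t"
        using hG by auto
      then show ?thesis
      proof cases
        case 1
        have hp: "h permutes {1..d}" unfolding 1
          by (intro permutes_compose \<sigma> iprod_permutes_monotone_pairs ps)
        have "h ` U \<subseteq> U" using \<sigma>U ipU unfolding 1 image_comp[symmetric] by simp
        then show ?thesis using hp permutes_image_eq_if_subset[OF hp finU] by blast
      next
        case 2
        have "h ` (\<sigma> ` U) = U" unfolding 2 by (rule image_inv_f_f[OF permutes_inj[OF \<sigma>]])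
        then show ?thesis using permutes_inv[OF \<sigma>] \<sigma>U 2 by simp
      next
        case 3
        have hp: "h permutes {1..d}" unfolding 3
          by (rule permutes_swap_id) (use 3 ps in \<open>auto simp: monotone_pairs_def\<close>)
        have "s \<in> U \<longleftrightarrow> t \<in> U" using U 3 by (auto simp: config_stable_def)
        then have "h ` U \<subseteq> U" unfolding 3 by (auto simp: Transposition.transpose_def)
        then show ?thesis using hp permutes_image_eq_if_subset[OF hp finU] by blast
      qed
    qed note gen = this
    have "\<pi> ` U = U" if "\<pi> \<in> generate (sym_group d) ?G" for \<pi>
      using that
    proof induction
      case one
      then show ?case by (simp add: sym_group_def)
    next
      case (incl h)
      then show ?case using gen by blast
    next
      case (inv h)
      have h: "h permutes {1..d}" "h ` U = U" using gen inv by blast+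
      have "inv_into UNIV h ` (h ` U) = U" by (rule image_inv_f_f[OF permutes_inj[OF h(1)]])
      moreover have "inv\<^bsub>sym_group d\<^esub> h = inv_into UNIV h"
        by (rule sym_group_inv_equality) (use h in \<open>simp add: sym_group_def\<close>)
      ultimately show ?case using h by simp
    next
      case (eng h1 h2)
      have "h1 \<otimes>\<^bsub>sym_group d\<^esub> h2 = h1 \<circ> h2" by (simp add: sym_group_def)
      moreover have "(h1 \<circ> h2) ` U = U" unfolding image_comp[symmetric] eng.IH ..
      ultimately show ?case by (simp only:)
    qed
    note HU = this
    obtain x where x: "x \<in> U" using U by auto
    have "y \<in> U" if y: "y \<in> {1..d}" for y
    proof -
      obtain \<pi> where \<pi>: "\<pi> \<in> generate (sym_group d) ?G" "\<pi> x = y"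
        using tr y x U(1) unfolding generates_transitive_def by blast
      then have "y \<in> \<pi> ` U" using x by auto
      then show ?thesis using HU[OF \<pi>(1)] by simp
    qed
    then show ?thesis using U(1) by blast
  qed
  then show "(\<sigma>, ps) \<in> connected_configs {1..d}" using c by (auto simp: connected_configs_def)
next
  have \<sigma>: "\<sigma> permutes {1..d}" and ps: "ps \<in> monotone_pairs {1..d}" using c by (auto simp: configs_def)
  assume conn: "(\<sigma>, ps) \<in> connected_configs {1..d}"
  let ?H = "generate (sym_group d) ?G"
  have mult: "f \<circ> g \<in> ?H" if "f \<in> ?H" "g \<in> ?H" for f g
    using generate.eng[OF that] by (simp add: sym_group_def)
  have \<sigma>H: "\<sigma> \<in> ?H"
  proof -
    have "inv_into UNIV \<sigma> permutes {1..d}" by (rule permutes_inv[OF \<sigma>])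
    then have "inv\<^bsub>sym_group d\<^esub> (inv_into UNIV \<sigma>) = inv_into UNIV (inv_into UNIV \<sigma>)"
      by (intro sym_group_inv_equality) (simp add: sym_group_def)
    also have "\<dots> = \<sigma>" by (rule inv_inv_eq[OF permutes_bij[OF \<sigma>]])
    finally show ?thesis using generate.inv[of "inv_into UNIV \<sigma>" ?G "sym_group d"] by simp
  qed
  have swp_permutes: "swp s t permutes {1..d}" if "(s, t) \<in> set ps" for s t
    by (rule permutes_swap_id) (use that ps in \<open>auto simp: monotone_pairs_def\<close>)
  have G_permutes: "h permutes {1..d}" if "h \<in> ?G" for h
  proof -
    have "h = iprod ps \<circ> \<sigma> \<or> h = inv_into UNIV \<sigma> \<or> (\<exists>(s, t)\<in>set ps. h = swp s t)"
      using that by auto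
    then show ?thesis
      using permutes_inv[OF \<sigma>] permutes_compose[OF \<sigma> iprod_permutes_monotone_pairs[OF ps]] swp_permutes
      by blast
  qed
  have "\<exists>\<pi>\<in>?H. \<pi> x = y" if xy: "x \<in> {1..d}" "y \<in> {1..d}" for x y
  proof -
    have Hp: "\<pi> permutes {1..d}" if "\<pi> \<in> ?H" for \<pi>
      using that
    proof induction
      case one
      have "\<one>\<^bsub>sym_group d\<^esub> = id" by (simp add: sym_group_def)
      then show ?case by (simp only: permutes_id)
    next
      case (incl h)
      then show ?case using G_permutes by blast
    next
      case (inv h)
      then have h: "h permutes {1..d}" using G_permutes by blast
      have "inv\<^bsub>sym_group d\<^esub> h = inv_into UNIV h"
        by (rule sym_group_inv_equality) (use h in \<open>simp add: sym_group_def\<close>)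
      then show ?case using permutes_inv[OF h] by simp
    next
      case (eng h1 h2)
      have "h1 \<otimes>\<^bsub>sym_group d\<^esub> h2 = h1 \<circ> h2" by (simp add: sym_group_def)
      then show ?case using permutes_compose[OF eng.IH(2,1)] by (simp only:)
    qed
    let ?U = "(\<lambda>\<pi>. \<pi> x) ` ?H"
    have "?U \<subseteq> {1..d}" using Hp permutes_in_image xy by fastforce
    moreover have "?U \<noteq> {}" using \<sigma>H by auto
    moreover have "config_stable (\<sigma>, ps) ?U"
    proof -
      have swH: "swp s t \<in> ?H" if "(s, t) \<in> set ps" for s t
        by (rule generate.incl) (use that in force)
      have step: "h z \<in> ?U" if hz: "h \<in> ?H" "z \<in> ?U" for h z
      proof -
        obtain \<pi> where "\<pi> \<in> ?H" "z = \<pi> x" using hz(2) by (rule imageE)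
        then have "h \<circ> \<pi> \<in> ?H" "h z = (h \<circ> \<pi>) x" using mult hz by auto
        then show ?thesis by (intro image_eqI[of _ _ "h \<circ> \<pi>"])
      qed
      have "s \<in> ?U \<longleftrightarrow> t \<in> ?U" if "(s, t) \<in> set ps" for s t
        using step[OF swH[OF that], of s] step[OF swH[OF that], of t]
        by (metis transpose_apply_first transpose_apply_second)
      then show ?thesis
        using step[OF \<sigma>H] unfolding config_stable_def fst_conv snd_conv by (intro conjI image_subsetI) auto
    qed
    ultimately have "?U = {1..d}" using conn unfolding connected_configs_def by blast
    then have "y \<in> ?U" using xy(2) by (simp only:)
    then show ?thesis by (rule imageE) blast
  qed
  then show "generates_transitive d ?G" unfolding generates_transitive_def by blast
qed

definition hurwitz_tuple :: "config \<Rightarrow> (nat \<Rightarrow> nat) \<times> (nat \<Rightarrow> nat) \<times> (nat \<Rightarrow> nat) list" where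
  "hurwitz_tuple c = (iprod (snd c) \<circ> fst c, inv_into UNIV (fst c), swaps (snd c))"

lemma cycle_type_inv: "\<sigma> permutes {1..d} \<Longrightarrow> cycle_type d (inv_into UNIV \<sigma>) = cycle_type d \<sigma>"
  by (simp add: cycle_type_def orbit_inv_permutes)

text \<open>Every tuple is reached because the product condition can be solved for \<rho>. Inverting
  the second permutation does not change its cycle type.\<close>

lemma bij_betw_hurwitz_tuple:
  "bij_betw hurwitz_tuple
    {c \<in> connected_configs {1..d}. length (snd c) = r \<and>
      cycle_type d (iprod (snd c) \<circ> fst c) = \<alpha> \<and> cycle_type d (fst c) = \<beta>}
    (hurwitz_tuples d r \<alpha> \<beta>)" (is "bij_betw _ ?C _")
proof (rule bij_betw_imageI)
  have C: "?C \<subseteq> configs {1..d}" by (auto simp: connected_configs_def)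
  show "inj_on hurwitz_tuple ?C"
  proof (rule inj_onI)
    fix c c' assume "c \<in> ?C" "c' \<in> ?C" and eq: "hurwitz_tuple c = hurwitz_tuple c'"
    then have cc: "fst c permutes {1..d}" "fst c' permutes {1..d}"
      "snd c \<in> monotone_pairs {1..d}" "snd c' \<in> monotone_pairs {1..d}"
      using C by (auto simp: configs_def)
    have "snd c = snd c'" using inj_onD[OF inj_on_swaps _ cc(3,4)] eq by (simp add: hurwitz_tuple_def)
    moreover have "inv_into UNIV (inv_into UNIV (fst c)) = inv_into UNIV (inv_into UNIV (fst c'))"
      using eq by (simp add: hurwitz_tuple_def)
    then have "fst c = fst c'" using inv_inv_eq[OF permutes_bij[OF cc(1)]] inv_inv_eq[OF permutes_bij[OF cc(2)]] by simp
    ultimately show "c = c'" by (simp add: prod_eq_iff)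
  qed
  show "hurwitz_tuple ` ?C = hurwitz_tuples d r \<alpha> \<beta>"
  proof (intro equalityI subsetI)
    fix x assume "x \<in> hurwitz_tuple ` ?C"
    then obtain \<sigma> ps where c: "(\<sigma>, ps) \<in> ?C" "x = hurwitz_tuple (\<sigma>, ps)" by auto
    then have c': "(\<sigma>, ps) \<in> configs {1..d}" using C by blast
    have \<sigma>: "\<sigma> permutes {1..d}" and ps: "ps \<in> monotone_pairs {1..d}" using c' by (auto simp: configs_def)
    have ip: "iprod ps permutes {1..d}" by (rule iprod_permutes_monotone_pairs[OF ps])
    have fip: "foldr (\<circ>) (swaps ps) id = inv_into UNIV (iprod ps)"
      by (rule inv_unique_comp[symmetric, OF _ foldr_swaps_iprod])
        (metis foldr_swaps_iprod bij_is_surj permutes_bij[OF ip] comp_id fun.map_id id_comp o_assoc surj_iff)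
    have "(iprod ps \<circ> \<sigma>) \<circ> inv_into UNIV \<sigma> \<circ> foldr (\<circ>) (swaps ps) id =
        iprod ps \<circ> (\<sigma> \<circ> inv_into UNIV \<sigma>) \<circ> inv_into UNIV (iprod ps)"
      unfolding fip by (simp only: o_assoc)
    also have "\<dots> = id" using permutes_inv_o[OF \<sigma>] permutes_inv_o[OF ip] by simp
    finally have "iprod ps \<circ> \<sigma> \<circ> inv_into UNIV \<sigma> \<circ> foldr (\<circ>) (swaps ps) id = id" .
    then show "x \<in> hurwitz_tuples d r \<alpha> \<beta>"
      using c generates_transitive_iff[OF c'] cycle_type_inv[OF \<sigma>] permutes_inv[OF \<sigma>]
        permutes_compose[OF \<sigma> ip] monotone_transpositions_iff[of d "swaps ps"] ps
      by (auto simp: hurwitz_tuples_def hurwitz_tuple_def)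
  next
    fix x assume x: "x \<in> hurwitz_tuples d r \<alpha> \<beta>"
    obtain \<rho> \<sigma>' \<tau>s where xx: "x = (\<rho>, \<sigma>', \<tau>s)" by (cases x) auto
    have h: "\<rho> permutes {1..d}" "\<sigma>' permutes {1..d}" "length \<tau>s = r" "cycle_type d \<rho> = \<alpha>"
      "cycle_type d \<sigma>' = \<beta>" "monotone_transpositions d \<tau>s"
      "\<rho> \<circ> \<sigma>' \<circ> foldr (\<circ>) \<tau>s id = id" "generates_transitive d ({\<rho>, \<sigma>'} \<union> set \<tau>s)"
      using x unfolding xx hurwitz_tuples_def by auto
    obtain ps where ps: "ps \<in> monotone_pairs {1..d}" "\<tau>s = swaps ps"
      using h(6) unfolding monotone_transpositions_iff by auto
    let ?\<sigma> = "inv_into UNIV \<sigma>'"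
    have \<sigma>: "?\<sigma> permutes {1..d}" by (rule permutes_inv[OF h(2)])
    have \<sigma>': "inv_into UNIV ?\<sigma> = \<sigma>'" by (rule inv_inv_eq[OF permutes_bij[OF h(2)]])
    have "\<rho> \<circ> \<sigma>' = \<rho> \<circ> \<sigma>' \<circ> (foldr (\<circ>) \<tau>s id \<circ> iprod ps)"
      unfolding ps foldr_swaps_iprod by simp
    also have "\<dots> = (\<rho> \<circ> \<sigma>' \<circ> foldr (\<circ>) \<tau>s id) \<circ> iprod ps" by (simp only: o_assoc)
    also have "\<dots> = iprod ps" using h(7) by simp
    finally have "\<rho> \<circ> (\<sigma>' \<circ> ?\<sigma>) = iprod ps \<circ> ?\<sigma>" by (simp only: o_assoc)
    then have \<rho>: "\<rho> = iprod ps \<circ> ?\<sigma>" using permutes_inv_o[OF h(2)] by simp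
    have c': "(?\<sigma>, ps) \<in> configs {1..d}" using \<sigma> ps by (simp add: configs_def)
    have "(?\<sigma>, ps) \<in> connected_configs {1..d}"
      using generates_transitive_iff[OF c'] h(8) unfolding \<sigma>' \<rho>[symmetric] ps(2) by simp
    then have "(?\<sigma>, ps) \<in> ?C" using h \<rho> ps cycle_type_inv[OF h(2)] by simp
    moreover have "hurwitz_tuple (?\<sigma>, ps) = x"
      by (simp add: hurwitz_tuple_def xx \<sigma>' \<rho>[symmetric] ps(2))
    ultimately show "x \<in> hurwitz_tuple ` ?C" by (intro image_eqI[of _ _ "(?\<sigma>, ps)"]) auto
  qed
qed

section \<open>Index sums over permutations\<close>

lemma sum_PiE_insert:
  fixes h :: "('i \<Rightarrow> 'v::finite) \<Rightarrow> 'b::comm_monoid_add"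
  assumes "finite S" "m \<notin> S"
  shows "(\<Sum>c\<in>insert m S \<rightarrow>\<^sub>E UNIV. h c) = (\<Sum>c\<in>S \<rightarrow>\<^sub>E UNIV. \<Sum>y\<in>UNIV. h (c(m := y)))"
proof -
  have "(\<Sum>c\<in>insert m S \<rightarrow>\<^sub>E UNIV. h c) = (\<Sum>(y, c)\<in>UNIV \<times> (S \<rightarrow>\<^sub>E UNIV). h (c(m := y)))"
    unfolding PiE_insert_eq
    by (subst sum.reindex[OF inj_combinator[OF assms(2)]]) (simp add: case_prod_beta)
  also have "\<dots> = (\<Sum>y\<in>UNIV. \<Sum>c\<in>S \<rightarrow>\<^sub>E UNIV. h (c(m := y)))"
    by (rule sum.cartesian_product[symmetric])
  also have "\<dots> = (\<Sum>c\<in>S \<rightarrow>\<^sub>E UNIV. \<Sum>y\<in>UNIV. h (c(m := y)))"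
    by (rule sum.swap)
  finally show ?thesis .
qed

text \<open>The product over the cycles of \<open>\<sigma>\<close> of the traces of the matrix products along the cycle.\<close>

definition index_sum :: "nat set \<Rightarrow> (nat \<Rightarrow> complex^'n^'n) \<Rightarrow> (nat \<Rightarrow> nat) \<Rightarrow> complex" where
  "index_sum S M \<sigma> = (\<Sum>c\<in>S \<rightarrow>\<^sub>E UNIV. \<Prod>k\<in>S. M k $ c k $ c (\<sigma> k))"

lemma index_sum_insert_fixed:
  assumes "finite S" "m \<notin> S" "\<sigma> permutes S"
  shows "index_sum (insert m S) M \<sigma> = trace (M m) * index_sum S M \<sigma>"
proof -
  have \<sigma>m: "\<sigma> m = m" using assms permutes_not_in by metis
  have ne: "\<sigma> k \<noteq> m" "k \<noteq> m" if "k \<in> S" for k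
    using permutes_in_image[OF assms(3), of k] that assms(2) by auto
  have "index_sum (insert m S) M \<sigma> =
      (\<Sum>c\<in>S \<rightarrow>\<^sub>E UNIV. \<Sum>y\<in>UNIV. M m $ y $ y * (\<Prod>k\<in>S. M k $ c k $ c (\<sigma> k)))"
    unfolding index_sum_def sum_PiE_insert[OF assms(1,2)] prod.insert[OF assms(1,2)]
    by (intro sum.cong refl arg_cong2[where f = "(*)"] prod.cong) (auto simp: \<sigma>m ne)
  then show ?thesis
    by (simp add: index_sum_def trace_def sum_distrib_left sum_distrib_right)
qed

text \<open>The transposition splices \<open>m\<close> into the cycle of \<sigma> directly after
  \<open>s\<close>; summing over the index at \<open>m\<close> is then the matrix product of the two
  neighbours.\<close>

lemma index_sum_insert_compose_transpose:
  assumes "finite S" "m \<notin> S" "\<sigma> permutes S" "s \<in> S"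
  shows "index_sum (insert m S) M (\<sigma> \<circ> swp s m) = index_sum S (M(s := M s ** M m)) \<sigma>"
proof -
  have \<sigma>m: "\<sigma> m = m" using assms permutes_not_in by metis
  have ne: "\<sigma> k \<noteq> m" "k \<noteq> m" if "k \<in> S" for k
    using permutes_in_image[OF assms(3), of k] that assms(2) by auto
  have "(\<Prod>k\<in>insert m S. M k $ (c(m := y)) k $ (c(m := y)) ((\<sigma> \<circ> swp s m) k)) =
      (M s $ c s $ y * M m $ y $ c (\<sigma> s)) * (\<Prod>k\<in>S - {s}. M k $ c k $ c (\<sigma> k))" for c y
  proof -
    have "(\<Prod>k\<in>S. M k $ (c(m := y)) k $ (c(m := y)) ((\<sigma> \<circ> swp s m) k)) =
        M s $ c s $ y * (\<Prod>k\<in>S - {s}. M k $ c k $ c (\<sigma> k))"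
      unfolding prod.remove[OF assms(1,4)]
      by (intro arg_cong2[where f = "(*)"] prod.cong)
        (use ne \<sigma>m assms(4) in \<open>auto simp: Transposition.transpose_def\<close>)
    then show ?thesis
      unfolding prod.insert[OF assms(1,2)] using ne[of s] assms(4) by (simp add: mult_ac)
  qed
  then have "index_sum (insert m S) M (\<sigma> \<circ> swp s m) =
      (\<Sum>c\<in>S \<rightarrow>\<^sub>E UNIV. \<Sum>y\<in>UNIV. (M s $ c s $ y * M m $ y $ c (\<sigma> s)) * (\<Prod>k\<in>S - {s}. M k $ c k $ c (\<sigma> k)))"
    unfolding index_sum_def sum_PiE_insert[OF assms(1,2)] by (intro sum.cong refl)
  also have "\<dots> = (\<Sum>c\<in>S \<rightarrow>\<^sub>E UNIV. (M s ** M m) $ c s $ c (\<sigma> s) * (\<Prod>k\<in>S - {s}. M k $ c k $ c (\<sigma> k)))"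
    by (simp add: matrix_matrix_mult_def sum_distrib_right)
  also have "\<dots> = index_sum S (M(s := M s ** M m)) \<sigma>"
    unfolding index_sum_def prod.remove[OF assms(1,4)]
    by (intro sum.cong refl arg_cong2[where f = "(*)"] prod.cong) auto
  finally show ?thesis .
qed

text \<open>The point \<open>s\<close> is the preimage of \<open>m\<close>; composing with the swap
  makes \<open>m\<close> a fixed point, that is, removes it from its cycle.\<close>

lemma bij_betw_permutes_insert:
  assumes m: "m \<notin> S"
  shows "bij_betw (\<lambda>(s, \<sigma>). \<sigma> \<circ> swp s m) (insert m S \<times> {\<sigma>. \<sigma> permutes S}) {\<tau>. \<tau> permutes insert m S}"
proof (rule bij_betw_byWitness[where f' = "\<lambda>\<tau>. (inv_into UNIV \<tau> m, \<tau> \<circ> swp (inv_into UNIV \<tau> m) m)"])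
  show "\<forall>a\<in>insert m S \<times> {\<sigma>. \<sigma> permutes S}.
      (inv_into UNIV (case a of (s, \<sigma>) \<Rightarrow> \<sigma> \<circ> swp s m) m,
        (case a of (s, \<sigma>) \<Rightarrow> \<sigma> \<circ> swp s m) \<circ> swp (inv_into UNIV (case a of (s, \<sigma>) \<Rightarrow> \<sigma> \<circ> swp s m) m) m) = a"
  proof
    fix a assume a: "a \<in> insert m S \<times> {\<sigma>. \<sigma> permutes S}"
    define s \<sigma> where "s = fst a" and "\<sigma> = snd a"
    have s: "s \<in> insert m S" and \<sigma>: "\<sigma> permutes S" using a by (auto simp: s_def \<sigma>_def)
    have "\<sigma> \<circ> swp s m permutes insert m S"
      by (rule permutes_compose[OF permutes_swap_id permutes_subset[OF \<sigma>]]) (use s in auto)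
    then have "inv_into UNIV (\<sigma> \<circ> swp s m) m = s"
      using permutes_not_in[OF \<sigma> m] by (simp add: permutes_inv_eq)
    then have "(inv_into UNIV (\<sigma> \<circ> swp s m) m, (\<sigma> \<circ> swp s m) \<circ> swp (inv_into UNIV (\<sigma> \<circ> swp s m) m) m) = (s, \<sigma>)"
      by (simp only: o_assoc[symmetric] transpose_comp_involutory comp_id)
    then show "(inv_into UNIV (case a of (s, \<sigma>) \<Rightarrow> \<sigma> \<circ> swp s m) m,
        (case a of (s, \<sigma>) \<Rightarrow> \<sigma> \<circ> swp s m) \<circ> swp (inv_into UNIV (case a of (s, \<sigma>) \<Rightarrow> \<sigma> \<circ> swp s m) m) m) = a"
      by (simp only: case_prod_beta s_def \<sigma>_def prod.collapse)
  qed
  show "\<forall>\<tau>\<in>{\<tau>. \<tau> permutes insert m S}.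
      (case (inv_into UNIV \<tau> m, \<tau> \<circ> swp (inv_into UNIV \<tau> m) m) of (s, \<sigma>) \<Rightarrow> \<sigma> \<circ> swp s m) = \<tau>"
    by (simp only: prod.case o_assoc[symmetric] transpose_comp_involutory comp_id) simp
  show "(\<lambda>(s, \<sigma>). \<sigma> \<circ> swp s m) ` (insert m S \<times> {\<sigma>. \<sigma> permutes S}) \<subseteq> {\<tau>. \<tau> permutes insert m S}"
  proof (intro image_subsetI)
    fix a assume a: "a \<in> insert m S \<times> {\<sigma>. \<sigma> permutes S}"
    then have "snd a permutes insert m S" by (auto intro: permutes_subset)
    moreover have "swp (fst a) m permutes insert m S" by (rule permutes_swap_id) (use a in auto)
    ultimately show "(case a of (s, \<sigma>) \<Rightarrow> \<sigma> \<circ> swp s m) \<in> {\<tau>. \<tau> permutes insert m S}"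
      unfolding case_prod_beta mem_Collect_eq by (intro permutes_compose)
  qed
  show "(\<lambda>\<tau>. (inv_into UNIV \<tau> m, \<tau> \<circ> swp (inv_into UNIV \<tau> m) m)) ` {\<tau>. \<tau> permutes insert m S}
      \<subseteq> insert m S \<times> {\<sigma>. \<sigma> permutes S}"
  proof (intro image_subsetI)
    fix \<tau> assume "\<tau> \<in> {\<tau>. \<tau> permutes insert m S}"
    then have \<tau>: "\<tau> permutes insert m S" by simp
    let ?s = "inv_into UNIV \<tau> m"
    have s: "?s \<in> insert m S" using permutes_in_image[OF permutes_inv[OF \<tau>]] by blast
    have "\<tau> \<circ> swp ?s m permutes insert m S"
      by (rule permutes_compose[OF permutes_swap_id \<tau>]) (use s in auto)
    moreover have fx: "(\<tau> \<circ> swp ?s m) m = m" using permutes_inverses(1)[OF \<tau>] by simp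
    moreover have "(\<tau> \<circ> swp ?s m) y = y" if "y \<in> insert m S - S" for y using that fx by blast
    ultimately have "\<tau> \<circ> swp ?s m permutes S" using permutes_superset by blast
    with s show "(?s, \<tau> \<circ> swp ?s m) \<in> insert m S \<times> {\<sigma>. \<sigma> permutes S}" by simp
  qed
qed

lemma matrix_power_0 [simp]: "matrix_power B 0 = mat 1"
  by (simp add: matrix_power_def)

lemma matrix_power_Suc: "matrix_power B (Suc k) = B ** matrix_power B k"
  by (simp add: matrix_power_def)

lemma matrix_power_add: "matrix_power B (j + k) = matrix_power B j ** matrix_power B k"
  by (induction j) (simp_all add: matrix_power_Suc matrix_mul_assoc)

text \<open>Individual exponents are needed for the induction: splicing \<open>m\<close> in after
  \<open>s\<close> replaces the power at \<open>s\<close> by the power with exponent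
  \<open>e s + e m\<close>.\<close>

lemma index_sum_matrix_power:
  fixes B :: "complex^'n^'n"
  assumes "finite S" "\<sigma> permutes S"
  shows "index_sum S (\<lambda>k. matrix_power B (e k)) \<sigma> =
    (\<Prod>C\<in>orbit \<sigma> ` S. trace (matrix_power B (sum e C)))"
  using assms
proof (induction S arbitrary: \<sigma> e rule: finite_induct)
  case empty
  then show ?case by (simp add: index_sum_def)
next
  case (insert m S \<tau>)
  let ?t = "\<lambda>e C. trace (matrix_power B (sum e C))"
  have fin: "finite (insert m S)" using insert.hyps by simp
  have "\<tau> \<in> (\<lambda>(s, \<sigma>). \<sigma> \<circ> swp s m) ` (insert m S \<times> {\<sigma>. \<sigma> permutes S})"
    using insert.prems unfolding bij_betw_imp_surj_on[OF bij_betw_permutes_insert[OF insert.hyps(2)]] by simp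
  then obtain s \<sigma> where s: "s \<in> insert m S" and \<sigma>: "\<sigma> permutes S" and \<tau>: "\<tau> = \<sigma> \<circ> swp s m"
    by (elim imageE SigmaE) (simp only: prod.case mem_Collect_eq)
  have \<sigma>': "\<sigma> permutes insert m S" by (rule permutes_subset[OF \<sigma>]) auto
  have om: "orbit \<sigma> m = {m}"
    unfolding orbit_eq_singleton_iff using permutes_not_in[OF \<sigma> insert.hyps(2)] .
  have oS: "orbit \<sigma> k \<subseteq> S" if "k \<in> S" for k by (rule permutes_orbit_subset[OF \<sigma> that])
  have m_orb: "{m} \<notin> orbit \<sigma> ` S" using oS insert.hyps(2) by fastforce
  show ?case
  proof (cases "s = m")
    case True
    have "index_sum (insert m S) (\<lambda>k. matrix_power B (e k)) \<tau> =
        trace (matrix_power B (e m)) * (\<Prod>C\<in>orbit \<sigma> ` S. ?t e C)"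
      using index_sum_insert_fixed[OF insert.hyps \<sigma>, of "\<lambda>k. matrix_power B (e k)"] insert.IH[OF \<sigma>]
      by (simp add: \<tau> True)
    also have "\<dots> = (\<Prod>C\<in>insert {m} (orbit \<sigma> ` S). ?t e C)"
      using m_orb insert.hyps(1) by (subst prod.insert) auto
    finally show ?thesis by (simp add: \<tau> True om)
  next
    case False
    then have sS: "s \<in> S" using s by simp
    let ?O = "orbit \<sigma> s"
    let ?e = "e(s := e s + e m)"
    have perm: "permutation \<sigma>" using \<sigma> insert.hyps(1) by (auto simp: permutation_permutes)
    have sO: "s \<in> ?O" by (rule permutation_self_in_orbit[OF perm])
    have finO: "finite ?O" using oS[OF sS] insert.hyps(1) finite_subset by blast
    have mO: "m \<notin> ?O" using oS[OF sS] insert.hyps(2) by auto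
    have "orbit \<tau> ` insert m S = insert (?O \<union> {m}) (orbit \<sigma> ` insert m S - {?O, {m}})"
      using orbits_compose_transpose_join[OF \<sigma>' fin _ _ mO] sS by (simp add: \<tau> om)
    also have "orbit \<sigma> ` insert m S - {?O, {m}} = orbit \<sigma> ` S - {?O}"
      using m_orb by (auto simp: om)
    finally have orbs: "orbit \<tau> ` insert m S = insert (?O \<union> {m}) (orbit \<sigma> ` S - {?O})" .
    have notin: "?O \<union> {m} \<notin> orbit \<sigma> ` S - {?O}"
      using oS insert.hyps(2) by fast
    have sumO: "sum ?e ?O = sum e (?O \<union> {m})"
    proof -
      have "sum ?e ?O = e s + e m + sum e (?O - {s})"
        using finO sO by (subst sum.remove[of _ s]) (auto intro!: sum.cong)
      also have "\<dots> = e m + sum e ?O" using finO sO by (subst (2) sum.remove[of _ s]) auto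
      finally show ?thesis using finO mO by simp
    qed
    have sum_other: "sum ?e C = sum e C" if hC: "C \<in> orbit \<sigma> ` S - {?O}" for C
    proof -
      obtain k where k: "k \<in> S" "C = orbit \<sigma> k" "C \<noteq> ?O" using hC by auto
      have "s \<notin> C" using orbit_eq_if_mem[OF perm, of s k] k by metis
      then show ?thesis by (intro sum.cong) auto
    qed
    have "(\<lambda>k. matrix_power B (?e k)) =
        (\<lambda>k. matrix_power B (e k))(s := matrix_power B (e s) ** matrix_power B (e m))"
      by (auto simp: matrix_power_add)
    then have "index_sum (insert m S) (\<lambda>k. matrix_power B (e k)) \<tau> =
        index_sum S (\<lambda>k. matrix_power B (?e k)) \<sigma>"
      unfolding \<tau> using index_sum_insert_compose_transpose[OF insert.hyps \<sigma> sS, of "\<lambda>k. matrix_power B (e k)"] by simp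
    also have "\<dots> = (\<Prod>C\<in>orbit \<sigma> ` S. ?t ?e C)" by (rule insert.IH[OF \<sigma>])
    also have "\<dots> = ?t ?e ?O * (\<Prod>C\<in>orbit \<sigma> ` S - {?O}. ?t ?e C)"
      using insert.hyps(1) sS by (intro prod.remove) auto
    also have "\<dots> = ?t e (?O \<union> {m}) * (\<Prod>C\<in>orbit \<sigma> ` S - {?O}. ?t e C)"
      unfolding sumO using sum_other by (intro arg_cong2[where f = "(*)"] refl prod.cong) (simp only:)
    also have "\<dots> = (\<Prod>C\<in>orbit \<tau> ` insert m S. ?t e C)"
      unfolding orbs using notin insert.hyps(1) by (subst prod.insert) auto
    finally show ?thesis .
  qed
qed

lemma index_sum_const:
  fixes B :: "complex^'n^'n"
  assumes "finite S" "\<sigma> permutes S"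
  shows "index_sum S (\<lambda>_. B) \<sigma> = orbit_weight (\<lambda>k. trace (matrix_power B k)) S \<sigma>"
proof -
  have "matrix_power B 1 = B" by (simp add: matrix_power_Suc)
  then show ?thesis
    using index_sum_matrix_power[OF assms, of B "\<lambda>_. 1"] by (simp add: orbit_weight_def)
qed

section \<open>Absolutely convergent sums over configurations\<close>

lemma sum_lists_length_le:
  fixes y :: real
  assumes "finite S"
  shows "(\<Sum>u | set u \<subseteq> S \<and> length u \<le> n. y ^ length u) = (\<Sum>i\<le>n. (real (card S) * y) ^ i)"
proof (induction n)
  case 0
  have "{u. set u \<subseteq> S \<and> length u \<le> 0} = {[]}" by auto
  then show ?case by simp
next
  case (Suc n)
  have "{u. set u \<subseteq> S \<and> length u \<le> Suc n} =
      {u. set u \<subseteq> S \<and> length u \<le> n} \<union> {u. set u \<subseteq> S \<and> length u = Suc n}" by auto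
  moreover have "(\<Sum>u | set u \<subseteq> S \<and> length u = Suc n. y ^ length u) = (real (card S) * y) ^ Suc n"
    using assms by (simp add: card_lists_length_eq power_mult_distrib)
  ultimately show ?case
    using Suc assms by (subst \<open>_ = _ \<union> _\<close>, subst sum.union_disjoint)
      (auto simp: finite_lists_length_le finite_lists_length_eq)
qed

lemma summable_on_lists_power:
  fixes y :: real
  assumes "finite S" "0 \<le> y" "real (card S) * y < 1"
  shows "(\<lambda>u. y ^ length u) summable_on lists S"
proof (rule nonneg_bdd_above_summable_on)
  let ?q = "real (card S) * y"
  show "bdd_above (sum (\<lambda>u. y ^ length u) ` {F. F \<subseteq> lists S \<and> finite F})"
  proof (rule bdd_aboveI2)
    fix F assume "F \<in> {F. F \<subseteq> lists S \<and> finite F}"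
    then have F: "F \<subseteq> lists S" "finite F" by auto
    define n where "n = Max (insert 0 (length ` F))"
    have "length u \<le> n" if "u \<in> F" for u
      unfolding n_def using F that by (intro Max_ge) auto
    then have "(\<Sum>u\<in>F. y ^ length u) \<le> (\<Sum>u | set u \<subseteq> S \<and> length u \<le> n. y ^ length u)"
      using F assms by (intro sum_mono2) (auto simp: finite_lists_length_le)
    also have "\<dots> = (\<Sum>i\<le>n. ?q ^ i)" by (rule sum_lists_length_le[OF assms(1)])
    also have "\<dots> \<le> (\<Sum>i. ?q ^ i)"
      using assms by (intro sum_le_suminf summable_geometric) auto
    finally show "(\<Sum>u\<in>F. y ^ length u) \<le> (\<Sum>i. ?q ^ i)" .
  qed
qed (use assms in auto)

text \<open>As \<open>m\<close> exceeds all of \<open>S\<close>, the pairs ending in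
  \<open>m\<close> form the tail of the list, and their first entries are an unrestricted word over
  \<open>S\<close>.\<close>

lemma bij_betw_monotone_pairs_insert:
  assumes "\<forall>s\<in>S. s < m"
  shows "bij_betw (\<lambda>(ps, u). ps @ map (\<lambda>s. (s, m)) u) (monotone_pairs S \<times> lists S) (monotone_pairs (insert m S))"
proof (rule bij_betw_byWitness[where
      f' = "\<lambda>ps. (filter (\<lambda>p. snd p \<noteq> m) ps, map fst (filter (\<lambda>p. snd p = m) ps))"])
  have ne: "filter (\<lambda>p. snd p \<noteq> m) ps = ps" "filter (\<lambda>p. snd p = m) ps = []" if "ps \<in> monotone_pairs S" for ps
    using that assms by (auto simp: monotone_pairs_def filter_id_conv filter_empty_conv)
  show "\<forall>a\<in>monotone_pairs S \<times> lists S.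
      (filter (\<lambda>p. snd p \<noteq> m) (case a of (ps, u) \<Rightarrow> ps @ map (\<lambda>s. (s, m)) u),
        map fst (filter (\<lambda>p. snd p = m) (case a of (ps, u) \<Rightarrow> ps @ map (\<lambda>s. (s, m)) u))) = a"
    using ne by (auto simp: filter_map comp_def)
  show "(\<lambda>(ps, u). ps @ map (\<lambda>s. (s, m)) u) ` (monotone_pairs S \<times> lists S) \<subseteq> monotone_pairs (insert m S)"
  proof (intro image_subsetI)
    fix z assume z: "z \<in> monotone_pairs S \<times> lists S"
    obtain ps u where zz: "z = (ps, u)" by force
    have ps: "ps \<in> monotone_pairs S" and u: "set u \<subseteq> S" using z by (auto simp: zz)
    have "map snd (map (\<lambda>s. (s, m)) u) = replicate (length u) m"
      by (simp add: comp_def map_replicate_const)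
    moreover have "\<forall>p\<in>set ps. snd p \<le> m"
      using ps assms by (fastforce simp: monotone_pairs_def dest: less_imp_le)
    ultimately have "sorted (map snd (ps @ map (\<lambda>s. (s, m)) u))"
      using ps by (simp only: map_append sorted_append) (auto simp: monotone_pairs_def)
    then show "(case z of (ps, u) \<Rightarrow> ps @ map (\<lambda>s. (s, m)) u) \<in> monotone_pairs (insert m S)"
      using ps u assms by (auto simp: monotone_pairs_def zz)
  qed
  show "(\<lambda>ps. (filter (\<lambda>p. snd p \<noteq> m) ps, map fst (filter (\<lambda>p. snd p = m) ps))) ` monotone_pairs (insert m S)
      \<subseteq> monotone_pairs S \<times> lists S"
  proof (intro image_subsetI)
    fix ps assume "ps \<in> monotone_pairs (insert m S)"
    then have ps: "sorted (map snd ps)" "\<And>p. p \<in> set ps \<Longrightarrow> fst p \<in> insert m S \<and> snd p \<in> insert m S \<and> fst p < snd p"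
      by (auto simp: monotone_pairs_def)
    have "fst p \<in> S" if "p \<in> set ps" for p
      using ps(2)[OF that] assms by (auto dest: order.strict_trans)
    then show "(filter (\<lambda>p. snd p \<noteq> m) ps, map fst (filter (\<lambda>p. snd p = m) ps)) \<in> monotone_pairs S \<times> lists S"
      using ps by (fastforce simp: monotone_pairs_def sorted_filter)
  qed
  show "\<forall>ps\<in>monotone_pairs (insert m S).
      (case (filter (\<lambda>p. snd p \<noteq> m) ps, map fst (filter (\<lambda>p. snd p = m) ps)) of
        (ps, u) \<Rightarrow> ps @ map (\<lambda>s. (s, m)) u) = ps"
  proof
    fix ps assume ps: "ps \<in> monotone_pairs (insert m S)"
    have "map (\<lambda>s. (s, m)) (map fst (filter (\<lambda>p. snd p = m) ps)) = filter (\<lambda>p. snd p = m) ps"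
      by (auto simp: comp_def intro!: map_idI)
    moreover have "filter (\<lambda>p. snd p \<noteq> m) ps @ filter (\<lambda>p. snd p = m) ps = ps"
    proof -
      have "sorted (map snd ps)" "\<forall>p\<in>set ps. snd p \<le> m"
        using ps assms by (fastforce simp: monotone_pairs_def dest: less_imp_le)+
      then show ?thesis
      proof (induction ps)
        case (Cons p ps)
        show ?case
        proof (cases "snd p = m")
          case True
          then have "\<forall>q\<in>set ps. snd q = m" using Cons.prems by (force intro: order.antisym)
          then have "filter (\<lambda>p. snd p \<noteq> m) ps = []" "filter (\<lambda>p. snd p = m) ps = ps"
            by (auto simp: filter_empty_conv filter_id_conv)
          then show ?thesis using True by simp
        qed (use Cons in auto)
      qed simp
    qed
    ultimately show "(case (filter (\<lambda>p. snd p \<noteq> m) ps, map fst (filter (\<lambda>p. snd p = m) ps)) of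
        (ps, u) \<Rightarrow> ps @ map (\<lambda>s. (s, m)) u) = ps" by (simp only: prod.case)
  qed
qed

text \<open>Convergence persists at the boundary value 1. The word belonging to the largest element
  \<open>m\<close> uses only the letters below it, so its geometric ratio involves one element fewer
  and is strictly below 1.\<close>

lemma summable_on_monotone_pairs:
  fixes y :: real
  assumes "finite S" "0 \<le> y" "real (card S) * y \<le> 1"
  shows "(\<lambda>ps. y ^ length ps) summable_on monotone_pairs S"
  using assms(1,3)
proof (induction S rule: finite_linorder_max_induct)
  case empty
  have "monotone_pairs {} = {[]}" by (auto simp: monotone_pairs_def) (metis neq_Nil_conv list.set_intros(1) surj_pair)
  then show ?case by simp
next
  case (insert m S)
  have m: "m \<notin> S" using insert.hyps by auto
  have card: "real (card (insert m S)) * y = real (card S) * y + y"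
    using insert.hyps m by (simp add: algebra_simps)
  have IH: "(\<lambda>ps. y ^ length ps) summable_on monotone_pairs S"
    by (rule insert.IH) (use insert.prems card assms(2) in linarith)
  have "real (card S) * y < 1"
    using insert.prems card assms(2) by (cases "y = 0") auto
  then have L: "(\<lambda>u. y ^ length u) summable_on lists S"
    by (rule summable_on_lists_power[OF insert.hyps(1) assms(2)])
  have "(\<lambda>(ps, u). y ^ length ps * y ^ length u) summable_on monotone_pairs S \<times> lists S"
    using IH L assms(2)
    by (intro summable_on_SigmaI[where g = "\<lambda>ps. y ^ length ps * (\<Sum>\<^sub>\<infinity>u\<in>lists S. y ^ length u)"])
      (auto intro!: has_sum_cmult_right summable_on_cmult_left)
  also have "(\<lambda>(ps, u). y ^ length ps * y ^ length u) =
      (\<lambda>z. y ^ length ((\<lambda>(ps, u). ps @ map (\<lambda>s. (s, m)) u) z))"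
    by (auto simp: power_add fun_eq_iff)
  finally show ?case
    using summable_on_reindex_bij_betw[OF bij_betw_monotone_pairs_insert[of S m], of "\<lambda>ps. y ^ length ps"]
      insert.hyps(2) by blast
qed

lemma abs_summable_on_configs:
  fixes f :: "config \<Rightarrow> 'a::banach"
  assumes "finite S" "0 \<le> y" "real (card S) * y \<le> 1"
    and bound: "\<And>c. c \<in> configs S \<Longrightarrow> norm (f c) \<le> K * y ^ length (snd c)"
  shows "f abs_summable_on configs S"
proof (rule Infinite_Sum.abs_summable_on_comparison_test')
  show "(\<lambda>c. K * y ^ length (snd c)) summable_on configs S"
  proof (rule summable_on_cmult_right)
    have "(\<lambda>(\<sigma>::nat \<Rightarrow> nat, ps). y ^ length ps) summable_on {\<sigma>. \<sigma> permutes S} \<times> monotone_pairs S"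
      using summable_on_monotone_pairs[OF assms(1-3)] assms
      by (intro summable_on_SigmaI[where g = "\<lambda>_. \<Sum>\<^sub>\<infinity>ps\<in>monotone_pairs S. y ^ length ps"])
        (auto simp: finite_permutations)
    then show "(\<lambda>c. y ^ length (snd c)) summable_on configs S"
      by (simp only: configs_def case_prod_unfold)
  qed
qed (use bound in auto)

lemma abs_summable_on_config_weight:
  fixes x :: complex
  assumes "finite S" "real (card S) * norm x \<le> 1"
  shows "config_weight x h k S abs_summable_on configs S"
proof (rule abs_summable_on_configs)
  let ?P = "{\<sigma>. \<sigma> permutes S}"
  \<comment> \<open>Only finitely many permutations occur, so the orbit weights are bounded by their
    sums over all of them, and only the length of the list matters.\<close>
  let ?K = "(\<Sum>\<sigma>\<in>?P. norm (orbit_weight h S \<sigma>)) * (\<Sum>\<sigma>\<in>?P. norm (orbit_weight k S \<sigma>))"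
  fix c assume "c \<in> configs S"
  then have \<sigma>: "fst c permutes S" and ps: "snd c \<in> monotone_pairs S" by (auto simp: configs_def)
  have "iprod (snd c) \<circ> fst c \<in> ?P"
    using permutes_compose[OF \<sigma> iprod_permutes_monotone_pairs[OF ps]] by (simp only: mem_Collect_eq)
  then have "norm (orbit_weight h S (iprod (snd c) \<circ> fst c)) \<le> (\<Sum>\<sigma>\<in>?P. norm (orbit_weight h S \<sigma>))"
    by (rule member_le_sum) (use assms finite_permutations in auto)
  moreover have "norm (orbit_weight k S (fst c)) \<le> (\<Sum>\<sigma>\<in>?P. norm (orbit_weight k S \<sigma>))"
    by (rule member_le_sum[where i = "fst c"]) (use assms \<sigma> finite_permutations in auto)
  ultimately have "norm (orbit_weight h S (iprod (snd c) \<circ> fst c)) * norm (orbit_weight k S (fst c)) \<le> ?K"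
    by (rule mult_mono) (auto intro: sum_nonneg)
  then have "norm (orbit_weight h S (iprod (snd c) \<circ> fst c)) * norm (orbit_weight k S (fst c)) *
      norm x ^ length (snd c) \<le> ?K * norm x ^ length (snd c)"
    by (rule mult_right_mono) auto
  then show "norm (config_weight x h k S c) \<le> ?K * norm x ^ length (snd c)"
    by (simp only: config_weight_def norm_mult norm_power mult_ac)
qed (use assms in auto)

section \<open>Entrywise series over configurations\<close>

text \<open>The truth value is the entry, in row \<open>a\<close> and column \<open>b\<close>, of
  the operator that permutes the tensor factors; the index sum is its coefficient.\<close>

definition config_index_sum ::
  "complex \<Rightarrow> nat set \<Rightarrow> (nat \<Rightarrow> complex^'n^'n) \<Rightarrow> (nat \<Rightarrow> 'n) \<Rightarrow> (nat \<Rightarrow> 'n) \<Rightarrow> config \<Rightarrow> complex" where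
  "config_index_sum x S M a b c =
    x ^ length (snd c) * index_sum S M (fst c) * of_bool (\<forall>k\<in>S. b k = a (iprod (snd c) (fst c k)))"

text \<open>At \<open>x\<close> = -1/N this is the entry of the Haar average multiplied by N^(card
  S), as shown in \<open>haar_moment_eq_index_series\<close>.\<close>

definition index_series ::
  "complex \<Rightarrow> nat set \<Rightarrow> (nat \<Rightarrow> complex^'n^'n) \<Rightarrow> (nat \<Rightarrow> 'n) \<Rightarrow> (nat \<Rightarrow> 'n) \<Rightarrow> complex" where
  "index_series x S M a b = (\<Sum>\<^sub>\<infinity>c\<in>configs S. config_index_sum x S M a b c)"

lemma norm_config_index_sum_le:
  assumes "finite S" "c \<in> configs S"
  shows "norm (config_index_sum x S M a b c) \<le>
    (\<Sum>\<sigma> | \<sigma> permutes S. norm (index_sum S M \<sigma>)) * norm x ^ length (snd c)"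
proof -
  have \<sigma>: "fst c permutes S" using assms(2) by (auto simp: configs_def)
  have "norm (config_index_sum x S M a b c) \<le> norm (index_sum S M (fst c)) * norm x ^ length (snd c)"
    by (simp add: config_index_sum_def norm_mult norm_power)
  also have "norm (index_sum S M (fst c)) \<le> (\<Sum>\<sigma> | \<sigma> permutes S. norm (index_sum S M \<sigma>))"
    by (rule member_le_sum[where i = "fst c"]) (use assms \<sigma> finite_permutations in auto)
  finally show ?thesis by (simp add: mult_right_mono)
qed

lemma abs_summable_on_config_index_sum:
  assumes "finite S" "real (card S) * norm x \<le> 1"
  shows "config_index_sum x S M a b abs_summable_on configs S"
  by (rule abs_summable_on_configs[OF assms(1) _ assms(2) norm_config_index_sum_le[OF assms(1)]]) auto

lemma index_series_bounded:
  assumes "finite S" "real (card S) * norm x \<le> 1"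
  shows "\<exists>K. \<forall>a b. norm (index_series x S M a b) \<le> K"
proof (intro exI allI)
  let ?K = "\<Sum>\<sigma> | \<sigma> permutes S. norm (index_sum S M \<sigma>)"
  fix a b
  have s: "(\<lambda>c. ?K * norm x ^ length (snd c)) abs_summable_on configs S"
    by (rule abs_summable_on_configs[OF assms(1) _ assms(2), of _ ?K]) (auto simp: abs_mult sum_nonneg)
  have "norm (index_series x S M a b) \<le> (\<Sum>\<^sub>\<infinity>c\<in>configs S. norm (config_index_sum x S M a b c))"
    unfolding index_series_def
    by (rule norm_infsum_bound) (rule abs_summable_on_config_index_sum[OF assms])
  also have "\<dots> \<le> (\<Sum>\<^sub>\<infinity>c\<in>configs S. ?K * norm x ^ length (snd c))"
    by (intro infsum_mono abs_summable_on_config_index_sum assms norm_config_index_sum_le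
        abs_summable_summable[OF s])
  finally show "norm (index_series x S M a b) \<le> (\<Sum>\<^sub>\<infinity>c\<in>configs S. ?K * norm x ^ length (snd c))" .
qed

lemma infsum_times_finite:
  fixes f :: "'i \<times> 'j \<Rightarrow> 'b::banach"
  assumes "finite I" and "\<And>i. i \<in> I \<Longrightarrow> (\<lambda>c. f (i, c)) abs_summable_on C"
  shows "f abs_summable_on I \<times> C" "infsum f (I \<times> C) = (\<Sum>i\<in>I. \<Sum>\<^sub>\<infinity>c\<in>C. f (i, c))"
proof -
  show s: "f abs_summable_on I \<times> C"
    unfolding Infinite_Sum.abs_summable_on_Sigma_iff using assms by auto
  show "infsum f (I \<times> C) = (\<Sum>i\<in>I. \<Sum>\<^sub>\<infinity>c\<in>C. f (i, c))"
    using infsum_Sigma'_banach[of "\<lambda>i c. f (i, c)" I "\<lambda>_. C"] abs_summable_summable[OF s] assms(1)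
    by simp
qed

text \<open>If no pair ends in the largest label \<open>m\<close>, only the permutation involves
  \<open>m\<close>, and it is split off as a swap. Otherwise the last pair ends in \<open>m\<close>
  and is removed, which leaves a configuration on the same ground set.\<close>

lemma infsum_configs_insert:
  fixes f :: "config \<Rightarrow> 'a::banach"
  assumes fin: "finite S" and lt: "\<forall>s\<in>S. s < m" and f: "f abs_summable_on configs (insert m S)"
  shows "infsum f (configs (insert m S)) =
    (\<Sum>s\<in>insert m S. \<Sum>\<^sub>\<infinity>c\<in>configs S. f (fst c \<circ> swp s m, snd c)) +
    (\<Sum>s\<in>S. \<Sum>\<^sub>\<infinity>c\<in>configs (insert m S). f (fst c, snd c @ [(s, m)]))"
proof -
  let ?S = "insert m S"
  have m: "m \<notin> S" using lt by auto
  let ?g0 = "\<lambda>(s, c). (fst c \<circ> swp s m, snd c)"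
  let ?g1 = "\<lambda>(s, c). (fst c, snd c @ [(s, m)])"
  let ?A0 = "?g0 ` (?S \<times> configs S)"
  let ?A1 = "?g1 ` (S \<times> configs ?S)"
  have A0: "?A0 = {\<sigma>. \<sigma> permutes ?S} \<times> monotone_pairs S"
  proof -
    have surj: "(\<lambda>(s, \<sigma>). \<sigma> \<circ> swp s m) ` (?S \<times> {\<sigma>. \<sigma> permutes S}) = {\<sigma>. \<sigma> permutes ?S}"
      by (rule bij_betw_imp_surj_on[OF bij_betw_permutes_insert[OF m]])
    show ?thesis
    proof (intro equalityI subsetI)
      fix z assume "z \<in> ?A0"
      then obtain w where w: "w \<in> ?S \<times> configs S" "z = ?g0 w" by (rule imageE)
      have "(case (fst w, fst (snd w)) of (s, \<sigma>) \<Rightarrow> \<sigma> \<circ> swp s m) \<in> {\<sigma>. \<sigma> permutes ?S}"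
        unfolding surj[symmetric] using w(1) by (intro imageI) (auto simp: configs_def)
      then show "z \<in> {\<sigma>. \<sigma> permutes ?S} \<times> monotone_pairs S"
        using w(1) unfolding w(2) case_prod_beta by (auto simp: configs_def)
    next
      fix z assume z: "z \<in> {\<sigma>. \<sigma> permutes ?S} \<times> monotone_pairs S"
      then have "fst z \<in> (\<lambda>(s, \<sigma>). \<sigma> \<circ> swp s m) ` (?S \<times> {\<sigma>. \<sigma> permutes S})"
        unfolding surj by auto
      then obtain w where w: "w \<in> ?S \<times> {\<sigma>. \<sigma> permutes S}" "fst z = (case w of (s, \<sigma>) \<Rightarrow> \<sigma> \<circ> swp s m)"
        by (rule imageE)
      have "z = ?g0 (fst w, snd w, snd z)"
        using w(2) by (simp only: case_prod_beta fst_conv snd_conv prod.case) (metis prod.collapse)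
      moreover have "(fst w, snd w, snd z) \<in> ?S \<times> configs S"
        using w(1) z by (auto simp: configs_def)
      ultimately show "z \<in> ?A0" by (rule image_eqI)
    qed
  qed
  have inj0: "inj_on ?g0 (?S \<times> configs S)"
  proof (rule inj_onI)
    fix z z' assume z: "z \<in> ?S \<times> configs S" "z' \<in> ?S \<times> configs S" and eq: "?g0 z = ?g0 z'"
    have "(fst z, fst (snd z)) = (fst z', fst (snd z'))"
      by (rule inj_onD[OF bij_betw_imp_inj_on[OF bij_betw_permutes_insert[OF m]]])
        (use z eq in \<open>auto simp: case_prod_beta configs_def\<close>)
    then show "z = z'" using eq by (auto simp: case_prod_beta prod_eq_iff)
  qed
  have inj1: "inj_on ?g1 (S \<times> configs ?S)"
    by (rule inj_onI) (auto simp: prod_eq_iff)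
  \<comment> \<open>By monotonicity a pair ending in \<open>m\<close> is followed only by pairs
    ending in \<open>m\<close>; so either none occurs or the last pair is one.\<close>
  have split_mono: "monotone_pairs ?S = monotone_pairs S \<union> (\<lambda>(s, ps). ps @ [(s, m)]) ` (S \<times> monotone_pairs ?S)"
  proof (intro equalityI subsetI)
    fix ps assume ps: "ps \<in> monotone_pairs ?S"
    show "ps \<in> monotone_pairs S \<union> (\<lambda>(s, ps). ps @ [(s, m)]) ` (S \<times> monotone_pairs ?S)"
    proof (cases ps rule: rev_cases)
      case (snoc qs p)
      obtain s t where p: "p = (s, t)" by force
      have qs: "qs \<in> monotone_pairs ?S" and st: "s \<in> ?S" "t \<in> ?S" "s < t"
        and le: "\<forall>q\<in>set qs. snd q \<le> t"
        using ps by (auto simp: snoc p monotone_pairs_def sorted_append)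
      show ?thesis
      proof (cases "t = m")
        case True
        then show ?thesis using qs st by (auto simp: snoc p)
      next
        case False
        then have tS: "t \<in> S" "t < m" using st lt by auto
        have "\<forall>q\<in>set ps. snd q < m" "\<forall>q\<in>set ps. fst q < m"
          using le tS st ps by (fastforce simp: snoc p monotone_pairs_def)+
        then have "ps \<in> monotone_pairs S" using ps by (fastforce simp: monotone_pairs_def)
        then show ?thesis by simp
      qed
    qed simp
  next
    fix ps assume "ps \<in> monotone_pairs S \<union> (\<lambda>(s, ps). ps @ [(s, m)]) ` (S \<times> monotone_pairs ?S)"
    then consider "ps \<in> monotone_pairs S" | s qs where "s \<in> S" "qs \<in> monotone_pairs ?S" "ps = qs @ [(s, m)]"
      by auto
    then show "ps \<in> monotone_pairs ?S"
    proof cases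
      case 1
      then show ?thesis by (fastforce simp: monotone_pairs_def)
    next
      case 2
      have "\<forall>p\<in>set qs. snd p \<le> m"
        using 2(2) lt by (fastforce simp: monotone_pairs_def dest: less_imp_le)
      then show ?thesis using 2 lt by (auto simp: monotone_pairs_def sorted_append)
    qed
  qed
  have "?A1 = {\<sigma>. \<sigma> permutes ?S} \<times> (\<lambda>(s, ps). ps @ [(s, m)]) ` (S \<times> monotone_pairs ?S)"
    unfolding configs_def by (auto simp: image_iff Bex_def)
  then have un: "configs ?S = ?A0 \<union> ?A1"
    unfolding A0 using split_mono by (auto simp: configs_def)
  have disj: "?A0 \<inter> ?A1 = {}"
    unfolding A0 using m by (auto simp: monotone_pairs_def)
  have s0: "f abs_summable_on ?A0" and s1: "f abs_summable_on ?A1"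
    using f un by (auto intro: summable_on_subset_banach)
  have "infsum f (configs ?S) = infsum f ?A0 + infsum f ?A1"
    by (subst un) (rule infsum_Un_disjoint[OF abs_summable_summable[OF s0] abs_summable_summable[OF s1] disj])
  also have "infsum f ?A0 = infsum (f \<circ> ?g0) (?S \<times> configs S)"
    by (rule infsum_reindex[OF inj0])
  also have "\<dots> = (\<Sum>s\<in>?S. \<Sum>\<^sub>\<infinity>c\<in>configs S. (f \<circ> ?g0) (s, c))"
  proof (rule infsum_times_finite(2))
    have "(\<lambda>z. norm (f (?g0 z))) summable_on ?S \<times> configs S"
      using s0 summable_on_reindex[OF inj0, of "\<lambda>c. norm (f c)"] by (simp add: comp_def)
    then have "(f \<circ> ?g0) abs_summable_on Sigma ?S (\<lambda>_. configs S)" by (simp add: comp_def)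
    then show "(\<lambda>c. (f \<circ> ?g0) (s, c)) abs_summable_on configs S" if "s \<in> ?S" for s
      unfolding Infinite_Sum.abs_summable_on_Sigma_iff using that by blast
  qed (use fin in simp)
  also have "infsum f ?A1 = infsum (f \<circ> ?g1) (S \<times> configs ?S)"
    by (rule infsum_reindex[OF inj1])
  also have "\<dots> = (\<Sum>s\<in>S. \<Sum>\<^sub>\<infinity>c\<in>configs ?S. (f \<circ> ?g1) (s, c))"
  proof (rule infsum_times_finite(2))
    have "(\<lambda>z. norm (f (?g1 z))) summable_on S \<times> configs ?S"
      using s1 summable_on_reindex[OF inj1, of "\<lambda>c. norm (f c)"] by (simp add: comp_def)
    then have "(f \<circ> ?g1) abs_summable_on Sigma S (\<lambda>_. configs ?S)" by (simp add: comp_def)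
    then show "(\<lambda>c. (f \<circ> ?g1) (s, c)) abs_summable_on configs ?S" if "s \<in> S" for s
      unfolding Infinite_Sum.abs_summable_on_Sigma_iff using that by blast
  qed (use fin in simp)
  finally show ?thesis by (simp add: comp_def)
qed

text \<open>The counterpart of the Schwinger-Dyson equation: \<open>m\<close> is a fixed point, or
  is spliced into a cycle after \<open>s\<close>, or is an end of the last transposition.\<close>

lemma index_series_insert:
  assumes fin: "finite S" and lt: "\<forall>s\<in>S. s < m" and x: "real (card (insert m S)) * norm x \<le> 1"
  shows "index_series x (insert m S) M a b =
    (if a m = b m then trace (M m) * index_series x S M a b else 0) +
    (\<Sum>s\<in>S. if b s = a m then index_series x S (M(s := M s ** M m)) a (b(s := b m)) else 0) +
    x * (\<Sum>s\<in>S. index_series x (insert m S) M (a \<circ> swp s m) b)"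
proof -
  let ?S = "insert m S"
  let ?f = "config_index_sum x ?S M a b"
  have m: "m \<notin> S" using lt by auto
  \<comment> \<open>The swap exchanges the conditions at \<open>s\<close> and \<open>m\<close>. At
    \<open>s\<close> it reaches the fixed point \<open>m\<close> of \<open>w\<close> and gives
    \<open>b s = a m\<close>; at \<open>m\<close> it becomes the condition at \<open>s\<close> with
    \<open>b m\<close> in place of \<open>b s\<close>.\<close>
  have perm: "(\<forall>k\<in>?S. b k = a (w (swp s m k))) \<longleftrightarrow> b s = a m \<and> (\<forall>k\<in>S. (b(s := b m)) k = a (w k))"
    if "s \<in> S" "w m = m" for s w
    using that m by (force simp: Transposition.transpose_def)
  have term_fixed: "?f (fst c \<circ> swp m m, snd c) =
      (if a m = b m then trace (M m) * config_index_sum x S M a b c else 0)" if c: "c \<in> configs S" for c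
  proof -
    have \<sigma>: "fst c permutes S" and ps: "snd c \<in> monotone_pairs S" using c by (auto simp: configs_def)
    have m_fixed: "iprod (snd c) (fst c m) = m"
      using permutes_not_in[OF \<sigma> m] permutes_not_in[OF iprod_permutes_monotone_pairs[OF ps] m] by simp
    show ?thesis
      using index_sum_insert_fixed[OF fin m \<sigma>, of M]
      by (auto simp: config_index_sum_def m_fixed)
  qed
  have term_swap: "?f (fst c \<circ> swp s m, snd c) =
      (if b s = a m then config_index_sum x S (M(s := M s ** M m)) a (b(s := b m)) c else 0)"
    if c: "c \<in> configs S" and s: "s \<in> S" for c s
  proof -
    have \<sigma>: "fst c permutes S" and ps: "snd c \<in> monotone_pairs S" using c by (auto simp: configs_def)
    have m_fixed: "iprod (snd c) (fst c m) = m"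
      using permutes_not_in[OF \<sigma> m] permutes_not_in[OF iprod_permutes_monotone_pairs[OF ps] m] by simp
    have "(\<forall>k\<in>?S. b k = a (iprod (snd c) ((fst c \<circ> swp s m) k))) \<longleftrightarrow>
        b s = a m \<and> (\<forall>k\<in>S. (b(s := b m)) k = a (iprod (snd c) (fst c k)))"
      using perm[OF s, of "\<lambda>k. iprod (snd c) (fst c k)", OF m_fixed] by simp
    then show ?thesis
      unfolding config_index_sum_def fst_conv snd_conv index_sum_insert_compose_transpose[OF fin m \<sigma> s]
      by simp
  qed
  have term_snoc: "?f (fst c, snd c @ [(s, m)]) = x * config_index_sum x ?S M (a \<circ> swp s m) b c" for c s
    by (simp add: config_index_sum_def)
  have "index_series x ?S M a b =
      (\<Sum>\<^sub>\<infinity>c\<in>configs S. ?f (fst c \<circ> swp m m, snd c)) +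
      (\<Sum>s\<in>S. \<Sum>\<^sub>\<infinity>c\<in>configs S. ?f (fst c \<circ> swp s m, snd c)) +
      (\<Sum>s\<in>S. \<Sum>\<^sub>\<infinity>c\<in>configs ?S. ?f (fst c, snd c @ [(s, m)]))"
    unfolding index_series_def
    using infsum_configs_insert[OF fin lt, of ?f] fin m x
    by (simp add: abs_summable_on_config_index_sum)
  also have "(\<Sum>\<^sub>\<infinity>c\<in>configs S. ?f (fst c \<circ> swp m m, snd c)) =
      (if a m = b m then trace (M m) * index_series x S M a b else 0)"
  proof -
    have "(\<Sum>\<^sub>\<infinity>c\<in>configs S. ?f (fst c \<circ> swp m m, snd c)) =
        (\<Sum>\<^sub>\<infinity>c\<in>configs S. if a m = b m then trace (M m) * config_index_sum x S M a b c else 0)"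
      by (rule infsum_cong) (rule term_fixed)
    then show ?thesis by (simp only:) (simp add: index_series_def infsum_cmult_right')
  qed
  also have "(\<Sum>s\<in>S. \<Sum>\<^sub>\<infinity>c\<in>configs S. ?f (fst c \<circ> swp s m, snd c)) =
      (\<Sum>s\<in>S. if b s = a m then index_series x S (M(s := M s ** M m)) a (b(s := b m)) else 0)"
  proof (rule sum.cong[OF refl])
    fix s assume s: "s \<in> S"
    show "(\<Sum>\<^sub>\<infinity>c\<in>configs S. ?f (fst c \<circ> swp s m, snd c)) =
        (if b s = a m then index_series x S (M(s := M s ** M m)) a (b(s := b m)) else 0)"
    proof -
      have "(\<Sum>\<^sub>\<infinity>c\<in>configs S. ?f (fst c \<circ> swp s m, snd c)) =
          (\<Sum>\<^sub>\<infinity>c\<in>configs S. if b s = a m then config_index_sum x S (M(s := M s ** M m)) a (b(s := b m)) c else 0)"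
        by (rule infsum_cong) (rule term_swap[OF _ s])
      then show ?thesis by (simp only:) (simp add: index_series_def)
    qed
  qed
  also have "(\<Sum>s\<in>S. \<Sum>\<^sub>\<infinity>c\<in>configs ?S. ?f (fst c, snd c @ [(s, m)])) =
      x * (\<Sum>s\<in>S. index_series x ?S M (a \<circ> swp s m) b)"
    unfolding term_snoc infsum_cmult_right' index_series_def sum_distrib_left ..
  finally show ?thesis .
qed

text \<open>This takes the place of inverting N + J: iterating the equation \<open>n\<close> times
  bounds \<open>Y\<close> by the \<open>n\<close>-th power of a ratio below 1.\<close>

lemma bounded_fixed_point_zero:
  fixes Y :: "(nat \<Rightarrow> 'n) \<Rightarrow> complex"
  assumes "\<And>a. Y a = x * (\<Sum>s\<in>S. Y (a \<circ> swp s m))" and "\<And>a. norm (Y a) \<le> K" and "real (card S) * norm x < 1"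
  shows "Y a = 0"
proof -
  let ?q = "real (card S) * norm x"
  have bound: "norm (Y a) \<le> ?q ^ n * K" for n a
  proof (induction n arbitrary: a)
    case (Suc n)
    have "norm (Y a) = norm x * norm (\<Sum>s\<in>S. Y (a \<circ> swp s m))"
      by (subst assms(1)) (simp add: norm_mult)
    also have "norm (\<Sum>s\<in>S. Y (a \<circ> swp s m)) \<le> real (card S) * (?q ^ n * K)"
      by (rule order.trans[OF norm_sum], rule sum_bounded_above) (rule Suc)
    also have "norm x * (real (card S) * (?q ^ n * K)) = ?q ^ Suc n * K" by simp
    finally show ?case by (simp add: mult_left_mono)
  qed (use assms(2) in simp)
  have "(\<lambda>n. ?q ^ n) \<longlonglongrightarrow> 0"
    by (rule LIMSEQ_realpow_zero[OF mult_nonneg_nonneg assms(3)]) auto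
  then have "(\<lambda>n. ?q ^ n * K) \<longlonglongrightarrow> 0 * K"
    by (intro tendsto_mult tendsto_const)
  then have "norm (Y a) \<le> 0 * K"
    by (rule LIMSEQ_le_const) (use bound[of a] in simp)
  then show ?thesis by simp
qed

section \<open>Haar moments\<close>

lemma conj_transpose_nth [simp]: "conj_transpose A $ i $ j = cnj (A $ j $ i)"
  by (simp add: conj_transpose_def Finite_Cartesian_Product.transpose_def map_matrix_def)

lemma conj_transpose_mult: "conj_transpose (A ** B) = conj_transpose B ** conj_transpose A"
  by (simp add: vec_eq_iff matrix_matrix_mult_def mult.commute)

lemma unitary_group_mult:
  assumes "U \<in> unitary_group" "V \<in> unitary_group"
  shows "U ** V \<in> unitary_group"
proof -
  have "(U ** V) ** conj_transpose (U ** V) = U ** (V ** conj_transpose V) ** conj_transpose U"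
    by (simp add: conj_transpose_mult matrix_mul_assoc)
  moreover have "conj_transpose (U ** V) ** (U ** V) = conj_transpose V ** (conj_transpose U ** U) ** V"
    by (simp add: conj_transpose_mult matrix_mul_assoc)
  ultimately show ?thesis using assms by (simp add: unitary_group_def)
qed

lemma norm_unitary_nth_le:
  assumes "U \<in> unitary_group"
  shows "norm (U $ i $ j) \<le> 1"
proof -
  have "(U ** conj_transpose U) $ i $ i = 1" using assms by (simp add: unitary_group_def mat_def)
  then have "(\<Sum>k\<in>UNIV. U $ i $ k * cnj (U $ i $ k)) = 1" by (simp add: matrix_matrix_mult_def)
  then have "complex_of_real (\<Sum>k\<in>UNIV. (norm (U $ i $ k))\<^sup>2) = 1"
    by (simp only: of_real_sum complex_norm_square)
  then have "(\<Sum>k\<in>UNIV. (norm (U $ i $ k))\<^sup>2) = 1" using of_real_eq_1_iff by blast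
  moreover have "(norm (U $ i $ j))\<^sup>2 \<le> (\<Sum>k\<in>UNIV. (norm (U $ i $ k))\<^sup>2)"
    by (rule member_le_sum) auto
  ultimately show ?thesis by (simp add: power_le_one_iff abs_square_le_1)
qed

text \<open>With the adjoint in place of the inverse, the entries are continuous on all matrices and
  not only on the unitary ones.\<close>

definition uconj :: "complex^'n^'n \<Rightarrow> complex^'n^'n \<Rightarrow> complex^'n^'n" where
  "uconj U B = U ** B ** conj_transpose U"

lemma uconj_nth: "uconj U B $ a $ b = (\<Sum>j\<in>UNIV. \<Sum>i\<in>UNIV. U $ a $ i * B $ i $ j * cnj (U $ b $ j))"
  by (simp add: uconj_def matrix_matrix_mult_def sum_distrib_right)

lemma uconj_mult_left: "uconj (g ** U) B = g ** uconj U B ** conj_transpose g"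
  by (simp add: uconj_def conj_transpose_mult matrix_mul_assoc)

lemma uconj_mult:
  assumes "U \<in> unitary_group"
  shows "uconj U B ** uconj U C = uconj U (B ** C)"
proof -
  have "uconj U B ** uconj U C = U ** B ** (conj_transpose U ** U) ** C ** conj_transpose U"
    by (simp add: uconj_def matrix_mul_assoc)
  moreover have "conj_transpose U ** U = mat 1" using assms by (simp add: unitary_group_def)
  ultimately show ?thesis by (simp only: matrix_mul_rid) (simp add: uconj_def matrix_mul_assoc)
qed

lemma trace_uconj:
  assumes "U \<in> unitary_group"
  shows "trace (uconj U B) = trace B"
proof -
  have "trace (uconj U B) = trace (conj_transpose U ** (U ** B))"
    unfolding uconj_def by (rule trace_mul_sym)
  also have "conj_transpose U ** (U ** B) = B"
    using assms by (simp add: matrix_mul_assoc unitary_group_def)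
  finally show ?thesis .
qed

definition entry_bound :: "complex^'n^'n \<Rightarrow> real" where
  "entry_bound B = (\<Sum>j\<in>UNIV. \<Sum>i\<in>UNIV. norm (B $ i $ j))"

lemma entry_bound_nonneg: "0 \<le> entry_bound B"
  by (simp add: entry_bound_def sum_nonneg)

lemma norm_uconj_nth_le:
  assumes "U \<in> unitary_group"
  shows "norm (uconj U B $ a $ b) \<le> entry_bound B"
  unfolding uconj_nth entry_bound_def
proof (intro sum_norm_le)
  fix i j
  have "norm (U $ a $ i) * norm (B $ i $ j) * norm (U $ b $ j) \<le> 1 * norm (B $ i $ j) * 1"
    by (intro mult_mono norm_unitary_nth_le[OF assms]) auto
  then show "norm (U $ a $ i * B $ i $ j * cnj (U $ b $ j)) \<le> norm (B $ i $ j)"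
    by (simp add: norm_mult)
qed

lemma norm_nth_le_entry_bound: "norm (B $ i $ j) \<le> entry_bound B"
proof -
  have "norm (B $ i $ j) \<le> (\<Sum>i\<in>UNIV. norm (B $ i $ j))" by (rule member_le_sum) auto
  also have "\<dots> \<le> entry_bound B"
    unfolding entry_bound_def by (rule member_le_sum[where i = j]) (auto intro: sum_nonneg)
  finally show ?thesis .
qed

lemma continuous_on_uconj_nth: "continuous_on S (\<lambda>U. uconj U B $ a $ b)"
  unfolding uconj_nth by (intro continuous_intros)

text \<open>For an orthogonal projection \<open>P\<close> and \<open>\<bar>z\<bar> = 1\<close> this is the unitary that acts as \<open>z\<close> on the
  range of \<open>P\<close>; its logarithmic derivatives span all matrices.\<close>

definition proj_rotation :: "complex \<Rightarrow> complex^'n^'n \<Rightarrow> complex^'n^'n" where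
  "proj_rotation z P = (\<chi> a c. (if a = c then 1 else 0) + (z - 1) * P $ a $ c)"

text \<open>For idempotent \<open>P\<close> the rotation is multiplicative in \<open>z\<close>; for
  Hermitian \<open>P\<close> its adjoint is the rotation by the conjugate of
  \<open>z\<close>.\<close>

lemma proj_rotation_unitary:
  assumes P: "P ** P = P" "conj_transpose P = P" and z: "z * cnj z = 1"
  shows "proj_rotation z P \<in> unitary_group"
proof -
  have PP: "(\<Sum>k\<in>UNIV. P $ i $ k * P $ k $ j) = P $ i $ j" for i j
  proof -
    have "(P ** P) $ i $ j = P $ i $ j" by (simp only: P(1))
    then show ?thesis by (simp add: matrix_matrix_mult_def)
  qed
  have mult: "proj_rotation v P ** proj_rotation w P = proj_rotation (v * w) P" for v w
  proof -
    have "(proj_rotation v P ** proj_rotation w P) $ i $ j =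
        (if i = j then 1 else 0) + (w - 1) * P $ i $ j + (v - 1) * P $ i $ j +
        (v - 1) * (w - 1) * (\<Sum>k\<in>UNIV. P $ i $ k * P $ k $ j)" for i j
      by (simp add: proj_rotation_def matrix_matrix_mult_def distrib_left distrib_right sum.distrib
          if_distrib[of "\<lambda>x. x * _"] if_distrib[of "\<lambda>x. _ * x"] sum_distrib_left mult_ac cong: if_cong)
    then show ?thesis
      by (simp add: vec_eq_iff PP proj_rotation_def algebra_simps)
  qed
  have "proj_rotation 1 P = mat 1" by (simp add: vec_eq_iff proj_rotation_def mat_def)
  moreover have "conj_transpose (proj_rotation z P) = proj_rotation (cnj z) P"
  proof -
    have "cnj (P $ j $ i) = P $ i $ j" for i j using P(2) by (metis conj_transpose_nth)
    then show ?thesis by (simp add: vec_eq_iff proj_rotation_def)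
  qed
  ultimately show ?thesis using mult z by (simp add: unitary_group_def mult.commute)
qed

text \<open>The difference quotients have integral 0. By the mean value inequality they are
  dominated by \<open>K\<close>, so the limit may be taken under the integral.\<close>

lemma integral_derivative_eq_zero:
  fixes f :: "real \<Rightarrow> 'a \<Rightarrow> complex"
  assumes M: "finite_measure M"
    and deriv: "\<And>t u. u \<in> space M \<Longrightarrow> ((\<lambda>t. f t u) has_vector_derivative f' t u) (at t)"
    and bound: "\<And>t u. u \<in> space M \<Longrightarrow> norm (f' t u) \<le> K"
    and int: "\<And>t. integrable M (f t)" and meas: "f' 0 \<in> borel_measurable M"
    and const: "\<And>t. (\<integral>u. f t u \<partial>M) = C"
  shows "(\<integral>u. f' 0 u \<partial>M) = 0"
proof -
  define h where "h n = 1 / real (Suc n)" for n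
  define q where "q n u = (f (h n) u - f 0 u) / of_real (h n)" for n u
  have h: "h n > 0" for n by (simp add: h_def)
  have lim: "(\<lambda>n. q n u) \<longlonglongrightarrow> f' 0 u" if u: "u \<in> space M" for u
  proof -
    have "((\<lambda>y. norm (f (0 + y) u - f 0 u - y *\<^sub>R f' 0 u) / norm y) \<longlongrightarrow> 0) (at 0)"
      using deriv[OF u, of 0] unfolding has_vector_derivative_def has_derivative_at by blast
    moreover have "h \<longlonglongrightarrow> 0" unfolding h_def by real_asymp
    then have "filterlim h (at 0) sequentially"
      using h by (auto simp: filterlim_at less_imp_neq[symmetric])
    ultimately have "(\<lambda>n. norm (f (0 + h n) u - f 0 u - h n *\<^sub>R f' 0 u) / norm (h n)) \<longlonglongrightarrow> 0"
      by (rule filterlim_compose)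
    also have "(\<lambda>n. norm (f (0 + h n) u - f 0 u - h n *\<^sub>R f' 0 u) / norm (h n)) = (\<lambda>n. norm (q n u - f' 0 u))"
    proof
      fix n
      have "q n u - f' 0 u = (f (0 + h n) u - f 0 u - h n *\<^sub>R f' 0 u) / of_real (h n)"
        using h[of n] by (simp add: q_def diff_divide_distrib scaleR_conv_of_real)
      then show "norm (f (0 + h n) u - f 0 u - h n *\<^sub>R f' 0 u) / norm (h n) = norm (q n u - f' 0 u)"
        by (simp add: norm_divide)
    qed
    finally show ?thesis using tendsto_norm_zero_iff LIM_zero_iff by blast
  qed
  have q_bound: "norm (q n u) \<le> K" if u: "u \<in> space M" for n u
  proof -
    have "norm (f (h n) u - f 0 u) \<le> K * norm (h n - 0)"
    proof (rule differentiable_bound[where S = UNIV and f' = "\<lambda>t x. x *\<^sub>R f' t u"])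
      show "((\<lambda>t. f t u) has_derivative (\<lambda>x. x *\<^sub>R f' t u)) (at t within UNIV)" for t
        using deriv[OF u, of t] by (simp add: has_vector_derivative_def)
      show "onorm (\<lambda>x. x *\<^sub>R f' t u) \<le> K" for t
        by (rule onorm_le) (use bound[OF u, of t] in \<open>simp add: mult.commute[of "\<bar>_\<bar>"] mult_right_mono\<close>)
    qed auto
    then show ?thesis using h[of n] by (simp add: q_def norm_divide field_simps)
  qed
  have "(\<lambda>n. \<integral>u. q n u \<partial>M) \<longlonglongrightarrow> (\<integral>u. f' 0 u \<partial>M)"
  proof (rule integral_dominated_convergence)
    show "integrable M (\<lambda>_. K)" using M by (rule finite_measure.integrable_const)
    show "q n \<in> borel_measurable M" for n unfolding q_def using int by measurable
  qed (use lim q_bound meas in auto)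
  moreover have "(\<integral>u. q n u \<partial>M) = 0" for n
    unfolding q_def using int const by simp
  ultimately show ?thesis by (simp add: LIMSEQ_const_iff)
qed

section \<open>Invariance of Haar moments and the Schwinger-Dyson equation\<close>

context
  fixes \<kappa> :: "(complex^'n^'n) measure"
  assumes haar: "is_unitary_haar \<kappa>"
begin

lemma space_haar: "space \<kappa> = unitary_group"
proof -
  have "space \<kappa> = space (restrict_space borel (unitary_group :: (complex^'n^'n) set))"
    using haar unfolding is_unitary_haar_def by (intro sets_eq_imp_space_eq) auto
  then show ?thesis by (simp add: space_restrict_space)
qed

lemma finite_measure_haar: "finite_measure \<kappa>"
  by (rule finite_measureI) (use haar in \<open>auto simp: is_unitary_haar_def\<close>)

lemma borel_measurable_haar:
  fixes f :: "complex^'n^'n \<Rightarrow> complex"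
  assumes "continuous_on UNIV f"
  shows "f \<in> borel_measurable \<kappa>"
proof -
  have "f \<in> borel_measurable (restrict_space borel unitary_group)"
    by (intro measurable_restrict_space1 borel_measurable_continuous_onI assms)
  moreover have "sets \<kappa> = sets (restrict_space borel unitary_group)"
    using haar by (simp add: is_unitary_haar_def)
  ultimately show ?thesis by (simp cong: measurable_cong_sets)
qed

lemma integrable_haar:
  fixes f :: "complex^'n^'n \<Rightarrow> complex"
  assumes "continuous_on UNIV f" and "\<And>U. U \<in> unitary_group \<Longrightarrow> norm (f U) \<le> K"
  shows "integrable \<kappa> f"
  by (rule finite_measure.integrable_const_bound[OF finite_measure_haar, of _ K])
    (use assms borel_measurable_haar in \<open>auto simp: space_haar\<close>)

lemma integral_haar_translate:
  fixes f :: "complex^'n^'n \<Rightarrow> complex"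
  assumes f: "continuous_on UNIV f" and g: "g \<in> unitary_group"
  shows "(\<integral>U. f (g ** U) \<partial>\<kappa>) = (\<integral>U. f U \<partial>\<kappa>)"
proof -
  have s: "sets \<kappa> = sets (restrict_space borel unitary_group)"
    using haar by (simp add: is_unitary_haar_def)
  have "(\<lambda>U. g ** U) \<in> measurable (restrict_space borel unitary_group) (restrict_space borel unitary_group)"
  proof (rule measurable_restrict_space2)
    show "(\<lambda>U. g ** U) \<in> space (restrict_space borel unitary_group) \<rightarrow> unitary_group"
      using unitary_group_mult[OF g] by (auto simp: space_restrict_space)
    have "continuous_on UNIV (\<lambda>U. g ** U)"
      unfolding matrix_matrix_mult_def by (intro continuous_intros)
    then show "(\<lambda>U. g ** U) \<in> measurable (restrict_space borel unitary_group) borel"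
      by (intro measurable_restrict_space1 borel_measurable_continuous_onI)
  qed
  then have "(\<lambda>U. g ** U) \<in> measurable \<kappa> \<kappa>" using s by (simp cong: measurable_cong_sets)
  then have "integral\<^sup>L (distr \<kappa> \<kappa> (\<lambda>U. g ** U)) f = (\<integral>U. f (g ** U) \<partial>\<kappa>)"
    by (rule integral_distr) (rule borel_measurable_haar[OF f])
  then show ?thesis using haar g by (simp add: is_unitary_haar_def)
qed

text \<open>An entry of the averaged tensor product. The matrices may differ from factor to factor,
  because contracting two factors multiplies their matrices.\<close>

definition haar_moment :: "nat set \<Rightarrow> (nat \<Rightarrow> complex^'n^'n) \<Rightarrow> (nat \<Rightarrow> 'n) \<Rightarrow> (nat \<Rightarrow> 'n) \<Rightarrow> complex" where
  "haar_moment S M a b = (\<integral>U. (\<Prod>k\<in>S. uconj U (M k) $ a k $ b k) \<partial>\<kappa>)"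

lemma norm_prod_uconj_le:
  "U \<in> unitary_group \<Longrightarrow> norm (\<Prod>k\<in>S. uconj U (M k) $ a k $ b k) \<le> (\<Prod>k\<in>S. entry_bound (M k))"
  unfolding prod_norm[symmetric] by (intro prod_mono conjI norm_ge_zero norm_uconj_nth_le)

lemma continuous_on_prod_uconj: "continuous_on T (\<lambda>U. \<Prod>k\<in>S. uconj U (M k) $ a k $ b k)"
  by (intro continuous_on_prod continuous_on_uconj_nth)

lemma integrable_prod_uconj: "integrable \<kappa> (\<lambda>U. \<Prod>k\<in>S. uconj U (M k) $ a k $ b k)"
  by (rule integrable_haar[OF continuous_on_prod_uconj norm_prod_uconj_le])

text \<open>The derivative at t = 0 of the invariance under the unitaries exp(itP). The left side
  comes from their action on the row indices, the right side from that of the adjoint on the column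
  indices, and the common factor \<open>\<i>\<close> is cancelled.\<close>

lemma projection_moment_invariance:
  fixes P :: "complex^'n^'n"
  assumes fin: "finite S" and P: "P ** P = P" "conj_transpose P = P"
  shows "(\<Sum>s\<in>S. \<Sum>c\<in>UNIV. P $ a s $ c * haar_moment S M (a(s := c)) b) =
    (\<Sum>s\<in>S. \<Sum>c\<in>UNIV. P $ c $ b s * haar_moment S M a (b(s := c)))"
proof -
  define g where "g t = proj_rotation (cis t) P" for t
  \<comment> \<open>Since \<open>P\<close> is a projection, exp(itP) = 1 + (e^(it) - 1) P; these are
    its entries, and \<open>A'\<close> holds their derivatives. Expanding each factor in them
    confines the dependence on t to scalars.\<close>
  define A where "A t x c = (if x = c then 1 else 0) + (cis t - 1) * P $ x $ c" for t x c
  define A' where "A' t x c = (\<i> * cis t) * P $ x $ c" for t x c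
  define \<phi> where "\<phi> t U k = (\<Sum>c\<in>UNIV. \<Sum>e\<in>UNIV. A t (a k) c * uconj U (M k) $ c $ e * cnj (A t (b k) e))" for t U k
  define \<phi>' where "\<phi>' t U k = (\<Sum>c\<in>UNIV. \<Sum>e\<in>UNIV. A' t (a k) c * uconj U (M k) $ c $ e * cnj (A t (b k) e)
      + A t (a k) c * uconj U (M k) $ c $ e * cnj (A' t (b k) e))" for t U k
  define f where "f t U = (\<Prod>k\<in>S. \<phi> t U k)" for t U
  define f' where "f' t U = (\<Sum>s\<in>S. \<phi>' t U s * (\<Prod>k\<in>S - {s}. \<phi> t U k))" for t U
  have g_nth: "g t $ x $ c = A t x c" for t x c by (simp add: g_def proj_rotation_def A_def)
  have g_unit: "g t \<in> unitary_group" for t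
    unfolding g_def by (rule proj_rotation_unitary[OF P]) (simp add: cis_cnj cis_mult)
  have cP: "cnj (P $ x $ y) = P $ y $ x" for x y using P(2) by (metis conj_transpose_nth)
  have \<phi>: "\<phi> t U k = uconj (g t ** U) (M k) $ a k $ b k" for t U k
    unfolding uconj_mult_left \<phi>_def
    by (subst sum.swap) (simp add: matrix_matrix_mult_def sum_distrib_right g_nth)
  have f: "f t U = (\<Prod>k\<in>S. uconj (g t ** U) (M k) $ a k $ b k)" for t U
    by (simp add: f_def \<phi>)
  have dA: "((\<lambda>t. A t x c) has_vector_derivative A' t x c) (at t)" for t x c
  proof -
    have "(cis has_vector_derivative \<i> * cis t) (at t)"
      unfolding has_vector_derivative_def by (rule has_derivative_cis[OF has_derivative_ident])
    then show ?thesis unfolding A_def A'_def by (auto intro!: derivative_eq_intros)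
  qed
  have "((\<lambda>t. \<phi> t U k) has_vector_derivative \<phi>' t U k) (at t)" for t U k
    unfolding \<phi>_def \<phi>'_def
    by (intro has_vector_derivative_sum) (auto intro!: derivative_eq_intros dA has_vector_derivative_cnj)
  then have "((\<lambda>t. f t U) has_derivative (\<lambda>y. \<Sum>s\<in>S. (y *\<^sub>R \<phi>' t U s) * (\<Prod>k\<in>S - {s}. \<phi> t U k))) (at t)" for t U
    unfolding f_def by (intro has_derivative_prod) (auto simp: has_vector_derivative_def)
  then have deriv: "((\<lambda>t. f t U) has_vector_derivative f' t U) (at t)" for t U
    unfolding has_vector_derivative_def f'_def by (simp add: scaleR_sum_right)
  define p where "p = entry_bound P"
  have p: "norm (P $ x $ c) \<le> p" "0 \<le> p" for x c
    unfolding p_def by (auto intro: norm_nth_le_entry_bound entry_bound_nonneg)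
  have nA': "norm (A' t x c) \<le> p" for t x c using p by (simp add: A'_def norm_mult)
  have nA: "norm (A t x c) \<le> 1" for t x c
    using norm_unitary_nth_le[OF g_unit] by (simp add: g_nth[symmetric])
  define K' where "K' k = (\<Sum>c\<in>(UNIV::'n set). \<Sum>e\<in>(UNIV::'n set). p * entry_bound (M k) * 1 + 1 * entry_bound (M k) * p)" for k
  have n\<phi>': "norm (\<phi>' t U k) \<le> K' k" if "U \<in> unitary_group" for t U k
    unfolding \<phi>'_def K'_def
  proof (intro sum_norm_le)
    fix c e
    have "norm (A' t (a k) c * uconj U (M k) $ c $ e * cnj (A t (b k) e)) \<le> p * entry_bound (M k) * 1"
      unfolding norm_mult complex_mod_cnj
      by (intro mult_mono nA nA' norm_uconj_nth_le that mult_nonneg_nonneg norm_ge_zero p entry_bound_nonneg)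
    moreover have "norm (A t (a k) c * uconj U (M k) $ c $ e * cnj (A' t (b k) e)) \<le> 1 * entry_bound (M k) * p"
      unfolding norm_mult complex_mod_cnj
      by (intro mult_mono nA nA' norm_uconj_nth_le that mult_nonneg_nonneg norm_ge_zero p entry_bound_nonneg) auto
    ultimately show "norm (A' t (a k) c * uconj U (M k) $ c $ e * cnj (A t (b k) e)
        + A t (a k) c * uconj U (M k) $ c $ e * cnj (A' t (b k) e)) \<le> p * entry_bound (M k) * 1 + 1 * entry_bound (M k) * p"
      by (rule norm_triangle_mono)
  qed
  have n\<phi>: "norm (\<phi> t U k) \<le> entry_bound (M k)" if "U \<in> unitary_group" for t U k
    unfolding \<phi> by (rule norm_uconj_nth_le[OF unitary_group_mult[OF g_unit that]])
  have bound: "norm (f' t U) \<le> (\<Sum>s\<in>S. K' s * (\<Prod>k\<in>S - {s}. entry_bound (M k)))"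
    if U: "U \<in> unitary_group" for t U
    unfolding f'_def
  proof (rule sum_norm_le)
    fix s
    have "norm (\<Prod>k\<in>S - {s}. \<phi> t U k) \<le> (\<Prod>k\<in>S - {s}. entry_bound (M k))"
      unfolding prod_norm[symmetric] by (intro prod_mono conjI norm_ge_zero n\<phi> U)
    moreover have "0 \<le> K' s" using norm_ge_zero order.trans[OF norm_ge_zero n\<phi>'[OF U]] by blast
    ultimately show "norm (\<phi>' t U s * (\<Prod>k\<in>S - {s}. \<phi> t U k)) \<le> K' s * (\<Prod>k\<in>S - {s}. entry_bound (M k))"
      unfolding norm_mult by (intro mult_mono n\<phi>' U norm_ge_zero)
  qed
  have contf: "continuous_on UNIV (f t)" for t
    unfolding f_def \<phi>_def by (intro continuous_intros continuous_on_uconj_nth)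
  have contf': "continuous_on UNIV (f' t)" for t
    unfolding f'_def \<phi>_def \<phi>'_def by (intro continuous_intros continuous_on_uconj_nth)
  have "(\<integral>U. f' 0 U \<partial>\<kappa>) = 0"
  proof (rule integral_derivative_eq_zero[OF finite_measure_haar, where f = f and C = "haar_moment S M a b"])
    show "integrable \<kappa> (f t)" for t
      by (rule integrable_haar[OF contf, of _ "\<Prod>k\<in>S. entry_bound (M k)"])
        (auto simp: f intro!: norm_prod_uconj_le unitary_group_mult g_unit)
    show "(\<integral>U. f t U \<partial>\<kappa>) = haar_moment S M a b" for t
      unfolding f haar_moment_def by (rule integral_haar_translate[OF continuous_on_prod_uconj g_unit])
  qed (use deriv bound borel_measurable_haar[OF contf'] in \<open>auto simp: space_haar\<close>)
  moreover have "f' 0 U = \<i> * ((\<Sum>s\<in>S. \<Sum>c\<in>UNIV. P $ a s $ c * (\<Prod>k\<in>S. uconj U (M k) $ (a(s := c)) k $ b k)) -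
      (\<Sum>s\<in>S. \<Sum>c\<in>UNIV. P $ c $ b s * (\<Prod>k\<in>S. uconj U (M k) $ a k $ (b(s := c)) k)))" for U
  proof -
    have \<phi>0: "\<phi> 0 U k = uconj U (M k) $ a k $ b k" for k
      by (simp add: \<phi>_def A_def if_distrib[of "\<lambda>x. x * _"] if_distrib[of "\<lambda>x. _ * x"] if_distrib[of cnj] cong: if_cong)
    have \<phi>'0: "\<phi>' 0 U k = \<i> * ((\<Sum>c\<in>UNIV. P $ a k $ c * uconj U (M k) $ c $ b k) -
        (\<Sum>c\<in>UNIV. P $ c $ b k * uconj U (M k) $ a k $ c))" for k
    proof -
      have "(\<Sum>c\<in>UNIV. \<Sum>e\<in>UNIV. A' 0 (a k) c * uconj U (M k) $ c $ e * cnj (A 0 (b k) e)) =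
          \<i> * (\<Sum>c\<in>UNIV. P $ a k $ c * uconj U (M k) $ c $ b k)"
        by (simp add: A_def A'_def if_distrib[of "\<lambda>x. _ * x"] if_distrib[of cnj] cong: if_cong)
          (simp add: sum_distrib_left mult_ac)
      moreover have "(\<Sum>c\<in>UNIV. \<Sum>e\<in>UNIV. A 0 (a k) c * uconj U (M k) $ c $ e * cnj (A' 0 (b k) e)) =
          - \<i> * (\<Sum>c\<in>UNIV. P $ c $ b k * uconj U (M k) $ a k $ c)"
        by (subst sum.swap, simp add: A_def A'_def cP if_distrib[of "\<lambda>x. x * _"] cong: if_cong)
          (simp add: sum_distrib_left sum_negf mult_ac)
      ultimately show ?thesis
        by (simp add: \<phi>'_def sum.distrib right_diff_distrib)
    qed
    have 1: "(\<Prod>k\<in>S. uconj U (M k) $ (a(s := c)) k $ b k) =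
        uconj U (M s) $ c $ b s * (\<Prod>k\<in>S - {s}. uconj U (M k) $ a k $ b k)" if "s \<in> S" for s c
      unfolding prod.remove[OF fin that] by (intro arg_cong2[where f = "(*)"] prod.cong) auto
    have 2: "(\<Prod>k\<in>S. uconj U (M k) $ a k $ (b(s := c)) k) =
        uconj U (M s) $ a s $ c * (\<Prod>k\<in>S - {s}. uconj U (M k) $ a k $ b k)" if "s \<in> S" for s c
      unfolding prod.remove[OF fin that] by (intro arg_cong2[where f = "(*)"] prod.cong) auto
    have "f' 0 U = (\<Sum>s\<in>S. \<i> * ((\<Sum>c\<in>UNIV. P $ a s $ c * (\<Prod>k\<in>S. uconj U (M k) $ (a(s := c)) k $ b k)) -
      (\<Sum>c\<in>UNIV. P $ c $ b s * (\<Prod>k\<in>S. uconj U (M k) $ a k $ (b(s := c)) k))))"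
      unfolding f'_def \<phi>0 \<phi>'0
      by (intro sum.cong refl)
        (simp only: 1 2, simp add: left_diff_distrib right_diff_distrib sum_distrib_left sum_distrib_right mult_ac)
    then show ?thesis by (simp add: sum_distrib_left[symmetric] sum_subtractf)
  qed
  ultimately have "\<i> * ((\<Sum>s\<in>S. \<Sum>c\<in>UNIV. P $ a s $ c * haar_moment S M (a(s := c)) b) -
    (\<Sum>s\<in>S. \<Sum>c\<in>UNIV. P $ c $ b s * haar_moment S M a (b(s := c)))) = 0"
    unfolding haar_moment_def by (simp add: integrable_prod_uconj del: fun_upd_apply)
  then show ?thesis by simp
qed

text \<open>The relation is linear in the matrix \<open>H\<close>, so it extends from orthogonal
  projections to their complex span, which contains every matrix unit by polarization.\<close>

lemma elementary_moment_invariance: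
  assumes fin: "finite S"
  shows "(\<Sum>s\<in>S. if a s = i then haar_moment S M (a(s := j)) b else 0) =
    (\<Sum>s\<in>S. if b s = j then haar_moment S M a (b(s := i)) else 0)"
proof -
  define L where "L H = (\<Sum>s\<in>S. \<Sum>c\<in>UNIV. H $ a s $ c * haar_moment S M (a(s := c)) b) -
    (\<Sum>s\<in>S. \<Sum>c\<in>UNIV. H $ c $ b s * haar_moment S M a (b(s := c)))" for H :: "complex^'n^'n"
  have L_proj: "L P = 0" if "P ** P = P" "conj_transpose P = P" for P
    unfolding L_def using projection_moment_invariance[OF fin that] by simp
  have L_add: "L (H + K) = L H + L K" for H K
    by (simp add: L_def distrib_right sum.distrib)
  have L_smult: "L (\<chi> x y. q * H $ x $ y) = q * L H" for q H
    by (simp add: L_def right_diff_distrib sum_distrib_left mult_ac)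
  define E where "E p q = (\<chi> x y. if x = p \<and> y = q then (1::complex) else 0)" for p q :: 'n
  have EE: "E p q ** E r t = (if q = r then E p t else 0)" for p q r t
  proof -
    have "(\<Sum>k\<in>UNIV. (if x = p \<and> k = q then 1 else 0) * (if k = r \<and> y = t then 1 else (0::complex))) =
        (if q = r \<and> x = p \<and> y = t then 1 else 0)" for x y
    proof -
      have "(\<Sum>k\<in>UNIV. (if x = p \<and> k = q then 1 else 0) * (if k = r \<and> y = t then 1 else (0::complex))) =
          (\<Sum>k\<in>UNIV. if k = q then (if q = r \<and> x = p \<and> y = t then 1 else 0) else 0)"
        by (intro sum.cong refl) auto
      then show ?thesis by simp
    qed
    then show ?thesis by (simp add: E_def vec_eq_iff matrix_matrix_mult_def)
  qed
  have L_diag: "L (E p p) = 0" for p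
    by (rule L_proj) (simp_all add: EE, simp add: E_def vec_eq_iff)
  have "L (E i j) = 0"
  proof (cases "i = j")
    case False
    \<comment> \<open>For w of modulus 1 this is the orthogonal projection onto the line spanned by
      e_i + \<open>cnj w\<close> e_j.\<close>
    define P where "P w = (\<chi> x y. (1 / 2) * (E i i + E j j + (\<chi> x y. w * E i j $ x $ y) + (\<chi> x y. cnj w * E j i $ x $ y)) $ x $ y)" for w
    have P_nth: "P w $ x $ y = (1 / 2) * ((if x = i \<and> y = i then 1 else 0) + (if x = j \<and> y = j then 1 else 0) +
        w * (if x = i \<and> y = j then 1 else 0) + cnj w * (if x = j \<and> y = i then 1 else 0))" for w x y
      by (simp add: P_def E_def)
    have "L (P w) = 0" if w: "w * cnj w = 1" for w
    proof (rule L_proj)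
      show "conj_transpose (P w) = P w" by (simp add: vec_eq_iff P_nth if_distrib[of cnj] conj_commute add.commute add.left_commute cong: if_cong)
      have "(P w ** P w) $ x $ y = P w $ x $ y" for x y
      proof -
        have "(P w ** P w) $ x $ y = (\<Sum>k\<in>UNIV. P w $ x $ k * P w $ k $ y)"
          by (simp add: matrix_matrix_mult_def)
        also have "\<dots> = (\<Sum>k\<in>{i, j}. P w $ x $ k * P w $ k $ y)"
          by (rule sum.mono_neutral_right) (auto simp: P_nth)
        also have "\<dots> = P w $ x $ i * P w $ i $ y + P w $ x $ j * P w $ j $ y"
          using False by simp
        also have "\<dots> = P w $ x $ y"
          using False w w[unfolded mult.commute[of w]]
          by (cases "x = i"; cases "x = j"; cases "y = i"; cases "y = j") (simp_all add: P_nth)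
        finally show ?thesis .
      qed
      then show "P w ** P w = P w" by (simp add: vec_eq_iff)
    qed
    moreover have "L (P w) = (1 / 2) * (w * L (E i j) + cnj w * L (E j i))" for w
      unfolding P_def L_smult L_add L_diag by simp
    ultimately have rel: "w * L (E i j) + cnj w * L (E j i) = 0" if "w * cnj w = 1" for w
      using that by (metis divide_eq_0_iff mult_cancel_right1 mult_eq_0_iff one_neq_zero zero_neq_numeral)
    \<comment> \<open>The value 1 gives the sum of the two unknowns and \<open>\<i>\<close> gives
      their difference, so both vanish.\<close>
    show ?thesis using rel[of 1] rel[of \<i>] by (simp add: algebra_simps)
  qed (simp add: L_diag)
  moreover have "L (E i j) = (\<Sum>s\<in>S. if a s = i then haar_moment S M (a(s := j)) b else 0) -
    (\<Sum>s\<in>S. if b s = j then haar_moment S M a (b(s := i)) else 0)"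
  proof -
    have 1: "(\<Sum>c\<in>UNIV. E i j $ a s $ c * haar_moment S M (a(s := c)) b) =
        (if a s = i then haar_moment S M (a(s := j)) b else 0)" for s
    proof -
      have "(\<Sum>c\<in>UNIV. E i j $ a s $ c * haar_moment S M (a(s := c)) b) =
          (\<Sum>c\<in>UNIV. if c = j then (if a s = i then haar_moment S M (a(s := j)) b else 0) else 0)"
        by (intro sum.cong refl) (simp add: E_def)
      then show ?thesis by simp
    qed
    have 2: "(\<Sum>c\<in>UNIV. E i j $ c $ b s * haar_moment S M a (b(s := c))) =
        (if b s = j then haar_moment S M a (b(s := i)) else 0)" for s
    proof -
      have "(\<Sum>c\<in>UNIV. E i j $ c $ b s * haar_moment S M a (b(s := c))) =
          (\<Sum>c\<in>UNIV. if c = i then (if b s = j then haar_moment S M a (b(s := i)) else 0) else 0)"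
        by (intro sum.cong refl) (simp add: E_def)
      then show ?thesis by simp
    qed
    show ?thesis unfolding L_def 1 2 ..
  qed
  ultimately show ?thesis by simp
qed

text \<open>Contracting the infinitesimal invariance at the index \<open>m\<close> gives the Schwinger-Dyson equation.\<close>

lemma haar_moment_insert:
  assumes fin: "finite S" and m: "m \<notin> S"
  shows "of_nat CARD('n) * haar_moment (insert m S) M a b =
    (if a m = b m then trace (M m) * haar_moment S M a b else 0) +
    (\<Sum>s\<in>S. if b s = a m then haar_moment S (M(s := M s ** M m)) a (b(s := b m)) else 0) -
    (\<Sum>s\<in>S. haar_moment (insert m S) M (a \<circ> swp s m) b)"
proof -
  let ?X = "haar_moment (insert m S) M"
  have fin': "finite (insert m S)" using fin by simp
  have ne: "s \<noteq> m" if "s \<in> S" for s using that m by auto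
  \<comment> \<open>The invariance is applied with \<open>a m\<close> as the new row index and row
    \<open>i\<close> at \<open>m\<close>, then summed over \<open>i\<close>. On the left the term at
    \<open>m\<close> occurs N times and the others become swaps. On the right the term at
    \<open>m\<close> contracts to a trace and the others to products of two matrices.\<close>
  have "(\<Sum>i\<in>UNIV. \<Sum>s\<in>insert m S. if (a(m := i)) s = i then ?X ((a(m := i))(s := a m)) b else 0) =
      (\<Sum>i\<in>UNIV. \<Sum>s\<in>insert m S. if b s = a m then ?X (a(m := i)) (b(s := i)) else 0)"
    by (intro sum.cong refl elementary_moment_invariance[OF fin'])
  also have "(\<Sum>i\<in>UNIV. \<Sum>s\<in>insert m S. if (a(m := i)) s = i then ?X ((a(m := i))(s := a m)) b else 0) =
      of_nat CARD('n) * ?X a b + (\<Sum>s\<in>S. ?X (a \<circ> swp s m) b)"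
  proof -
    have "(\<Sum>i\<in>UNIV. \<Sum>s\<in>S. if (a(m := i)) s = i then ?X ((a(m := i))(s := a m)) b else 0) =
        (\<Sum>s\<in>S. \<Sum>i\<in>UNIV. if a s = i then ?X ((a(m := i))(s := a m)) b else 0)"
      by (subst sum.swap) (intro sum.cong refl, use ne in auto)
    also have "\<dots> = (\<Sum>s\<in>S. ?X (a \<circ> swp s m) b)"
    proof (rule sum.cong[OF refl])
      fix s assume s: "s \<in> S"
      have "(a(m := a s))(s := a m) = a \<circ> swp s m"
        by (auto simp: fun_eq_iff Transposition.transpose_def)
      then show "(\<Sum>i\<in>UNIV. if a s = i then ?X ((a(m := i))(s := a m)) b else 0) = ?X (a \<circ> swp s m) b"
        by simp
    qed
    finally show ?thesis
      unfolding sum.insert[OF fin m] sum.distrib by simp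
  qed
  also have "(\<Sum>i\<in>UNIV. \<Sum>s\<in>insert m S. if b s = a m then ?X (a(m := i)) (b(s := i)) else 0) =
      (if b m = a m then \<Sum>i\<in>UNIV. ?X (a(m := i)) (b(m := i)) else 0) +
      (\<Sum>s\<in>S. if b s = a m then \<Sum>i\<in>UNIV. ?X (a(m := i)) (b(s := i)) else 0)"
  proof -
    have "(\<Sum>i\<in>UNIV. \<Sum>s\<in>S. if b s = a m then ?X (a(m := i)) (b(s := i)) else 0) =
        (\<Sum>s\<in>S. if b s = a m then \<Sum>i\<in>UNIV. ?X (a(m := i)) (b(s := i)) else 0)"
      by (subst sum.swap) (intro sum.cong refl, simp)
    then show ?thesis unfolding sum.insert[OF fin m] sum.distrib by simp
  qed
  also have "(\<Sum>i\<in>UNIV. ?X (a(m := i)) (b(m := i))) = trace (M m) * haar_moment S M a b"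
  proof -
    have "(\<Prod>k\<in>insert m S. uconj U (M k) $ (a(m := i)) k $ (b(m := i)) k) =
        uconj U (M m) $ i $ i * (\<Prod>k\<in>S. uconj U (M k) $ a k $ b k)" for U i
      unfolding prod.insert[OF fin m] using ne by (intro arg_cong2[where f = "(*)"] prod.cong) auto
    then have "(\<Sum>i\<in>UNIV. \<Prod>k\<in>insert m S. uconj U (M k) $ (a(m := i)) k $ (b(m := i)) k) =
        trace (uconj U (M m)) * (\<Prod>k\<in>S. uconj U (M k) $ a k $ b k)" for U
      by (simp add: trace_def sum_distrib_right)
    then have "(\<integral>U. (\<Sum>i\<in>UNIV. \<Prod>k\<in>insert m S. uconj U (M k) $ (a(m := i)) k $ (b(m := i)) k) \<partial>\<kappa>) =
        (\<integral>U. trace (M m) * (\<Prod>k\<in>S. uconj U (M k) $ a k $ b k) \<partial>\<kappa>)"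
      by (intro Bochner_Integration.integral_cong refl) (simp add: space_haar trace_uconj)
    then show ?thesis
      unfolding haar_moment_def using integrable_prod_uconj
      by (subst (asm) Bochner_Integration.integral_sum) auto
  qed
  also have "(\<Sum>s\<in>S. if b s = a m then \<Sum>i\<in>UNIV. ?X (a(m := i)) (b(s := i)) else 0) =
      (\<Sum>s\<in>S. if b s = a m then haar_moment S (M(s := M s ** M m)) a (b(s := b m)) else 0)"
  proof (intro sum.cong refl if_cong)
    fix s assume s: "s \<in> S"
    have p: "(\<Prod>k\<in>insert m S. uconj U (M k) $ (a(m := i)) k $ (b(s := i)) k) =
        uconj U (M s) $ a s $ i * uconj U (M m) $ i $ b m * (\<Prod>k\<in>S - {s}. uconj U (M k) $ a k $ b k)" for U i
    proof -
      have "(\<Prod>k\<in>S. uconj U (M k) $ (a(m := i)) k $ (b(s := i)) k) =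
          uconj U (M s) $ a s $ i * (\<Prod>k\<in>S - {s}. uconj U (M k) $ a k $ b k)"
        unfolding prod.remove[OF fin s] using ne s by (intro arg_cong2[where f = "(*)"] prod.cong) auto
      then show ?thesis unfolding prod.insert[OF fin m] using ne[OF s] by simp
    qed
    have q: "(\<Prod>k\<in>S. uconj U ((M(s := M s ** M m)) k) $ a k $ (b(s := b m)) k) =
        uconj U (M s ** M m) $ a s $ b m * (\<Prod>k\<in>S - {s}. uconj U (M k) $ a k $ b k)" for U
      unfolding prod.remove[OF fin s] by (intro arg_cong2[where f = "(*)"] prod.cong) auto
    have "(\<Sum>i\<in>UNIV. \<Prod>k\<in>insert m S. uconj U (M k) $ (a(m := i)) k $ (b(s := i)) k) =
        (\<Prod>k\<in>S. uconj U ((M(s := M s ** M m)) k) $ a k $ (b(s := b m)) k)" if U: "U \<in> unitary_group" for U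
      unfolding p q uconj_mult[OF U, symmetric] by (simp add: matrix_matrix_mult_def sum_distrib_right)
    then have "(\<integral>U. (\<Sum>i\<in>UNIV. \<Prod>k\<in>insert m S. uconj U (M k) $ (a(m := i)) k $ (b(s := i)) k) \<partial>\<kappa>) =
        (\<integral>U. (\<Prod>k\<in>S. uconj U ((M(s := M s ** M m)) k) $ a k $ (b(s := b m)) k) \<partial>\<kappa>)"
      by (intro Bochner_Integration.integral_cong refl) (simp add: space_haar)
    then show "(\<Sum>i\<in>UNIV. ?X (a(m := i)) (b(s := i))) = haar_moment S (M(s := M s ** M m)) a (b(s := b m))"
      unfolding haar_moment_def using integrable_prod_uconj
      by (subst (asm) Bochner_Integration.integral_sum) auto
  qed
  finally show ?thesis unfolding eq_diff_eq eq_commute[of "a m" "b m"] .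
qed

lemma norm_haar_moment_le: "norm (haar_moment S M a b) \<le> (\<Prod>k\<in>S. entry_bound (M k))"
proof -
  have "norm (haar_moment S M a b) \<le> (\<integral>U. (\<Prod>k\<in>S. entry_bound (M k)) \<partial>\<kappa>)"
    unfolding haar_moment_def
    by (rule Bochner_Integration.integral_norm_bound_integral)
      (use integrable_prod_uconj norm_prod_uconj_le finite_measure.integrable_const[OF finite_measure_haar]
        in \<open>auto simp: space_haar\<close>)
  also have "\<dots> = (\<Prod>k\<in>S. entry_bound (M k))"
    using haar by (simp add: is_unitary_haar_def measure_def)
  finally show ?thesis .
qed

end

section \<open>Weingarten expansion and cumulants\<close>

lemma haar_moment_empty: "is_unitary_haar \<kappa> \<Longrightarrow> haar_moment \<kappa> {} M a b = 1"
  by (simp add: haar_moment_def is_unitary_haar_def measure_def)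

lemma index_series_empty: "index_series x {} M a b = 1"
proof -
  have "configs {} = {(id, [])}"
    by (auto simp: configs_def monotone_pairs_def) (metis neq_Nil_conv list.set_intros(1) surj_pair)
  then show ?thesis by (simp add: index_series_def config_index_sum_def index_sum_def)
qed

text \<open>Multiplied by the power of N, the Schwinger-Dyson equation becomes
  \<open>index_series_insert\<close> at -1/N; the terms on \<open>S\<close> agree by induction. Only
  the swap term remains, and its ratio \<open>card S\<close>/N is below 1 because \<open>m\<close>
  is one more element.\<close>

theorem haar_moment_eq_index_series:
  fixes \<kappa> :: "(complex^'n^'n) measure"
  assumes haar: "is_unitary_haar \<kappa>" and fin: "finite S" and card: "card S \<le> CARD('n)"
  shows "of_nat CARD('n) ^ card S * haar_moment \<kappa> S M a b = index_series (- 1 / of_nat CARD('n)) S M a b"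
  using fin card
proof (induction S arbitrary: M a b rule: finite_linorder_max_induct)
  case empty
  then show ?case by (simp add: haar_moment_empty[OF haar] index_series_empty)
next
  case (insert m S)
  let ?N = "of_nat CARD('n) :: complex"
  let ?x = "- 1 / ?N"
  have m: "m \<notin> S" using insert.hyps by auto
  have N: "?N \<noteq> 0" by simp
  have norm_x: "norm ?x = 1 / real CARD('n)" by (simp add: norm_divide)
  have card_S: "card S < CARD('n)" using insert.prems insert.hyps(1) m by simp
  have le: "real (card (insert m S)) * norm ?x \<le> 1"
    unfolding norm_x using insert.prems by (simp add: divide_le_eq)
  \<comment> \<open>Everything in the recursion that lives on the smaller set cancels in this
    difference, so it solves the homogeneous equation.\<close>
  define Y where "Y a = ?N ^ card (insert m S) * haar_moment \<kappa> (insert m S) M a b -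
      index_series ?x (insert m S) M a b" for a
  have IH: "?N ^ card S * haar_moment \<kappa> S M a b = index_series ?x S M a b" for M a b
    by (rule insert.IH) (use card_S in simp)
  have "Y a = ?x * (\<Sum>s\<in>S. Y (a \<circ> swp s m))" for a
  proof -
    let ?h = "\<lambda>a. ?N ^ card (insert m S) * haar_moment \<kappa> (insert m S) M a b"
    have "?h a = ?N ^ card S * (?N * haar_moment \<kappa> (insert m S) M a b)"
      using insert.hyps(1) m by simp
    also have "\<dots> = (if a m = b m then trace (M m) * (?N ^ card S * haar_moment \<kappa> S M a b) else 0) +
        (\<Sum>s\<in>S. if b s = a m then ?N ^ card S * haar_moment \<kappa> S (M(s := M s ** M m)) a (b(s := b m)) else 0) -
        (\<Sum>s\<in>S. ?N ^ card S * haar_moment \<kappa> (insert m S) M (a \<circ> swp s m) b)"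
      unfolding haar_moment_insert[OF haar insert.hyps(1) m] right_diff_distrib distrib_left sum_distrib_left
      by (intro arg_cong2[where f = "(-)"] arg_cong2[where f = "(+)"] sum.cong refl) auto
    also have "\<dots> = (if a m = b m then trace (M m) * index_series ?x S M a b else 0) +
        (\<Sum>s\<in>S. if b s = a m then index_series ?x S (M(s := M s ** M m)) a (b(s := b m)) else 0) +
        ?x * (\<Sum>s\<in>S. ?h (a \<circ> swp s m))"
      unfolding IH using insert.hyps(1) m
      by (simp add: sum_distrib_left sum_negf[symmetric] comp_def)
    finally show ?thesis
      unfolding Y_def index_series_insert[OF insert.hyps(1,2) le, of M a b] sum_subtractf right_diff_distrib
      by simp
  qed
  moreover obtain K where K: "\<And>a b. norm (index_series ?x (insert m S) M a b) \<le> K"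
    using index_series_bounded[OF _ le, of M] insert.hyps(1) by auto
  have "norm (Y a) \<le> real CARD('n) ^ card (insert m S) * (\<Prod>k\<in>insert m S. entry_bound (M k)) + K" for a
  proof -
    have "norm (Y a) \<le> norm (?N ^ card (insert m S) * haar_moment \<kappa> (insert m S) M a b) +
        norm (index_series ?x (insert m S) M a b)"
      unfolding Y_def by (rule norm_triangle_ineq4)
    also have "norm (?N ^ card (insert m S) * haar_moment \<kappa> (insert m S) M a b) \<le>
        real CARD('n) ^ card (insert m S) * (\<Prod>k\<in>insert m S. entry_bound (M k))"
      unfolding norm_mult norm_power norm_of_nat
      by (intro mult_left_mono norm_haar_moment_le[OF haar]) simp
    finally show ?thesis using K[of a b] by linarith
  qed
  moreover have "real (card S) * norm ?x < 1"
    unfolding norm_x using card_S by (simp add: divide_less_eq)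
  ultimately have "Y a = 0" for a by (rule bounded_fixed_point_zero)
  then show ?case unfolding Y_def by simp
qed

section \<open>Moments of the trace\<close>

lemma sum_infsum_swap:
  fixes f :: "'i \<Rightarrow> 'j \<Rightarrow> 'b::{topological_comm_monoid_add, t2_space}"
  assumes "finite I" "\<And>i. i \<in> I \<Longrightarrow> f i summable_on C"
  shows "(\<Sum>i\<in>I. \<Sum>\<^sub>\<infinity>c\<in>C. f i c) = (\<Sum>\<^sub>\<infinity>c\<in>C. \<Sum>i\<in>I. f i c)" "(\<lambda>c. \<Sum>i\<in>I. f i c) summable_on C"
proof -
  have "(\<Sum>i\<in>I. \<Sum>\<^sub>\<infinity>c\<in>C. f i c) = (\<Sum>\<^sub>\<infinity>c\<in>C. \<Sum>i\<in>I. f i c) \<and> (\<lambda>c. \<Sum>i\<in>I. f i c) summable_on C"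
    using assms by (induction I rule: finite_induct) (auto simp: infsum_add intro: summable_on_add)
  then show "(\<Sum>i\<in>I. \<Sum>\<^sub>\<infinity>c\<in>C. f i c) = (\<Sum>\<^sub>\<infinity>c\<in>C. \<Sum>i\<in>I. f i c)" "(\<lambda>c. \<Sum>i\<in>I. f i c) summable_on C"
    by auto
qed

text \<open>The matching condition determines all second indices by the first ones. The entries of
  \<open>A\<close> are taken as column before row, so its products run along the cycles backwards;
  hence the inverse.\<close>

lemma sum_matching_index_sum:
  fixes A :: "complex^'n^'n"
  assumes fin: "finite S" and \<pi>: "\<pi> permutes S"
  shows "(\<Sum>c\<in>S \<rightarrow>\<^sub>E UNIV. (\<Prod>k\<in>S. A $ snd (c k) $ fst (c k)) *
      of_bool (\<forall>k\<in>S. snd (c k) = fst (c (\<pi> k)))) = index_sum S (\<lambda>_. A) (inv_into UNIV \<pi>)"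
proof -
  let ?J = "{c \<in> S \<rightarrow>\<^sub>E UNIV. \<forall>k\<in>S. snd (c k) = fst (c (\<pi> k))}"
  have \<pi>S: "\<pi> k \<in> S" if "k \<in> S" for k using permutes_in_image[OF \<pi>] that by blast
  have ip: "inv_into UNIV \<pi> permutes S" by (rule permutes_inv[OF \<pi>])
  have "(\<Sum>c\<in>S \<rightarrow>\<^sub>E UNIV. (\<Prod>k\<in>S. A $ snd (c k) $ fst (c k)) *
      of_bool (\<forall>k\<in>S. snd (c k) = fst (c (\<pi> k)))) =
      (\<Sum>c\<in>?J. (\<Prod>k\<in>S. A $ snd (c k) $ fst (c k)))"
    by (rule sum.mono_neutral_cong_right) (auto simp: finite_PiE[OF fin])
  also have "\<dots> = (\<Sum>a\<in>S \<rightarrow>\<^sub>E UNIV. \<Prod>k\<in>S. A $ a (\<pi> k) $ a k)"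
  proof (rule sum.reindex_bij_witness[where
        i = "\<lambda>a. \<lambda>k\<in>S. (a k, a (\<pi> k))" and j = "\<lambda>c. \<lambda>k\<in>S. fst (c k)"])
    fix c :: "nat \<Rightarrow> 'n \<times> 'n" assume c: "c \<in> ?J"
    show "(\<lambda>k\<in>S. ((\<lambda>k\<in>S. fst (c k)) k, (\<lambda>k\<in>S. fst (c k)) (\<pi> k))) = c"
    proof
      fix k
      show "(\<lambda>k\<in>S. ((\<lambda>k\<in>S. fst (c k)) k, (\<lambda>k\<in>S. fst (c k)) (\<pi> k))) k = c k"
        using c \<pi>S[of k] by (cases "k \<in> S") (auto simp: prod_eq_iff PiE_def extensional_def)
    qed
    show "(\<Prod>k\<in>S. A $ (\<lambda>k\<in>S. fst (c k)) (\<pi> k) $ (\<lambda>k\<in>S. fst (c k)) k) = (\<Prod>k\<in>S. A $ snd (c k) $ fst (c k))"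
      using c \<pi>S by (intro prod.cong) auto
  next
    fix a :: "nat \<Rightarrow> 'n" assume a: "a \<in> S \<rightarrow>\<^sub>E UNIV"
    show "(\<lambda>k\<in>S. fst ((\<lambda>k\<in>S. (a k, a (\<pi> k))) k)) = a"
      using a by (auto simp: fun_eq_iff PiE_def extensional_def)
    show "(\<lambda>k\<in>S. (a k, a (\<pi> k))) \<in> ?J"
      using \<pi>S by auto
  qed auto
  also have "\<dots> = (\<Sum>a\<in>S \<rightarrow>\<^sub>E UNIV. \<Prod>k\<in>S. A $ a k $ a (inv_into UNIV \<pi> k))"
  proof (intro sum.cong refl)
    fix a :: "nat \<Rightarrow> 'n"
    show "(\<Prod>k\<in>S. A $ a (\<pi> k) $ a k) = (\<Prod>k\<in>S. A $ a k $ a (inv_into UNIV \<pi> k))"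
      using prod.reindex_bij_betw[OF permutes_imp_bij[OF \<pi>], of "\<lambda>k. A $ a k $ a (inv_into UNIV \<pi> k)"]
      by (simp add: permutes_inverses[OF \<pi>])
  qed
  finally show ?thesis by (simp add: index_sum_def)
qed

text \<open>The Weingarten expansion of the moments of \<open>Tr (A U B U\<^sup>*)\<close>; it converges because
  \<open>card S \<le> N\<close>.\<close>

theorem haar_trace_moment:
  fixes \<kappa> :: "(complex^'n^'n) measure"
  assumes haar: "is_unitary_haar \<kappa>" and fin: "finite S" and card: "card S \<le> CARD('n)"
  shows "of_nat CARD('n) ^ card S * (\<integral>U. trace (A ** uconj U B) ^ card S \<partial>\<kappa>) =
    (\<Sum>\<^sub>\<infinity>c\<in>configs S. config_weight (- 1 / of_nat CARD('n)) (\<lambda>k. trace (matrix_power A k))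
      (\<lambda>k. trace (matrix_power B k)) S c)"
proof -
  let ?N = "of_nat CARD('n) :: complex"
  let ?x = "- 1 / ?N"
  let ?J = "S \<rightarrow>\<^sub>E (UNIV :: ('n \<times> 'n) set)"
  have finJ: "finite ?J" by (rule finite_PiE[OF fin]) simp
  have le: "real (card S) * norm ?x \<le> 1"
    using card by (simp add: norm_divide divide_le_eq)
  \<comment> \<open>Each factor of the power carries its own pair of indices; the entries of
    \<open>V\<close> then form one product of the kind averaged in
    \<open>haar_moment\<close>.\<close>
  have tr: "trace (A ** V) ^ card S =
      (\<Sum>c\<in>?J. (\<Prod>k\<in>S. A $ snd (c k) $ fst (c k)) * (\<Prod>k\<in>S. V $ fst (c k) $ snd (c k)))" for V :: "complex^'n^'n"
  proof -
    have "trace (A ** V) = (\<Sum>j\<in>UNIV. \<Sum>i\<in>UNIV. A $ j $ i * V $ i $ j)"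
      by (simp add: trace_def matrix_matrix_mult_def)
    also have "\<dots> = (\<Sum>i\<in>UNIV. \<Sum>j\<in>UNIV. A $ j $ i * V $ i $ j)" by (rule sum.swap)
    also have "\<dots> = (\<Sum>p\<in>UNIV. A $ snd p $ fst p * V $ fst p $ snd p)"
      by (simp add: sum.cartesian_product case_prod_beta)
    finally have "trace (A ** V) ^ card S = (\<Prod>k\<in>S. \<Sum>p\<in>UNIV. A $ snd p $ fst p * V $ fst p $ snd p)"
      by simp
    also have "\<dots> = (\<Sum>c\<in>?J. \<Prod>k\<in>S. A $ snd (c k) $ fst (c k) * V $ fst (c k) $ snd (c k))"
      using fin by (rule prod_sum_PiE) simp
    finally show ?thesis by (simp add: prod.distrib)
  qed
  have "(\<integral>U. trace (A ** uconj U B) ^ card S \<partial>\<kappa>) =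
      (\<Sum>c\<in>?J. (\<Prod>k\<in>S. A $ snd (c k) $ fst (c k)) * haar_moment \<kappa> S (\<lambda>_. B) (\<lambda>k. fst (c k)) (\<lambda>k. snd (c k)))"
    unfolding tr haar_moment_def[OF haar]
    by (subst Bochner_Integration.integral_sum)
      (auto intro!: integrable_mult_right integrable_prod_uconj[OF haar, where M = "\<lambda>_. B"])
  then have "?N ^ card S * (\<integral>U. trace (A ** uconj U B) ^ card S \<partial>\<kappa>) =
      (\<Sum>c\<in>?J. (\<Prod>k\<in>S. A $ snd (c k) $ fst (c k)) *
        (?N ^ card S * haar_moment \<kappa> S (\<lambda>_. B) (\<lambda>k. fst (c k)) (\<lambda>k. snd (c k))))"
    by (simp add: sum_distrib_left mult_ac)
  also have "\<dots> = (\<Sum>c\<in>?J. \<Sum>\<^sub>\<infinity>C\<in>configs S. (\<Prod>k\<in>S. A $ snd (c k) $ fst (c k)) *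
      config_index_sum ?x S (\<lambda>_. B) (\<lambda>k. fst (c k)) (\<lambda>k. snd (c k)) C)"
    unfolding haar_moment_eq_index_series[OF haar fin card] index_series_def infsum_cmult_right' ..
  also have "\<dots> = (\<Sum>\<^sub>\<infinity>C\<in>configs S. \<Sum>c\<in>?J. (\<Prod>k\<in>S. A $ snd (c k) $ fst (c k)) *
      config_index_sum ?x S (\<lambda>_. B) (\<lambda>k. fst (c k)) (\<lambda>k. snd (c k)) C)"
    by (rule sum_infsum_swap(1)[OF finJ], rule summable_on_cmult_right, rule abs_summable_summable)
      (rule abs_summable_on_config_index_sum[OF fin le])
  also have "\<dots> = (\<Sum>\<^sub>\<infinity>C\<in>configs S. config_weight ?x (\<lambda>k. trace (matrix_power A k)) (\<lambda>k. trace (matrix_power B k)) S C)"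
  proof (rule infsum_cong)
    fix C assume C: "C \<in> configs S"
    then have \<sigma>: "fst C permutes S" and ps: "snd C \<in> monotone_pairs S" by (auto simp: configs_def)
    have \<pi>: "iprod (snd C) \<circ> fst C permutes S"
      by (rule permutes_compose[OF \<sigma> iprod_permutes_monotone_pairs[OF ps]])
    have "(\<Sum>c\<in>?J. (\<Prod>k\<in>S. A $ snd (c k) $ fst (c k)) *
        config_index_sum ?x S (\<lambda>_. B) (\<lambda>k. fst (c k)) (\<lambda>k. snd (c k)) C) =
        ?x ^ length (snd C) * index_sum S (\<lambda>_. B) (fst C) *
        (\<Sum>c\<in>?J. (\<Prod>k\<in>S. A $ snd (c k) $ fst (c k)) *
          of_bool (\<forall>k\<in>S. snd (c k) = fst (c ((iprod (snd C) \<circ> fst C) k))))"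
      by (simp add: config_index_sum_def sum_distrib_left mult_ac)
    \<comment> \<open>Reversing a permutation keeps its cycles as sets, so the traces of powers of
      \<open>A\<close> are those of the permutation itself.\<close>
    also have "\<dots> = config_weight ?x (\<lambda>k. trace (matrix_power A k)) (\<lambda>k. trace (matrix_power B k)) S C"
      unfolding sum_matching_index_sum[OF fin \<pi>] index_sum_const[OF fin permutes_inv[OF \<pi>]]
        index_sum_const[OF fin \<sigma>] config_weight_def orbit_weight_def orbit_inv_permutes[OF \<pi> fin]
      by (simp add: mult_ac)
    finally show "(\<Sum>c\<in>?J. (\<Prod>k\<in>S. A $ snd (c k) $ fst (c k)) *
        config_index_sum ?x S (\<lambda>_. B) (\<lambda>k. fst (c k)) (\<lambda>k. snd (c k)) C) =
        config_weight ?x (\<lambda>k. trace (matrix_power A k)) (\<lambda>k. trace (matrix_power B k)) S C" .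
  qed
  finally show ?thesis .
qed

section \<open>Connected configurations and cumulants\<close>

text \<open>Configurations are sorted by the component of the marked point \<open>v\<close>, and the
  weight is multiplicative over that component and its complement.\<close>

lemma infsum_configs_component:
  fixes x :: complex
  assumes fin: "finite S" and v: "v \<in> S" and le: "real (card S) * norm x \<le> 1"
  shows "(\<Sum>\<^sub>\<infinity>c\<in>configs S. config_weight x h k S c) =
    (\<Sum>T | T \<subseteq> S \<and> v \<in> T. (\<Sum>\<^sub>\<infinity>c\<in>connected_configs T. config_weight x h k T c) *
      (\<Sum>\<^sub>\<infinity>c\<in>configs (S - T). config_weight x h k (S - T) c))"
proof -
  let ?TT = "{T. T \<subseteq> S \<and> v \<in> T}"
  let ?w = "config_weight x h k"
  have finTT: "finite ?TT" using fin by simp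
  have abs_S: "?w S abs_summable_on configs S" by (rule abs_summable_on_config_weight[OF fin le])
  have sub: "?w V abs_summable_on configs V" if "V \<subseteq> S" for V
  proof (rule abs_summable_on_config_weight)
    show "finite V" using that fin finite_subset by blast
    have "real (card V) * norm x \<le> real (card S) * norm x"
      using card_mono[OF fin that] by (intro mult_right_mono) auto
    then show "real (card V) * norm x \<le> 1" using le by linarith
  qed
  have "(\<Sum>\<^sub>\<infinity>c\<in>configs S. ?w S c) =
      (\<Sum>\<^sub>\<infinity>c\<in>configs S. \<Sum>T\<in>?TT. if component S v c = T then ?w S c else 0)"
  proof (rule infsum_cong)
    fix c assume c: "c \<in> configs S"
    have "component S v c \<in> ?TT" using component[OF c v] by auto
    then show "?w S c = (\<Sum>T\<in>?TT. if component S v c = T then ?w S c else 0)"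
      using finTT by (simp add: sum.delta)
  qed
  also have "\<dots> = (\<Sum>T\<in>?TT. \<Sum>\<^sub>\<infinity>c\<in>configs S. if component S v c = T then ?w S c else 0)"
  proof (rule sum_infsum_swap(1)[OF finTT, symmetric])
    fix T
    have "(\<lambda>c. norm (if component S v c = T then ?w S c else 0)) summable_on configs S"
      by (rule summable_on_comparison_test[OF abs_S]) auto
    then show "(\<lambda>c. if component S v c = T then ?w S c else 0) summable_on configs S"
      by (rule abs_summable_summable)
  qed
  also have "\<dots> = (\<Sum>T\<in>?TT. (\<Sum>\<^sub>\<infinity>c\<in>connected_configs T. ?w T c) * (\<Sum>\<^sub>\<infinity>c\<in>configs (S - T). ?w (S - T) c))"
  proof (rule sum.cong[OF refl])
    fix T assume "T \<in> ?TT"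
    then have T: "T \<subseteq> S" "v \<in> T" by auto
    have finT: "finite T" using T fin finite_subset by blast
    have conn: "connected_configs T \<subseteq> configs T" by (auto simp: connected_configs_def)
    have s1: "?w T abs_summable_on connected_configs T"
      using sub[OF T(1)] conn by (rule summable_on_subset_banach)
    have s2: "?w (S - T) abs_summable_on configs (S - T)" by (rule sub) auto
    have "(\<Sum>\<^sub>\<infinity>c\<in>configs S. if component S v c = T then ?w S c else 0) =
        (\<Sum>\<^sub>\<infinity>c\<in>{c \<in> configs S. component S v c = T}. ?w S c)"
      by (rule infsum_cong_neutral) auto
    also have "\<dots> = (\<Sum>\<^sub>\<infinity>c\<in>connected_configs T \<times> configs (S - T). ?w S (merge_configs c))"
      by (rule infsum_reindex_bij_betw[OF bij_betw_merge_configs[OF fin T], symmetric])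
    also have "\<dots> = (\<Sum>\<^sub>\<infinity>(c1, c2)\<in>connected_configs T \<times> configs (S - T). ?w T c1 * ?w (S - T) c2)"
    proof (rule infsum_cong)
      fix c assume "c \<in> connected_configs T \<times> configs (S - T)"
      then obtain c1 c2 where c: "c = (c1, c2)" "c1 \<in> configs T" "c2 \<in> configs (S - T)" using conn by auto
      have "T \<union> (S - T) = S" using T by auto
      then show "?w S (merge_configs c) = (case c of (c1, c2) \<Rightarrow> ?w T c1 * ?w (S - T) c2)"
        using config_weight_merge[OF c(2,3) _ finT, of x h k] fin by (simp add: c(1))
    qed
    also have "\<dots> = (\<Sum>\<^sub>\<infinity>c1\<in>connected_configs T. \<Sum>\<^sub>\<infinity>c2\<in>configs (S - T). ?w T c1 * ?w (S - T) c2)"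
    proof (rule infsum_Sigma'_banach[symmetric])
      have "(\<lambda>z. (\<lambda>(c1, c2). ?w T c1 * ?w (S - T) c2) z) abs_summable_on connected_configs T \<times> configs (S - T)"
        unfolding Infinite_Sum.abs_summable_on_Sigma_iff
        using s1 s2 by (auto simp: norm_mult infsum_cmult_right' infsum_nonneg abs_mult
            intro: summable_on_cmult_right summable_on_cmult_left)
      then show "(\<lambda>(c1, c2). ?w T c1 * ?w (S - T) c2) summable_on connected_configs T \<times> configs (S - T)"
        by (rule abs_summable_summable)
    qed
    also have "\<dots> = (\<Sum>\<^sub>\<infinity>c\<in>connected_configs T. ?w T c) * (\<Sum>\<^sub>\<infinity>c\<in>configs (S - T). ?w (S - T) c)"
      by (simp add: infsum_cmult_right' infsum_cmult_left')
    finally show "(\<Sum>\<^sub>\<infinity>c\<in>configs S. if component S v c = T then ?w S c else 0) =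
        (\<Sum>\<^sub>\<infinity>c\<in>connected_configs T. ?w T c) * (\<Sum>\<^sub>\<infinity>c\<in>configs (S - T). ?w (S - T) c)" .
  qed
  finally show ?thesis .
qed

lemma sum_subsets_containing:
  fixes f :: "nat \<Rightarrow> 'b::comm_semiring_1"
  assumes fin: "finite S" and v: "v \<in> S" and card: "card S = Suc n"
  shows "(\<Sum>T | T \<subseteq> S \<and> v \<in> T. f (card T)) = (\<Sum>j\<le>n. of_nat (n choose j) * f (Suc j))"
proof -
  let ?R = "S - {v}"
  have finR: "finite ?R" and cardR: "card ?R = n" using fin v card by auto
  have "(\<Sum>T | T \<subseteq> S \<and> v \<in> T. f (card T)) = (\<Sum>R\<in>Pow ?R. f (Suc (card R)))"
  proof (rule sum.reindex_bij_witness[where i = "insert v" and j = "\<lambda>T. T - {v}"])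
    fix T assume "T \<in> {T. T \<subseteq> S \<and> v \<in> T}"
    then have T: "T \<subseteq> S" "v \<in> T" "finite T" using fin finite_subset by auto
    show "f (Suc (card (T - {v}))) = f (card T)" using card.remove[OF T(3,2)] by simp
  qed (use v in auto)
  also have "\<dots> = (\<Sum>j\<le>n. \<Sum>R\<in>{R \<in> Pow ?R. card R = j}. f (Suc (card R)))"
    by (rule sum.group[symmetric]) (use finR cardR card_mono[OF finR] in auto)
  also have "\<dots> = (\<Sum>j\<le>n. of_nat (n choose j) * f (Suc j))"
  proof (rule sum.cong[OF refl])
    fix j
    have "(\<Sum>R\<in>{R \<in> Pow ?R. card R = j}. f (Suc (card R))) = (\<Sum>R\<in>{R. R \<subseteq> ?R \<and> card R = j}. f (Suc j))"
      by (rule sum.cong) auto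
    then show "(\<Sum>R\<in>{R \<in> Pow ?R. card R = j}. f (Suc (card R))) = of_nat (n choose j) * f (Suc j)"
      using n_subsets[OF finR, of j] cardR by simp
  qed
  finally show ?thesis .
qed

text \<open>Both families satisfy the recursion over subsets containing a marked point. The term of
  the whole set has coefficient \<open>w 0\<close> = 1, so the value on a set is determined by those
  on smaller sets.\<close>

theorem infsum_connected_configs:
  fixes x :: complex and w \<gamma> :: "nat \<Rightarrow> complex"
  assumes w: "\<And>S. finite S \<Longrightarrow> card S \<le> N \<Longrightarrow> (\<Sum>\<^sub>\<infinity>c\<in>configs S. config_weight x h k S c) = w (card S)"
    and w0: "w 0 = 1" and rec: "\<And>n. w (Suc n) = (\<Sum>j\<le>n. of_nat (n choose j) * (\<gamma> (Suc j) * w (n - j)))"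
    and x: "real N * norm x \<le> 1"
    and S: "finite S" "S \<noteq> {}" "card S \<le> N"
  shows "(\<Sum>\<^sub>\<infinity>c\<in>connected_configs S. config_weight x h k S c) = \<gamma> (card S)"
  using S
proof (induction "card S" arbitrary: S rule: less_induct)
  case less
  let ?C = "\<lambda>T. \<Sum>\<^sub>\<infinity>c\<in>connected_configs T. config_weight x h k T c"
  obtain v where v: "v \<in> S" using less.prems by auto
  obtain n where n: "card S = Suc n" using less.prems by (metis card_eq_0_iff not0_implies_Suc)
  have le: "real (card S) * norm x \<le> 1"
  proof -
    have "real (card S) * norm x \<le> real N * norm x" using less.prems by (intro mult_right_mono) auto
    then show ?thesis using x by linarith
  qed
  let ?TT = "{T. T \<subseteq> S \<and> v \<in> T}"
  have finTT: "finite ?TT" using less.prems by simp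
  have S_TT: "S \<in> ?TT" using v by simp
  have W: "(\<Sum>\<^sub>\<infinity>c\<in>configs (S - T). config_weight x h k (S - T) c) = w (card S - card T)" if "T \<in> ?TT" for T
  proof -
    have "card (S - T) = card S - card T"
      using that less.prems(1) by (intro card_Diff_subset) (auto intro: finite_subset)
    then show ?thesis using w[of "S - T"] less.prems by auto
  qed
  have "(\<Sum>T\<in>?TT. ?C T * w (card S - card T)) = w (Suc n)"
  proof -
    have "(\<Sum>T\<in>?TT. ?C T * w (card S - card T)) = (\<Sum>\<^sub>\<infinity>c\<in>configs S. config_weight x h k S c)"
      unfolding infsum_configs_component[OF less.prems(1) v le] using W by (intro sum.cong refl) simp
    then show ?thesis using w[OF less.prems(1,3)] n by simp
  qed
  also have "\<dots> = (\<Sum>T\<in>?TT. \<gamma> (card T) * w (card S - card T))"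
    using sum_subsets_containing[OF less.prems(1) v n, of "\<lambda>j. \<gamma> j * w (card S - j)"] by (simp add: rec n)
  finally have "(\<Sum>T\<in>?TT. ?C T * w (card S - card T)) = (\<Sum>T\<in>?TT. \<gamma> (card T) * w (card S - card T))" .
  moreover have "(\<Sum>T\<in>?TT - {S}. ?C T * w (card S - card T)) = (\<Sum>T\<in>?TT - {S}. \<gamma> (card T) * w (card S - card T))"
  proof (rule sum.cong[OF refl])
    fix T assume "T \<in> ?TT - {S}"
    then have T: "T \<subset> S" "v \<in> T" by auto
    have "card T < card S" by (rule psubset_card_mono[OF less.prems(1) T(1)])
    then have "?C T = \<gamma> (card T)"
      using T less.prems by (intro less.hyps) (auto intro: finite_subset)
    then show "?C T * w (card S - card T) = \<gamma> (card T) * w (card S - card T)" by simp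
  qed
  ultimately show ?case
    unfolding sum.remove[OF finTT S_TT] by (simp add: w0)
qed

section \<open>The free energy\<close>

lemma matrix_inv_unitary: "U \<in> unitary_group \<Longrightarrow> matrix_inv U = conj_transpose U"
proof -
  assume U: "U \<in> unitary_group"
  then have "invertible U" unfolding invertible_def unitary_group_def by blast
  then have "U ** matrix_inv U = mat 1" "matrix_inv U ** U = mat 1"
    using someI_ex[of "\<lambda>V. U ** V = mat 1 \<and> V ** U = mat 1"] unfolding matrix_inv_def invertible_def by auto
  have "matrix_inv U = matrix_inv U ** (U ** conj_transpose U)"
    using U by (simp add: unitary_group_def)
  also have "\<dots> = (matrix_inv U ** U) ** conj_transpose U" by (simp add: matrix_mul_assoc)
  also have "\<dots> = conj_transpose U" using \<open>matrix_inv U ** U = mat 1\<close> by simp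
  finally show ?thesis .
qed

text \<open>The trace is bounded on the unitary group, so the exponential series is dominated by a
  convergent numerical series and may be integrated term by term.\<close>

lemma hciz_sums:
  fixes \<kappa> :: "(complex^'n^'n) measure"
  assumes haar: "is_unitary_haar \<kappa>"
  shows "(\<lambda>j. ((- of_nat CARD('n)) ^ j * (\<integral>U. trace (A ** uconj U B) ^ j \<partial>\<kappa>) / fact j) * z ^ j) sums hciz \<kappa> z A B"
proof -
  let ?N = "of_nat CARD('n) :: complex"
  let ?T = "\<lambda>U. trace (A ** uconj U B)"
  define K where "K = (\<Sum>i\<in>(UNIV::'n set). \<Sum>j\<in>(UNIV::'n set). entry_bound A * entry_bound B)"
  have T_bound: "norm (?T U) \<le> K" if U: "U \<in> unitary_group" for U
  proof -
    have "?T U = (\<Sum>i\<in>UNIV. \<Sum>k\<in>UNIV. A $ i $ k * uconj U B $ k $ i)"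
      by (simp add: trace_def matrix_matrix_mult_def)
    moreover have "norm (A $ i $ k * uconj U B $ k $ i) \<le> entry_bound A * entry_bound B" for i k
      unfolding norm_mult
      by (intro mult_mono norm_nth_le_entry_bound norm_uconj_nth_le[OF U] entry_bound_nonneg norm_ge_zero)
    ultimately show ?thesis unfolding K_def by (simp only:, intro sum_norm_le)
  qed
  have K0: "0 \<le> K" unfolding K_def by (intro sum_nonneg mult_nonneg_nonneg entry_bound_nonneg)
  have T_cont: "continuous_on UNIV ?T"
    unfolding trace_def matrix_matrix_mult_def by (simp, intro continuous_intros continuous_on_uconj_nth)
  define f where "f j U = (- z * ?N * ?T U) ^ j /\<^sub>R fact j" for j U
  let ?q = "norm (- z * ?N) * K"
  have f_bound: "norm (f j U) \<le> ?q ^ j /\<^sub>R fact j" if U: "U \<in> unitary_group" for j U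
    unfolding f_def norm_scaleR norm_power
    by (simp add: norm_mult, intro divide_right_mono power_mono mult_left_mono T_bound U) auto
  have f_cont: "continuous_on UNIV (f j)" for j
    unfolding f_def by (intro continuous_intros T_cont)
  have f_int: "integrable \<kappa> (f j)" for j
    by (rule integrable_haar[OF haar f_cont f_bound])
  have sq: "summable (\<lambda>j. ?q ^ j /\<^sub>R fact j)" by (rule summable_exp_generic)
  have "(\<lambda>j. integral\<^sup>L \<kappa> (f j)) sums (\<integral>U. (\<Sum>j. f j U) \<partial>\<kappa>)"
  proof (rule sums_integral[OF f_int])
    show "AE U in \<kappa>. summable (\<lambda>j. norm (f j U))"
      by (rule AE_I2) (rule summable_comparison_test'[OF sq, of 0], use f_bound in \<open>auto simp: space_haar[OF haar]\<close>)
    show "summable (\<lambda>j. \<integral>U. norm (f j U) \<partial>\<kappa>)"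
    proof (rule summable_comparison_test'[OF sq, of 0])
      fix j
      have "(\<integral>U. norm (f j U) \<partial>\<kappa>) \<le> (\<integral>U. ?q ^ j /\<^sub>R fact j \<partial>\<kappa>)"
        by (intro integral_mono integrable_norm f_int finite_measure.integrable_const[OF finite_measure_haar[OF haar]])
          (use f_bound in \<open>auto simp: space_haar[OF haar]\<close>)
      also have "\<dots> = ?q ^ j /\<^sub>R fact j"
        using haar by (simp add: is_unitary_haar_def measure_def)
      finally show "norm (\<integral>U. norm (f j U) \<partial>\<kappa>) \<le> ?q ^ j /\<^sub>R fact j"
        by (simp add: integral_nonneg_AE)
    qed
  qed
  also have "(\<integral>U. (\<Sum>j. f j U) \<partial>\<kappa>) = hciz \<kappa> z A B"
    unfolding hciz_def
  proof (rule Bochner_Integration.integral_cong[OF refl])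
    fix U assume "U \<in> space \<kappa>"
    then have "matrix_inv U = conj_transpose U" using matrix_inv_unitary by (simp add: space_haar[OF haar])
    then have "A ** U ** B ** matrix_inv U = A ** uconj U B" by (simp add: uconj_def matrix_mul_assoc)
    then show "(\<Sum>j. f j U) = exp (- z * ?N * trace (A ** U ** B ** matrix_inv U))"
      by (simp add: f_def exp_def)
  qed
  also have "(\<lambda>j. integral\<^sup>L \<kappa> (f j)) =
      (\<lambda>j. ((- ?N) ^ j * (\<integral>U. ?T U ^ j \<partial>\<kappa>) / fact j) * z ^ j)"
  proof
    fix j
    have "f j U = ((- ?N) ^ j / fact j * z ^ j) * ?T U ^ j" for U
      by (simp add: f_def scaleR_conv_of_real divide_inverse power_mult_distrib mult_ac power_minus[of "z * _"]
          power_minus[of ?N] power_minus[of "?N * _"] power_minus[of "z"])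
    then have "f j = (\<lambda>U. ((- ?N) ^ j / fact j * z ^ j) * ?T U ^ j)" by (rule ext)
    then show "integral\<^sup>L \<kappa> (f j) = ((- ?N) ^ j * (\<integral>U. ?T U ^ j \<partial>\<kappa>) / fact j) * z ^ j"
      by simp
  qed
  finally show ?thesis .
qed

text \<open>Comparison of Taylor coefficients in I' = N^2 F' I. The signs are absorbed by passing to
  -z: \<open>w n\<close> and \<open>\<gamma> n\<close> are the \<open>n\<close>-th derivatives at 0
  of I(-z) and N^2 F(-z).\<close>

lemma free_energy_recurrence:
  fixes \<kappa> :: "(complex^'n^'n) measure"
  assumes haar: "is_unitary_haar \<kappa>" and F: "is_free_energy \<kappa> A B D F"
  defines "w \<equiv> \<lambda>n. of_nat CARD('n) ^ n * (\<integral>U. trace (A ** uconj U B) ^ n \<partial>\<kappa>)"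
  defines "\<gamma> \<equiv> \<lambda>n. (-1) ^ n * of_nat (CARD('n)\<^sup>2) * (deriv ^^ n) F 0"
  shows "w (Suc n) = (\<Sum>j\<le>n. of_nat (n choose j) * (\<gamma> (Suc j) * w (n - j)))"
proof -
  let ?N = "of_nat CARD('n) :: complex" and ?N2 = "of_nat (CARD('n)\<^sup>2) :: complex"
  let ?I = "\<lambda>z. hciz \<kappa> z A B"
  define FI where "FI = Abs_fps (\<lambda>j. (- ?N) ^ j * (\<integral>U. trace (A ** uconj U B) ^ j \<partial>\<kappa>) / fact j)"
  define FF where "FF = fps_expansion F 0"
  have D: "open D" "0 \<in> D" "F holomorphic_on D" "\<And>z. z \<in> D \<Longrightarrow> ?I z = exp (?N2 * F z)"
    using F by (auto simp: is_free_energy_def)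
  have I_exp: "?I has_fps_expansion FI"
    by (rule has_fps_expansionI, rule always_eventually) (use hciz_sums[OF haar, of A B] in \<open>simp add: FI_def\<close>)
  have F_exp: "F has_fps_expansion FF"
    unfolding FF_def by (rule has_fps_expansion_fps_expansion[OF D(1-3)])
  have dI: "deriv ?I z = ?N2 * deriv F z * ?I z" if z: "z \<in> D" for z
  proof -
    have "(F has_field_derivative deriv F z) (at z)"
      using D(1,3) z holomorphic_derivI by blast
    then have "((\<lambda>z. exp (?N2 * F z)) has_field_derivative ?N2 * deriv F z * exp (?N2 * F z)) (at z)"
      by (auto intro!: derivative_eq_intros)
    then have "(?I has_field_derivative ?N2 * deriv F z * exp (?N2 * F z)) (at z)"
      by (rule has_field_derivative_transform_within_open[OF _ D(1) z]) (simp add: D(4))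
    then show ?thesis using D(4)[OF z] DERIV_imp_deriv by metis
  qed
  have "(\<lambda>z. ?N2 * deriv F z * ?I z) has_fps_expansion fps_const ?N2 * fps_deriv FF * FI"
    by (intro has_fps_expansion_mult has_fps_expansion_cmult_left has_fps_expansion_deriv F_exp I_exp)
  moreover have ev: "eventually (\<lambda>z. deriv ?I z = ?N2 * deriv F z * ?I z) (nhds 0)"
    unfolding eventually_nhds using D(1,2) dI by blast
  ultimately have "deriv ?I has_fps_expansion fps_const ?N2 * fps_deriv FF * FI"
    using has_fps_expansion_cong[OF ev refl] by blast
  then have eq: "fps_deriv FI = fps_const ?N2 * fps_deriv FF * FI"
    using has_fps_expansion_deriv[OF I_exp] fps_expansion_unique_complex by blast
  have FF_nth: "fps_nth FF j = (deriv ^^ j) F 0 / fact j" for j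
    by (rule fps_nth_fps_expansion[OF F_exp])
  have FI_nth: "fps_nth FI j = (-1) ^ j * w j / fact j" for j
    by (simp add: FI_def w_def power_minus[of ?N] mult_ac)
  have "of_nat (Suc n) * fps_nth FI (Suc n) =
      ?N2 * (\<Sum>j\<le>n. of_nat (Suc j) * fps_nth FF (Suc j) * fps_nth FI (n - j))"
    using arg_cong[OF eq, of "\<lambda>G. fps_nth G n"]
    by (simp only: mult.assoc fps_mult_left_const_nth fps_mult_nth[of "fps_deriv _"] fps_deriv_nth
        atMost_atLeast0 Suc_eq_plus1)
  then have "(-1) ^ Suc n * fact n * (of_nat (Suc n) * fps_nth FI (Suc n)) =
      (\<Sum>j\<le>n. (-1) ^ Suc n * fact n * (?N2 * (of_nat (Suc j) * fps_nth FF (Suc j) * fps_nth FI (n - j))))"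
    by (simp only: sum_distrib_left)
  also have "\<dots> = (\<Sum>j\<le>n. of_nat (n choose j) * (\<gamma> (Suc j) * w (n - j)))"
  proof (rule sum.cong[OF refl])
    fix j assume "j \<in> {..n}"
    then have j: "j \<le> n" by simp
    have sgn: "(-1 :: complex) ^ Suc n * (-1) ^ (n - j) = (-1) ^ Suc j"
    proof -
      have "(-1 :: complex) ^ Suc n = (-1) ^ Suc j * (-1) ^ (n - j)"
        using j by (simp add: power_add[symmetric])
      then show ?thesis by (simp add: power_mult_distrib[symmetric] mult.assoc)
    qed
    have "(-1) ^ Suc n * fact n * (?N2 * (of_nat (Suc j) * fps_nth FF (Suc j) * fps_nth FI (n - j))) =
        ((-1) ^ Suc n * (-1) ^ (n - j)) * (fact n / (fact j * fact (n - j))) * ?N2 * (deriv ^^ Suc j) F 0 * w (n - j)"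
      unfolding FF_nth FI_nth fact_Suc by (simp add: field_simps del: funpow.simps power_Suc of_nat_Suc)
    also have "\<dots> = of_nat (n choose j) * (\<gamma> (Suc j) * w (n - j))"
      unfolding sgn binomial_fact[OF j] \<gamma>_def by (simp add: mult_ac del: funpow.simps)
    finally show "(-1) ^ Suc n * fact n * (?N2 * (of_nat (Suc j) * fps_nth FF (Suc j) * fps_nth FI (n - j))) =
        of_nat (n choose j) * (\<gamma> (Suc j) * w (n - j))" .
  qed
  also have "(-1) ^ Suc n * fact n * (of_nat (Suc n) * fps_nth FI (Suc n)) = w (Suc n)"
  proof -
    have "(-1 :: complex) ^ Suc n * (-1) ^ Suc n = 1"
      unfolding power_mult_distrib[symmetric] by simp
    then show ?thesis
      unfolding FI_nth fact_Suc by (simp add: field_simps del: power_Suc of_nat_Suc)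
  qed
  finally show ?thesis .
qed

theorem connected_configs_free_energy:
  fixes \<kappa> :: "(complex^'n^'n) measure"
  assumes haar: "is_unitary_haar \<kappa>" and F: "is_free_energy \<kappa> A B D F"
    and S: "finite S" "S \<noteq> {}" "card S \<le> CARD('n)"
  shows "(\<Sum>\<^sub>\<infinity>c\<in>connected_configs S. config_weight (- 1 / of_nat CARD('n)) (\<lambda>k. trace (matrix_power A k))
      (\<lambda>k. trace (matrix_power B k)) S c) = (-1) ^ card S * of_nat (CARD('n)\<^sup>2) * (deriv ^^ card S) F 0"
proof (rule infsum_connected_configs[OF _ _ free_energy_recurrence[OF haar F] _ S])
  show "real CARD('n) * norm (- 1 / of_nat CARD('n) :: complex) \<le> 1" by (simp add: norm_divide)
  show "of_nat CARD('n) ^ 0 * (\<integral>U. trace (A ** uconj U B) ^ 0 \<partial>\<kappa>) = 1"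
    using haar by (simp add: is_unitary_haar_def measure_def)
qed (rule haar_trace_moment[OF haar, symmetric])

section \<open>Regrouping by genus\<close>

text \<open>For connected configurations on a nonempty set neither the subtraction nor the division
  truncates, by \<open>genus_connected\<close>.\<close>

definition genus :: "nat set \<Rightarrow> config \<Rightarrow> nat" where
  "genus S c = (length (snd c) + 2 - card (orbit (iprod (snd c) \<circ> fst c) ` S) - card (orbit (fst c) ` S)) div 2"

lemma genus_connected:
  assumes "finite S" "S \<noteq> {}" "c \<in> connected_configs S"
  shows "2 * genus S c + card (orbit (iprod (snd c) \<circ> fst c) ` S) + card (orbit (fst c) ` S) = length (snd c) + 2"
proof -
  obtain g where g: "2 * g + card (orbit (iprod (snd c) \<circ> fst c) ` S) + card (orbit (fst c) ` S) = length (snd c) + 2"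
    using connected_config_genus[OF assms(1,2), of "fst c" "snd c"] assms(3) by auto
  have "genus S c = g" unfolding genus_def g[symmetric] by simp
  with g show ?thesis by simp
qed

lemma size_cycle_type: "size (cycle_type d \<sigma>) = card (orbit \<sigma> ` {1..d})"
  by (simp add: cycle_type_def)

lemma power_sum_cycle_type:
  "power_sum (cycle_type d \<sigma>) A = orbit_weight (\<lambda>k. trace (matrix_power A k)) {1..d} \<sigma>"
  by (simp add: power_sum_def cycle_type_def orbit_weight_def prod_unfold_prod_mset image_mset.compositionality comp_def)

lemma cycle_type_partitions:
  assumes \<sigma>: "\<sigma> permutes {1..d}"
  shows "cycle_type d \<sigma> \<in> partitions d"
proof -
  have perm: "permutation \<sigma>" using \<sigma> by (auto simp: permutation_permutes)
  have self: "x \<in> orbit \<sigma> x" for x by (rule permutation_self_in_orbit[OF perm])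
  have sub: "orbit \<sigma> x \<subseteq> {1..d}" if "x \<in> {1..d}" for x by (rule permutes_orbit_subset[OF \<sigma> that])
  have fin: "finite (orbit \<sigma> x)" for x by (rule finite_orbit[OF self])
  have "0 \<notin># cycle_type d \<sigma>"
    using fin by (auto simp: cycle_type_def card_eq_0_iff orbit_nonempty)
  moreover have "sum_mset (cycle_type d \<sigma>) = (\<Sum>C\<in>orbit \<sigma> ` {1..d}. card C)"
    by (simp add: cycle_type_def sum_unfold_sum_mset)
  moreover have "(\<Sum>C\<in>orbit \<sigma> ` {1..d}. card C) = card (\<Union>(orbit \<sigma> ` {1..d}))"
  proof (rule card_Union_disjoint[symmetric])
    show "disjoint (orbit \<sigma> ` {1..d})"
      unfolding disjoint_def using orbit_eq_if_mem[OF perm] by blast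
  qed (use fin in auto)
  moreover have "\<Union>(orbit \<sigma> ` {1..d}) = {1..d}" using self sub by blast
  ultimately show ?thesis by (simp add: partitions_def)
qed

lemma partitions_size_pos: "1 \<le> d \<Longrightarrow> \<alpha> \<in> partitions d \<Longrightarrow> 1 \<le> size \<alpha>"
  by (cases \<alpha>) (auto simp: partitions_def)

text \<open>For given genus the two cycle types fix the number of transpositions. The weight is thus
  constant on each class of cycle types, and the class is counted by a Hurwitz number; finiteness
  follows since there are finitely many types.\<close>

lemma leading_coeff_eq_sum_configs:
  fixes A B :: "complex^'n^'n"
  assumes d: "1 \<le> d"
  shows "leading_coeff g d A B / of_nat CARD('n) ^ (2 * g) =
    (-1) ^ d / of_nat (CARD('n)\<^sup>2) *
    (\<Sum>c | c \<in> connected_configs {1..d} \<and> genus {1..d} c = g.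
      config_weight (- 1 / of_nat CARD('n)) (\<lambda>k. trace (matrix_power A k)) (\<lambda>k. trace (matrix_power B k)) {1..d} c)"
    "finite {c \<in> connected_configs {1..d}. genus {1..d} c = g}"
proof -
  let ?S = "{1..d}" and ?N = "of_nat CARD('n) :: complex"
  let ?w = "config_weight (- 1 / ?N) (\<lambda>k. trace (matrix_power A k)) (\<lambda>k. trace (matrix_power B k)) ?S"
  let ?G = "{c \<in> connected_configs ?S. genus ?S c = g}"
  let ?r = "\<lambda>\<alpha> \<beta>. 2 * g + size \<alpha> + size \<beta> - 2"
  let ?t = "\<lambda>c. (cycle_type d (iprod (snd c) \<circ> fst c), cycle_type d (fst c))"
  let ?C = "\<lambda>\<alpha> \<beta>. {c \<in> connected_configs ?S. length (snd c) = ?r \<alpha> \<beta> \<and>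
      cycle_type d (iprod (snd c) \<circ> fst c) = \<alpha> \<and> cycle_type d (fst c) = \<beta>}"
  have S: "finite ?S" "?S \<noteq> {}" using d by auto
  have N: "?N \<noteq> 0" by simp
  have t: "?t c \<in> partitions d \<times> partitions d" if c: "c \<in> connected_configs ?S" for c
  proof -
    have \<sigma>: "fst c permutes ?S" and ps: "snd c \<in> monotone_pairs ?S"
      using c by (auto simp: connected_configs_def configs_def)
    show ?thesis
      using cycle_type_partitions[OF \<sigma>]
        cycle_type_partitions[OF permutes_compose[OF \<sigma> iprod_permutes_monotone_pairs[OF ps]]] by blast
  qed
  have fiber: "{c \<in> ?G. ?t c = (\<alpha>, \<beta>)} = ?C \<alpha> \<beta>" if "\<alpha> \<in> partitions d" "\<beta> \<in> partitions d" for \<alpha> \<beta>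
  proof -
    have sz: "1 \<le> size \<alpha>" "1 \<le> size \<beta>" using partitions_size_pos[OF d] that by auto
    have "genus ?S c = g \<longleftrightarrow> length (snd c) = ?r \<alpha> \<beta>"
      if c: "c \<in> connected_configs ?S" "?t c = (\<alpha>, \<beta>)" for c
    proof -
      have "card (orbit (iprod (snd c) \<circ> fst c) ` ?S) = size \<alpha>" "card (orbit (fst c) ` ?S) = size \<beta>"
        using c(2) by (simp_all only: prod.inject size_cycle_type[symmetric])
      then have "2 * genus ?S c + size \<alpha> + size \<beta> = length (snd c) + 2"
        using genus_connected[OF S c(1)] by (simp only:)
      then show ?thesis using sz by linarith
    qed
    then show ?thesis by (intro Collect_cong) (simp only: mem_Collect_eq prod.inject, blast)
  qed
  have finC: "finite (?C \<alpha> \<beta>)" for \<alpha> \<beta>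
    using bij_betw_finite[OF bij_betw_hurwitz_tuple, of d "?r \<alpha> \<beta>" \<alpha> \<beta>] finite_hurwitz_tuples by blast
  have G_un: "?G = (\<Union>(\<alpha>, \<beta>)\<in>partitions d \<times> partitions d. {c \<in> ?G. ?t c = (\<alpha>, \<beta>)})"
    using t by blast
  show finG: "finite ?G"
    by (subst G_un, rule finite_UN_I) (use finite_partitions finC fiber in \<open>auto simp only: finite_cartesian_product split: prod.splits\<close>)
  have card_C: "card (?C \<alpha> \<beta>) = monotone_hurwitz d g \<alpha> \<beta>" if "\<alpha> \<in> partitions d" "\<beta> \<in> partitions d" for \<alpha> \<beta>
  proof -
    have "1 \<le> size \<alpha>" "1 \<le> size \<beta>" using partitions_size_pos[OF d] that by auto
    then have "monotone_hurwitz d g \<alpha> \<beta> = card (hurwitz_tuples d (?r \<alpha> \<beta>) \<alpha> \<beta>)"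
      by (simp add: monotone_hurwitz_def)
    then show ?thesis using bij_betw_same_card[OF bij_betw_hurwitz_tuple, of d "?r \<alpha> \<beta>" \<alpha> \<beta>] by simp
  qed
  have "(\<Sum>c\<in>?G. ?w c) = (\<Sum>p\<in>partitions d \<times> partitions d. \<Sum>c\<in>{c \<in> ?G. ?t c = p}. ?w c)"
    by (rule sum.group[symmetric]) (use finG finite_partitions t in auto)
  also have "\<dots> = (\<Sum>(\<alpha>, \<beta>)\<in>partitions d \<times> partitions d.
      of_nat (monotone_hurwitz d g \<alpha> \<beta>) * ((- 1 / ?N) ^ ?r \<alpha> \<beta> * power_sum \<alpha> A * power_sum \<beta> B))"
  proof (rule sum.cong[OF refl])
    fix p assume "p \<in> partitions d \<times> partitions d"
    then obtain \<alpha> \<beta> where p: "p = (\<alpha>, \<beta>)" "\<alpha> \<in> partitions d" "\<beta> \<in> partitions d" by auto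
    have "(\<Sum>c\<in>{c \<in> ?G. ?t c = p}. ?w c) = (\<Sum>c\<in>?C \<alpha> \<beta>. (- 1 / ?N) ^ ?r \<alpha> \<beta> * power_sum \<alpha> A * power_sum \<beta> B)"
      unfolding p(1) fiber[OF p(2,3)]
    proof (rule sum.cong[OF refl])
      fix c assume "c \<in> ?C \<alpha> \<beta>"
      then have c: "length (snd c) = ?r \<alpha> \<beta>" "cycle_type d (iprod (snd c) \<circ> fst c) = \<alpha>" "cycle_type d (fst c) = \<beta>"
        by blast+
      show "?w c = (- 1 / ?N) ^ ?r \<alpha> \<beta> * power_sum \<alpha> A * power_sum \<beta> B"
        unfolding config_weight_def c(1) power_sum_cycle_type[symmetric] c(2,3) ..
    qed
    also have "\<dots> = of_nat (monotone_hurwitz d g \<alpha> \<beta>) * ((- 1 / ?N) ^ ?r \<alpha> \<beta> * power_sum \<alpha> A * power_sum \<beta> B)"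
      unfolding sum_constant card_C[OF p(2,3)] ..
    finally show "(\<Sum>c\<in>{c \<in> ?G. ?t c = p}. ?w c) = (case p of (\<alpha>, \<beta>) \<Rightarrow>
        of_nat (monotone_hurwitz d g \<alpha> \<beta>) * ((- 1 / ?N) ^ ?r \<alpha> \<beta> * power_sum \<alpha> A * power_sum \<beta> B))"
      by (simp only: p(1) prod.case)
  qed
  also have "\<dots> = (\<Sum>\<alpha>\<in>partitions d. \<Sum>\<beta>\<in>partitions d.
      of_nat (monotone_hurwitz d g \<alpha> \<beta>) * ((- 1 / ?N) ^ ?r \<alpha> \<beta> * power_sum \<alpha> A * power_sum \<beta> B))"
    by (rule sum.cartesian_product[symmetric])
  finally have sum_G: "(\<Sum>c\<in>?G. ?w c) = \<dots>" .
  have "(-1) ^ (d + size \<alpha> + size \<beta>) * of_nat (monotone_hurwitz d g \<alpha> \<beta>) *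
      (power_sum \<alpha> A / ?N ^ size \<alpha>) * (power_sum \<beta> B / ?N ^ size \<beta>) / ?N ^ (2 * g) =
      (-1) ^ d / of_nat (CARD('n)\<^sup>2) *
      (of_nat (monotone_hurwitz d g \<alpha> \<beta>) * ((- 1 / ?N) ^ ?r \<alpha> \<beta> * power_sum \<alpha> A * power_sum \<beta> B))"
    if "\<alpha> \<in> partitions d" "\<beta> \<in> partitions d" for \<alpha> \<beta>
  proof -
    have "1 \<le> size \<alpha>" "1 \<le> size \<beta>" using partitions_size_pos[OF d] that by auto
    then have r: "?r \<alpha> \<beta> + 2 = 2 * g + size \<alpha> + size \<beta>" by linarith
    \<comment> \<open>Raising the exponent by 2 removes the truncated subtraction and produces the
      N^2 that cancels the one in the denominator.\<close>
    have "(- 1 / ?N) ^ ?r \<alpha> \<beta> = (- 1 / ?N) ^ (?r \<alpha> \<beta> + 2) * ?N ^ 2"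
      by (simp add: power_add field_simps power2_eq_square)
    also have "\<dots> = (-1) ^ (size \<alpha> + size \<beta>) * ?N ^ 2 / (?N ^ (2 * g) * ?N ^ size \<alpha> * ?N ^ size \<beta>)"
      unfolding r power_divide power_add power_mult by simp
    finally have x: "(- 1 / ?N) ^ ?r \<alpha> \<beta> =
        (-1) ^ (size \<alpha> + size \<beta>) * ?N ^ 2 / (?N ^ (2 * g) * ?N ^ size \<alpha> * ?N ^ size \<beta>)" .
    show ?thesis unfolding x by (simp add: power_add field_simps)
  qed
  then show "leading_coeff g d A B / ?N ^ (2 * g) = (-1) ^ d / of_nat (CARD('n)\<^sup>2) * (\<Sum>c\<in>?G. ?w c)"
    unfolding sum_G leading_coeff_def sum_distrib_left sum_divide_distrib by (intro sum.cong refl) blast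
qed

theorem theorem0p1:
  fixes A B :: "complex^'n^'n"
    and \<kappa> :: "(complex^'n^'n) measure"
    and D :: "complex set"
    and F :: "complex \<Rightarrow> complex"
    and d :: nat
  assumes "is_unitary_haar \<kappa>"
    and "normal_matrix A" and "normal_matrix B"
    and "is_free_energy \<kappa> A B D F"
    and "1 \<le> d" and "d \<le> CARD('n)"
  shows "summable (\<lambda>g. norm (leading_coeff g d A B / of_nat CARD('n) ^ (2 * g))) \<and>
         (deriv ^^ d) F 0 = (\<Sum>g. leading_coeff g d A B / of_nat CARD('n) ^ (2 * g))"
proof -
  let ?S = "{1..d}" and ?N = "of_nat CARD('n) :: complex"
  let ?w = "config_weight (- 1 / ?N) (\<lambda>k. trace (matrix_power A k)) (\<lambda>k. trace (matrix_power B k)) ?S"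
  let ?G = "\<lambda>g. {c \<in> connected_configs ?S. genus ?S c = g}"
  let ?q = "(-1) ^ d / of_nat (CARD('n)\<^sup>2) :: complex"
  note lc = leading_coeff_eq_sum_configs[OF assms(5)]
  have S: "finite ?S" "?S \<noteq> {}" "card ?S \<le> CARD('n)" using assms(5,6) by auto
  have conn: "connected_configs ?S \<subseteq> configs ?S" by (auto simp: connected_configs_def)
  have "?w abs_summable_on configs ?S"
    by (rule abs_summable_on_config_weight) (use assms(6) in \<open>simp_all add: norm_divide divide_le_eq\<close>)
  then have w: "?w abs_summable_on connected_configs ?S" using conn by (rule summable_on_subset_banach)
  \<comment> \<open>Each connected configuration has exactly one genus, so labelling by the genus
    allows the absolutely convergent sum to be taken genus by genus.\<close>
  have bij: "bij_betw snd (Sigma UNIV ?G) (connected_configs ?S)"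
    by (rule bij_betw_byWitness[where f' = "\<lambda>c. (genus ?S c, c)"]) auto
  have abs: "(\<lambda>p. ?w (snd p)) abs_summable_on Sigma UNIV ?G"
    using w summable_on_reindex_bij_betw[OF bij, of "\<lambda>c. norm (?w c)"] by simp
  have "((\<lambda>p. ?w (snd p)) has_sum (\<Sum>\<^sub>\<infinity>c\<in>connected_configs ?S. ?w c)) (Sigma UNIV ?G)"
    unfolding has_sum_reindex_bij_betw[OF bij] using abs_summable_summable[OF w] by simp
  then have "((\<lambda>g. \<Sum>c\<in>?G g. ?w c) has_sum (\<Sum>\<^sub>\<infinity>c\<in>connected_configs ?S. ?w c)) UNIV"
    by (rule has_sum_Sigma') (use lc(2) in \<open>simp add: has_sum_finite\<close>)
  then have sums: "(\<lambda>g. \<Sum>c\<in>?G g. ?w c) sums ((-1) ^ d * of_nat (CARD('n)\<^sup>2) * (deriv ^^ d) F 0)"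
    using connected_configs_free_energy[OF assms(1,4) S] has_sum_imp_sums by fastforce
  have "(\<lambda>g. ?q * (\<Sum>c\<in>?G g. ?w c)) sums (?q * ((-1) ^ d * of_nat (CARD('n)\<^sup>2) * (deriv ^^ d) F 0))"
    by (rule sums_mult[OF sums])
  also have "?q * ((-1) ^ d * of_nat (CARD('n)\<^sup>2) * (deriv ^^ d) F 0) = (deriv ^^ d) F 0"
    by (simp add: power_mult_distrib[symmetric] mult.assoc[symmetric])
  finally have "(\<lambda>g. leading_coeff g d A B / ?N ^ (2 * g)) sums (deriv ^^ d) F 0"
    by (simp only: lc(1))
  moreover have "summable (\<lambda>g. norm (leading_coeff g d A B / ?N ^ (2 * g)))"
  \<comment> \<open>Collecting terms of equal genus does not increase the sum of norms, so absolute
    convergence over configurations passes to the series over g.\<close>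
  proof (rule summable_comparison_test')
    have "(\<lambda>g. \<Sum>c\<in>?G g. norm (?w c)) summable_on UNIV"
      using abs unfolding Infinite_Sum.abs_summable_on_Sigma_iff
      using lc(2) by (simp add: sum_nonneg)
    then show "summable (\<lambda>g. norm ?q * (\<Sum>c\<in>?G g. norm (?w c)))"
      by (intro summable_mult summable_on_imp_summable)
    show "norm (norm (leading_coeff g d A B / ?N ^ (2 * g))) \<le> norm ?q * (\<Sum>c\<in>?G g. norm (?w c))" for g
      unfolding lc(1) norm_mult[of ?q] real_norm_def abs_mult abs_norm_cancel
      by (intro mult_left_mono norm_sum norm_ge_zero)
  qed
  ultimately show ?thesis by (simp add: sums_iff)
qed

end
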